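(* Let $\Gamma$ be a concave, strictly decreasing curve in the first quadrant with both intercepts equal to $L>0$, given by $y=f(x)$ with inverse function $x=g(y)$, and let $(\alpha,\beta)\in\Gamma$ be a point with $\alpha,\beta>0$. (1) Assume $f\in C^2[0,\alpha]$ with $f'<0$ on $(0,\alpha]$ and $f''<0$ on $[0,\alpha]$, $g\in C^2[0,\beta]$ with $g'<0$ on $(0,\beta]$ and $g''<0$ on $[0,\beta]$, $f''$ is monotonic on $[0,\alpha]$, and $g''$ is monotonic on $[0,\beta]$. Then the optimal stretch factor for minimizing $\mathcal{N}(r,s)$ approaches $1$ as $r\to\infty$: $$\mathcal{S}(r)\subset[1-O(r^{-1/6}),\,1+O(r^{-1/6})],$$ $$\min_{s>0}\mathcal{N}(r,s)=r^2\operatorname{Area}(\Gamma)+rL+O(r^{2/3}).$$ (2) Assume $f\in PC^2(0,\alpha]$ with $f'<0$ and $f''<0$, and $f''$ is monotonic on each subinterval of the partition; and $g\in PC^2(0,\beta]$ with $g'<0$ and $g''<0$, and $g''$ is monotonic on each subinterval of the partition. Suppose there are numbers $a_1,a_2,b_1,b_2>0$ and positive-valued functions $\delta(r),\epsilon(r)$ such that, as $r\to\infty$, $$\delta(r)=O(r^{-2a_1}),\qquad f''(\delta(r))^{-1}=O(r^{1-4a_2}),$$ $$\epsilon(r)=O(r^{-2b_1}),\qquad g''(\epsilon(r))^{-1}=O(r^{1-4b_2}),$$ and let $e=\min\{\tfrac16,a_1,a_2,b_1,b_2\}$. Then, as $r\to\infty$, $$\mathcal{S}(r)\subset[1-O(r^{-e}),\,1+O(r^{-e})],$$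 $$\min_{s>0}\mathcal{N}(r,s)=r^2\operatorname{Area}(\Gamma)+rL+O(r^{1-2e}).$$
   Context: $\mathbb{Z}_+=\{0,1,2,3,\dots\}$. The curve $\Gamma$ is the graph $y=f(x)$, $x\in[0,L]$, of a continuous, concave, strictly decreasing function $f:[0,L]\to[0,L]$ with $f(0)=L$ and $f(L)=0$; $g:[0,L]\to[0,L]$ is the inverse function of $f$. $\operatorname{Area}(\Gamma)$ is the area enclosed by $\Gamma$ and the coordinate axes. For $r,s>0$, the curve $r\Gamma(s)$ is the image of $\Gamma$ under $(x,y)\mapsto(rs^{-1}x,\,rsy)$, i.e. the graph of $x\mapsto rsf(sx/r)$ on $[0,rs^{-1}L]$. The number of nonnegative-integer lattice points inside or on $r\Gamma(s)$ in the closed first quadrant is $$\mathcal{N}(r,s)=\#\{(j,k)\in\mathbb{Z}_+\times\mathbb{Z}_+: js/r\le L,\ k\le rsf(js/r)\}.$$ $\mathcal{S}(r)=\operatorname{arg\,min}_{s>0}\mathcal{N}(r,s)$ denotes the set of all $s>0$ minimizing $s\mapsto\mathcal{N}(r,s)$. The notation $\mathcal{S}(r)\subset[1-O(r^{-c}),1+O(r^{-c})]$ means there exist $C,r_0>0$ such that $|s-1|\le Cr^{-c}$ for all $r\ge r_0$ and all $s\in\mathcal{S}(r)$. Piecewise smoothness: $f\in PC^2(0,\alpha]$ means $f$ is continuous and there is a partition $0=\alpha_0<\alpha_1<\dots<\alpha_l=\alpha$ such that $f\in C^2(0,\alpha_1]$ and $f\in C^2[\alpha_{i-1},\alpha_i]$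 for $i=2,\dots,l$ (restrictions of $f$, with one-sided derivatives at the partition points). Then $f'<0$ means that $f'$ is negative on each of the subintervals $(0,\alpha_1]$ and $[\alpha_{i-1},\alpha_i]$, $i=2,\dots,l$, with derivatives taken in the one-sided senses at the partition points; $f''<0$ is understood analogously. The subintervals of the partition are these same subintervals. The definitions for $g\in PC^2(0,\beta]$ are the same, with a partition $0=\beta_0<\beta_1<\dots<\beta_m=\beta$. *)

theory Defs
  imports "HOL-Analysis.Analysis" "HOL-Library.Landau_Symbols"
begin

definition decreasing_concave_curve :: "real \<Rightarrow> (real \<Rightarrow> real) \<Rightarrow> bool" where
  "decreasing_concave_curve L f \<longleftrightarrow>
     continuous_on {0..L} f \<and> concave_on {0..L} f \<and> strict_antimono_on {0..L} f \<and>
     f 0 = L \<and> f L = 0"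

definition curve_area :: "real \<Rightarrow> (real \<Rightarrow> real) \<Rightarrow> real" where
  "curve_area L f = measure lborel {(x, y). 0 \<le> x \<and> x \<le> L \<and> 0 \<le> y \<and> y \<le> f x}"

definition lattice_count :: "real \<Rightarrow> (real \<Rightarrow> real) \<Rightarrow> real \<Rightarrow> real \<Rightarrow> nat" where
  "lattice_count L f r s =
     card {(j :: nat, k :: nat).
             real j * s / r \<le> L \<and> real k \<le> r * s * f (real j * s / r)}"

definition optimal_stretches :: "real \<Rightarrow> (real \<Rightarrow> real) \<Rightarrow> real \<Rightarrow> real set" where
  "optimal_stretches L f r = {s. is_arg_min (lattice_count L f r) (\<lambda>s. 0 < s) s}"

(* The infimum of a nonempty set of natural numbers belongs to the set, so this is a minimum. *)
definition min_lattice_count :: "real \<Rightarrow> (real \<Rightarrow> real) \<Rightarrow> real \<Rightarrow> nat" where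
  "min_lattice_count L f r = (INF s\<in>{0<..}. lattice_count L f r s)"

definition near_one_with_rate :: "(real \<Rightarrow> real set) \<Rightarrow> real \<Rightarrow> bool" where
  "near_one_with_rate S c \<longleftrightarrow>
     (\<exists>C>0. \<exists>r0>0. \<forall>r\<ge>r0. \<forall>s\<in>S r. \<bar>s - 1\<bar> \<le> C * r powr (- c))"

(* First and second derivative of the restriction of f to S; when S is an interval of positive
   length, these are the one-sided derivatives at the end points belonging to S. *)
definition D1 :: "real set \<Rightarrow> (real \<Rightarrow> real) \<Rightarrow> real \<Rightarrow> real" where
  "D1 S f x = vector_derivative f (at x within S)"

definition D2 :: "real set \<Rightarrow> (real \<Rightarrow> real) \<Rightarrow> real \<Rightarrow> real" where
  "D2 S f = D1 S (D1 S f)"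

definition C2_on :: "real set \<Rightarrow> (real \<Rightarrow> real) \<Rightarrow> bool" where
  "C2_on S f \<longleftrightarrow>
     f differentiable_on S \<and> D1 S f differentiable_on S \<and> continuous_on S (D2 S f)"

definition monotonic_on :: "real set \<Rightarrow> (real \<Rightarrow> real) \<Rightarrow> bool" where
  "monotonic_on S h \<longleftrightarrow> mono_on S h \<or> antimono_on S h"

definition partition_points :: "real \<Rightarrow> nat \<Rightarrow> (nat \<Rightarrow> real) \<Rightarrow> bool" where
  "partition_points a l p \<longleftrightarrow> 0 < l \<and> p 0 = 0 \<and> p l = a \<and> (\<forall>i<l. p i < p (Suc i))"

(* For i < l, the subintervals are indexed from 0; only the first one omits its left end point. *)
definition subinterval :: "(nat \<Rightarrow> real) \<Rightarrow> nat \<Rightarrow> real set" where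
  "subinterval p i = (if i = 0 then {0<..p 1} else {p i..p (Suc i)})"

definition PC2_on :: "real \<Rightarrow> nat \<Rightarrow> (nat \<Rightarrow> real) \<Rightarrow> (real \<Rightarrow> real) \<Rightarrow> bool" where
  "PC2_on a l p f \<longleftrightarrow>
     partition_points a l p \<and> continuous_on {0<..a} f \<and> (\<forall>i<l. C2_on (subinterval p i) f)"

definition smooth_hypotheses :: "real \<Rightarrow> (real \<Rightarrow> real) \<Rightarrow> bool" where
  "smooth_hypotheses a f \<longleftrightarrow>
     C2_on {0..a} f \<and>
     (\<forall>x\<in>{0<..a}. D1 {0..a} f x < 0) \<and>
     (\<forall>x\<in>{0..a}. D2 {0..a} f x < 0) \<and>
     monotonic_on {0..a} (D2 {0..a} f)"

definition piecewise_hypotheses :: "real \<Rightarrow> nat \<Rightarrow> (nat \<Rightarrow> real) \<Rightarrow> (real \<Rightarrow> real) \<Rightarrow> bool" where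
  "piecewise_hypotheses a l p f \<longleftrightarrow>
     PC2_on a l p f \<and>
     (\<forall>i<l. \<forall>x\<in>subinterval p i. D1 (subinterval p i) f x < 0) \<and>
     (\<forall>i<l. \<forall>x\<in>subinterval p i. D2 (subinterval p i) f x < 0) \<and>
     (\<forall>i<l. monotonic_on (subinterval p i) (D2 (subinterval p i) f))"

(* If d r is positive and tends to 0, then d r eventually lies in the interior of the first
   subinterval of any partition, where D2 {0<..a} f is the ordinary second derivative.  So the
   possible failure of f'' to exist at partition points does not affect the second estimate. *)
definition decay_hypotheses ::
  "real \<Rightarrow> (real \<Rightarrow> real) \<Rightarrow> (real \<Rightarrow> real) \<Rightarrow> real \<Rightarrow> real \<Rightarrow> bool" where
  "decay_hypotheses a f d c1 c2 \<longleftrightarrow>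
     (\<forall>r>0. 0 < d r) \<and>
     d \<in> O[at_top](\<lambda>r. r powr (- 2 * c1)) \<and>
     (\<lambda>r. inverse (D2 {0<..a} f (d r))) \<in> O[at_top](\<lambda>r. r powr (1 - 4 * c2))"

end

theory Submission
  imports Defs
begin

text \<open>
  Why the theorem holds.  Write \<open>\<psi> y = frac y - 1 / 2\<close> for the sawtooth function.  The lattice points below
  the stretched curve are counted by columns up to the point corresponding to \<open>(\<alpha>, \<beta>)\<close> and by rows
  below it, and the rectangle counted twice is subtracted.  A column of height \<open>y\<close> contains
  \<open>y + 1 / 2 - \<psi> y\<close> points.  Concavity makes the trapezoidal rule exact up to a bounded error, and so
  (\<open>lattice_count_two_term\<close>)

  \<open>N(r, s) = r\<^sup>2 * Area + r * L * (s + 1 / s) / 2 - (\<psi>-sum over columns) - (\<psi>-sum over rows) + O(1)\<close>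

  uniformly for \<open>s\<close> in a compact subset of \<open>(0, \<infinity>)\<close>.

  The \<open>\<psi>\<close>-sums are \<open>O(r powr (1 - 2 * e))\<close> by van der Corput's method, carried out here for sequences
  and their second differences.  An Erdos-Turan inequality (\<open>erdos_turan_sawtooth\<close>) reduces them to exponential
  sums, which the second derivative test (\<open>second_difference_test\<close>, resting on \<open>kuzmin_landau\<close>) bounds
  when the second differences are of comparable size.  Monotonicity of the second derivative
  makes the second differences monotone and allows a dyadic decomposition (\<open>sawtooth_sum_concave\<close>), and their sum
  telescopes to a bounded difference of slopes.  Each piece of the curve thus contributes
  \<open>O(r powr (2 / 3))\<close> plus \<open>O(sqrt (r / \<kappa>))\<close>, where \<open>\<kappa>\<close> is a lower bound for the curvature on it.  On the
  piece next to the axis the abscissae below \<open>\<delta>(r)\<close> are discarded, and the growth conditions on \<open>\<delta>\<close> and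
  \<open>f''(\<delta>(r))\<close> make both the discarded part and the term with \<open>\<kappa>\<close> small enough
  (\<open>sawtooth_sum_rate\<close>).

  A minimizing \<open>s\<close> does at least as well as \<open>s = 1\<close>.  Since the count exceeds \<open>r\<^sup>2 * Area\<close> by a multiple of
  \<open>r * max s (1 / s)\<close> (\<open>lattice_count_lower\<close>, applied to the curve and its inverse), the minimizing
  \<open>s\<close> stay in a compact set.  There the two-term formula forces
  \<open>s + 1 / s - 2 = (s - 1)\<^sup>2 / s\<close> to be \<open>O(r powr (- 2 * e))\<close>, which is the claimed rate, and the
  asymptotics of the minimum follow (\<open>optimal_stretch_asymptotics\<close>).

  The first part is the second one for the partition with one subinterval, with
  \<open>\<delta>(r) = \<epsilon>(r) = r powr (- 1 / 3)\<close> and all exponents equal to \<open>1 / 6\<close> (\<open>piecewise_of_smooth\<close>).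
\<close>

section \<open>The sawtooth function, exponentials and the cotangent\<close>

definition sawtooth :: "real \<Rightarrow> real" where
  "sawtooth x = frac x - 1 / 2"

definition unit_exp :: "real \<Rightarrow> complex" where
  "unit_exp x = cis (2 * pi * x)"

lemma norm_unit_exp [simp]: "norm (unit_exp x) = 1"
  by (simp add: unit_exp_def)

lemma unit_exp_add: "unit_exp (x + y) = unit_exp x * unit_exp y"
  by (simp add: unit_exp_def cis_mult distrib_left)

lemma unit_exp_minus: "unit_exp (- x) = cnj (unit_exp x)"
  by (simp add: unit_exp_def cis_cnj)

text \<open>
  Equivalent to \<open>y \<le> tan y\<close>; in this form it serves both the sum over monotone
  differences and the tail of the Fejer kernel.
\<close>

lemma cot_le_inverse:
  assumes "0 < y" "y \<le> pi / 2"
  shows "cot y \<le> 1 / y"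
proof -
  have "sin 0 - 0 * cos 0 \<le> sin y - y * cos y"
  proof (rule DERIV_nonneg_imp_nondecreasing[of 0 y "\<lambda>y. sin y - y * cos y"])
    show "0 \<le> y" using assms by simp
    fix x :: real assume x: "0 \<le> x" "x \<le> y"
    have "((\<lambda>y. sin y - y * cos y) has_real_derivative x * sin x) (at x)"
      by (auto intro!: derivative_eq_intros)
    moreover have "0 \<le> x * sin x" using x assms pi_gt_zero by (intro mult_nonneg_nonneg sin_ge_zero) linarith+
    ultimately show "\<exists>D. ((\<lambda>y. sin y - y * cos y) has_real_derivative D) (at x) \<and> 0 \<le> D" by blast
  qed
  moreover have "sin y > 0" using assms pi_gt_zero by (intro sin_gt_zero) linarith+
  ultimately show ?thesis using assms by (simp add: cot_def field_simps)
qed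

lemma cot_antimono:
  assumes "0 < x" "x \<le> y" "y < pi"
  shows "cot y \<le> cot x"
proof -
  have s: "sin x > 0" "sin y > 0" using assms by (auto intro!: sin_gt_zero)
  have "0 \<le> sin (y - x)" using assms by (intro sin_ge_zero) auto
  hence "cos y * sin x \<le> cos x * sin y" by (simp add: sin_diff mult.commute)
  thus ?thesis using s by (simp add: cot_def field_simps)
qed

lemma cot_pi_minus: "cot (pi - y) = - cot y"
  by (simp add: cot_def)

lemma abs_cot_le:
  assumes "0 < t" "t \<le> 1 / 2" "t \<le> q" "q \<le> 1 - t"
  shows "\<bar>cot (pi * q)\<bar> \<le> 1 / (3 * t)"
proof -
  have "0 < pi * t" using assms by simp
  have 1: "cot (pi * t) \<le> 1 / (pi * t)"
    using assms by (intro cot_le_inverse) auto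
  have 2: "1 / (pi * t) \<le> 1 / (3 * t)"
    using assms pi_gt3 by (intro divide_left_mono) (auto intro!: mult_right_mono mult_pos_pos)
  have "cot (pi * q) \<le> cot (pi * t)"
    using assms by (intro cot_antimono) (auto simp: field_simps)
  moreover have "cot (pi - pi * t) \<le> cot (pi * q)"
  proof (rule cot_antimono)
    have "pi * q \<le> pi * (1 - t)" using assms by (intro mult_left_mono) auto
    thus "pi * q \<le> pi - pi * t" by (simp add: algebra_simps)
  qed (use assms in auto)
  ultimately show ?thesis using 1 2 by (simp add: cot_pi_minus abs_le_iff)
qed

lemma cot_plus_of_int: "cot (pi * (x + of_int m)) = cot (pi * x)"
proof -
  have *: "cot (pi * (x + real n)) = cot (pi * x)" for x n
  proof -
    have "cos (pi * x + pi * real n) = (-1) ^ n * cos (pi * x)"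
      "sin (pi * x + pi * real n) = (-1) ^ n * sin (pi * x)"
      by (simp_all add: cos_add sin_add cos_npi2 sin_npi2)
    thus ?thesis by (simp add: cot_def distrib_left)
  qed
  show ?thesis
  proof (cases "m \<ge> 0")
    case True thus ?thesis using *[of x "nat m"] by simp
  next
    case False thus ?thesis using *[of "x + of_int m" "nat (-m)"] by simp
  qed
qed

section \<open>Exponential sums with monotone differences\<close>

text \<open>
  The multiplier \<open>1 / (unit_exp d - 1)\<close> has constant real part \<open>- 1 / 2\<close>, and its imaginary part is
  a monotone function of \<open>d\<close> between consecutive integers.  This is what makes its total variation
  along a monotone sequence a telescoping sum.
\<close>

lemma inverse_unit_exp_minus_one:
  assumes "sin (pi * d) \<noteq> 0"
  shows "(unit_exp d - 1) * Complex (- 1 / 2) (- cot (pi * d) / 2) = 1"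
proof -
  have c2: "cos (2 * pi * d) = 1 - 2 * (sin (pi * d))\<^sup>2"
    using cos_double_sin[of "pi * d"] by (simp add: mult.assoc)
  have s2: "sin (2 * pi * d) = 2 * sin (pi * d) * cos (pi * d)"
    using sin_double[of "pi * d"] by (simp add: mult.assoc)
  show ?thesis unfolding complex_eq_iff
  proof
    show "Re ((unit_exp d - 1) * Complex (- 1 / 2) (- cot (pi * d) / 2)) = Re 1"
      using assms sin_cos_squared_add[of "pi * d"]
      by (simp add: unit_exp_def c2 s2 cot_def power2_eq_square)
    show "Im ((unit_exp d - 1) * Complex (- 1 / 2) (- cot (pi * d) / 2)) = Im 1"
      using assms by (simp add: unit_exp_def c2 s2 cot_def power2_eq_square)
  qed
qed

lemma sum_by_parts_complex:
  fixes E g :: "nat \<Rightarrow> complex"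
  shows "(\<Sum>n<Suc K. (E (Suc n) - E n) * g n) =
    E (Suc K) * g K - E 0 * g 0 - (\<Sum>n<K. E (Suc n) * (g (Suc n) - g n))"
  by (induction K) (auto simp: algebra_simps)

text \<open>
  The Kuzmin-Landau inequality.  Each term is the difference of two consecutive terms times the
  multiplier \<open>g\<close> of \<open>inverse_unit_exp_minus_one\<close>, so summation by parts bounds the sum by the size and the
  total variation of \<open>g\<close>.  Since the differences stay at distance \<open>t\<close> from the integers, both
  are of order \<open>1 / t\<close>.
\<close>

lemma kuzmin_landau:
  fixes x :: "nat \<Rightarrow> real" and t :: real and m :: int
  assumes t: "0 < t" "t \<le> 1 / 2"
    and mono: "\<And>n. Suc (Suc n) < N \<Longrightarrow> x (Suc n) - x n \<le> x (Suc (Suc n)) - x (Suc n)"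
    and range: "\<And>n. Suc n < N \<Longrightarrow> real_of_int m + t \<le> x (Suc n) - x n \<and>
      x (Suc n) - x n \<le> real_of_int m + 1 - t"
  shows "norm (\<Sum>n<N. unit_exp (x n)) \<le> 2 / t"
proof -
  have tt: "2 \<le> 1 / t" using t by (simp add: field_simps)
  consider "N = 0" | "N = 1" | K where "N = Suc (Suc K)"
    by (metis One_nat_def not0_implies_Suc)
  thus ?thesis
  proof cases
    case 1 thus ?thesis using t by simp
  next
    case 2 thus ?thesis using tt by simp
  next
    case 3
    define d where "d n = x (Suc n) - x n" for n
    define c where "c n = cot (pi * d n)" for n
    define g where "g n = Complex (- 1 / 2) (- c n / 2)" for n
    define E where "E n = unit_exp (x n)" for n
    have c_eq: "c n = cot (pi * (d n - m))" for n
      using cot_plus_of_int[of "d n - m" m] by (simp add: c_def)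
    have dr: "t \<le> d n - m" "d n - m \<le> 1 - t" if "n \<le> K" for n
      using range[of n] that 3 by (auto simp: d_def)
    have cb: "\<bar>c n\<bar> \<le> 1 / (3 * t)" if "n \<le> K" for n
      unfolding c_eq using dr[OF that] t by (intro abs_cot_le)
    have cmono: "c (Suc n) \<le> c n" if "n < K" for n
      unfolding c_eq
    proof (rule cot_antimono)
      show "0 < pi * (d n - m)" using dr[of n] that t by simp
      show "pi * (d n - m) \<le> pi * (d (Suc n) - m)"
        using mono[of n] that 3 by (intro mult_left_mono) (auto simp: d_def)
      show "pi * (d (Suc n) - m) < pi" using dr[of "Suc n"] that t by simp
    qed
    have Eg: "E n = (E (Suc n) - E n) * g n" if "n \<le> K" for n
    proof -
      have "pi * (d n - m) > 0" "pi * (d n - m) < pi" using dr[OF that] t by auto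
      hence "sin (pi * (d n - m)) > 0" by (intro sin_gt_zero)
      moreover have "sin (pi * (d n - m)) = sin (pi * d n) * cos (pi * m)"
        by (simp add: sin_diff right_diff_distrib sin_integer_2pi mult.commute)
      ultimately have "sin (pi * d n) \<noteq> 0" by auto
      from inverse_unit_exp_minus_one[OF this] have "(unit_exp (d n) - 1) * g n = 1"
        by (simp add: g_def c_def)
      moreover have "E (Suc n) = E n * unit_exp (d n)"
        by (simp add: E_def d_def flip: unit_exp_add)
      ultimately show ?thesis by (simp add: algebra_simps)
    qed
    have gb: "norm (g n) \<le> 1 / 2 + 1 / (6 * t)" if "n \<le> K" for n
      using cmod_le[of "g n"] cb[OF that] t by (simp add: g_def)
    have "(\<Sum>n<N. unit_exp (x n)) = (\<Sum>n<Suc K. (E (Suc n) - E n) * g n) + E (Suc K)"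
      using Eg by (simp add: 3 E_def[symmetric])
    also have "\<dots> = E (Suc K) * g K - E 0 * g 0 - (\<Sum>n<K. E (Suc n) * (g (Suc n) - g n)) + E (Suc K)"
      by (simp only: sum_by_parts_complex)
    also have "norm \<dots> \<le> norm (g K) + norm (g 0) + (\<Sum>n<K. (c n - c (Suc n)) / 2) + 1"
    proof -
      have 1: "norm (\<Sum>n<K. E (Suc n) * (g (Suc n) - g n)) \<le> (\<Sum>n<K. (c n - c (Suc n)) / 2)"
      proof (intro order_trans[OF norm_sum] sum_mono)
        fix n assume "n \<in> {..<K}"
        hence "c (Suc n) \<le> c n" using cmono by auto
        moreover have "g (Suc n) - g n = Complex 0 ((c n - c (Suc n)) / 2)"
          by (simp add: g_def complex_eq_iff diff_divide_distrib)
        ultimately have "norm (g (Suc n) - g n) \<le> (c n - c (Suc n)) / 2"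
          by (simp add: cmod_def)
        thus "norm (E (Suc n) * (g (Suc n) - g n)) \<le> (c n - c (Suc n)) / 2"
          by (simp only: norm_mult E_def norm_unit_exp mult_1)
      qed
      have "norm (E (Suc K) * g K - E 0 * g 0 - (\<Sum>n<K. E (Suc n) * (g (Suc n) - g n)) + E (Suc K))
        \<le> norm (E (Suc K) * g K) + norm (E 0 * g 0) + norm (\<Sum>n<K. E (Suc n) * (g (Suc n) - g n)) + norm (E (Suc K))"
        by (intro order_trans[OF norm_triangle_ineq] add_right_mono order_trans[OF norm_triangle_ineq4]) simp_all
      thus ?thesis using 1 by (simp add: norm_mult E_def)
    qed
    also have "(\<Sum>n<K. (c n - c (Suc n)) / 2) = (c 0 - c K) / 2"
      unfolding sum_divide_distrib[symmetric] by (simp only: sum_lessThan_telescope')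
    also have "norm (g K) + norm (g 0) + (c 0 - c K) / 2 + 1 \<le> 2 + 1 / (3 * t) + 1 / (3 * t)"
    proof -
      define i where "i = 1 / t"
      have i: "1 / (6 * t) = i / 6" "1 / (3 * t) = i / 3" by (simp_all add: i_def)
      show ?thesis
        using gb[OF order_refl] gb[OF le0] abs_le_D2[OF cb[OF order_refl]] abs_le_D1[OF cb[OF le0]]
        unfolding i by (simp add: field_simps)
    qed
    also have "\<dots> \<le> 2 / t" using tt t by (simp add: field_simps)
    finally show ?thesis .
  qed
qed

lemma initial_segment_split:
  assumes "\<And>n. Suc n < M \<Longrightarrow> P (Suc n) \<Longrightarrow> P n"
  obtains i :: nat where "i \<le> M" "\<And>n. n < M \<Longrightarrow> P n \<longleftrightarrow> n < i"
proof -
  have "\<exists>i\<le>M. \<forall>n<M. P n \<longleftrightarrow> n < i" using assms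
  proof (induction M)
    case (Suc M)
    from Suc.IH Suc.prems obtain i where i: "i \<le> M" "\<forall>n<M. P n \<longleftrightarrow> n < i" by auto
    show ?case
    proof (cases "P M")
      case True
      have "P n" if "n \<le> M" for n
        using that by (induction rule: inc_induct) (auto simp: True intro: Suc.prems)
      thus ?thesis by (intro exI[of _ "Suc M"]) auto
    next
      case False
      thus ?thesis using i by (intro exI[of _ i]) (auto simp: less_Suc_eq)
    qed
  qed auto
  thus ?thesis using that by blast
qed

lemma sum_lessThan_shift_split:
  fixes f :: "nat \<Rightarrow> 'a :: comm_monoid_add"
  assumes "i \<le> N"
  shows "(\<Sum>n<N. f n) = (\<Sum>n<i. f n) + (\<Sum>n<N - i. f (i + n))"
proof -
  have "(\<Sum>n<N. f n) = (\<Sum>n<i. f n) + (\<Sum>n\<in>{i..<N}. f n)"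
    using assms by (subst sum.union_disjoint[symmetric]) (auto intro!: sum.cong)
  also have "(\<Sum>n\<in>{i..<N}. f n) = (\<Sum>n<N - i. f (i + n))"
    by (rule sum.reindex_bij_witness[of _ "\<lambda>n. i + n" "\<lambda>n. n - i"]) auto
  finally show ?thesis .
qed

text \<open>
  On a block where the differences \<open>d n\<close> vary by at most \<open>1 / 2\<close> they come close to at most one
  integer \<open>m\<close>.  Because they increase by at least \<open>l\<close> at each step, only about \<open>2 / sqrt l\<close> of them lie
  within \<open>t = sqrt l\<close> of \<open>m\<close>; these terms are estimated trivially, and the terms before and after
  them by \<open>kuzmin_landau\<close>.
\<close>

lemma exp_sum_short_block:
  fixes x :: "nat \<Rightarrow> real" and l :: real
  assumes l: "0 < l" "l \<le> 1 / 16"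
    and inc: "\<And>n. Suc (Suc n) < N \<Longrightarrow> l \<le> x (Suc (Suc n)) - 2 * x (Suc n) + x n"
    and total: "\<And>j. Suc j < N \<Longrightarrow> (x (Suc j) - x j) - (x 1 - x 0) \<le> 1 / 2"
  shows "norm (\<Sum>n<N. unit_exp (x n)) \<le> 7 / sqrt l"
proof (cases "N = 0")
  case True
  thus ?thesis using l by simp
next
  case False
  define M where "M = N - 1"
  have N: "N = Suc M" using False by (simp add: M_def)
  define d where "d n = x (Suc n) - x n" for n
  define t where "t = sqrt l"
  have t: "0 < t" "t \<le> 1 / 4" "t * t = l"
    using l real_sqrt_le_mono[of l "1/16"] by (auto simp: t_def real_sqrt_divide)
  have t1: "1 \<le> 1 / t" using t by (simp add: field_simps)
  have dinc: "d n + l \<le> d (Suc n)" if "Suc n < M" for n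
    using inc[of n] that N by (simp add: d_def)
  have dstep: "d i + real k * l \<le> d (i + k)" if "i + k < M" for i k
    using that
  proof (induction k)
    case (Suc k)
    thus ?case using dinc[of "i + k"] by (simp add: algebra_simps)
  qed simp
  \<comment> \<open>The only integer that the differences can approach to a distance less than \<open>1 / 4\<close>.\<close>
  define m where "m = \<lfloor>d 0 + 3 / 4\<rfloor>"
  have m: "m \<le> d 0 + 3 / 4" "d 0 + 3 / 4 < m + 1" unfolding m_def by linarith+
  have dr: "m - 3 / 4 \<le> d n" "d n \<le> m + 3 / 4" if "n < M" for n
  proof -
    have "d 0 + real n * l \<le> d (0 + n)" using dstep[of 0 n] that by simp
    moreover have "0 \<le> real n * l" using l by simp
    ultimately show "m - 3 / 4 \<le> d n" using m by simp
    show "d n \<le> m + 3 / 4" using total[of n] that m N by (simp add: d_def)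
  qed
  have "d n < m - t" if "Suc n < M" "d (Suc n) < m - t" for n
    using dinc[of n] that l by simp
  then obtain i where i: "i \<le> M" "\<And>n. n < M \<Longrightarrow> d n < m - t \<longleftrightarrow> n < i"
    using initial_segment_split[of M "\<lambda>n. d n < m - t"] by blast
  have "d n \<le> m + t" if "Suc n < M" "d (Suc n) \<le> m + t" for n
    using dinc[of n] that l by simp
  then obtain j where j: "j \<le> M" "\<And>n. n < M \<Longrightarrow> d n \<le> m + t \<longleftrightarrow> n < j"
    using initial_segment_split[of M "\<lambda>n. d n \<le> m + t"] by blast
  have ij: "i \<le> j"
  proof (rule ccontr)
    assume "\<not> i \<le> j"
    hence "j < i" by simp
    thus False using i(2)[of j] j(2)[of j] i(1) t by auto
  qed
  have 1: "norm (\<Sum>n<i. unit_exp (x n)) \<le> 2 / t"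
  proof (rule kuzmin_landau[where m = "m - 1"])
    fix n
    show "x (Suc n) - x n \<le> x (Suc (Suc n)) - x (Suc n)" if "Suc (Suc n) < i"
      using dinc[of n] that i l by (simp add: d_def)
    show "real_of_int (m - 1) + t \<le> x (Suc n) - x n \<and> x (Suc n) - x n \<le> real_of_int (m - 1) + 1 - t"
      if "Suc n < i"
      using that i(2)[of n] i(1) dr[of n] t by (simp add: d_def)
  qed (use t in auto)
  have 3: "norm (\<Sum>n<N - j. unit_exp (x (j + n))) \<le> 2 / t"
  proof (rule kuzmin_landau[where m = m])
    fix n
    show "x (j + Suc n) - x (j + n) \<le> x (j + Suc (Suc n)) - x (j + Suc n)" if "Suc (Suc n) < N - j"
    proof -
      have "Suc (j + n) < M" using that N by arith
      thus ?thesis using dinc[of "j + n"] l by (simp add: d_def)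
    qed
    show "real_of_int m + t \<le> x (j + Suc n) - x (j + n) \<and> x (j + Suc n) - x (j + n) \<le> real_of_int m + 1 - t"
      if "Suc n < N - j"
    proof -
      have "j + n < M" using that N by arith
      thus ?thesis using that j(2)[of "j + n"] dr[of "j + n"] t by (simp add: d_def)
    qed
  qed (use t in auto)
  have 2: "norm (\<Sum>n<j - i. unit_exp (x (i + n))) \<le> 3 / t"
  proof (cases "i = j")
    case True
    thus ?thesis using t by simp
  next
    case False
    define k where "k = j - i - 1"
    have k: "j = Suc (i + k)" using False ij by (simp add: k_def)
    have "d (i + k) \<le> m + t" using j(2)[of "i + k"] j(1) k by simp
    moreover have "m - t \<le> d i" using i(2)[of i] j(1) k by auto
    moreover have "d i + real k * l \<le> d (i + k)" using dstep[of i k] j(1) k by simp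
    ultimately have "real k * l \<le> 2 * t" by simp
    hence "(real k * t) * t \<le> 2 * t" by (simp add: t(3)[symmetric] mult.assoc)
    hence "real k * t \<le> 2" using t by simp
    hence "real k \<le> 2 / t" using t by (simp add: field_simps)
    moreover have "norm (\<Sum>n<j - i. unit_exp (x (i + n))) \<le> real k + 1"
      using norm_sum[of "\<lambda>n. unit_exp (x (i + n))" "{..<j - i}"] k by simp
    ultimately show ?thesis using t1 by simp
  qed
  have "(\<Sum>n<N. unit_exp (x n)) = (\<Sum>n<i. unit_exp (x n)) + (\<Sum>n<j - i. unit_exp (x (i + n)))
      + (\<Sum>n<N - j. unit_exp (x (j + n)))"
    using ij j(1) sum_lessThan_shift_split[of j N "\<lambda>n. unit_exp (x n)"]
      sum_lessThan_shift_split[of i j "\<lambda>n. unit_exp (x n)"] by (simp only: N le_SucI)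
  also have "norm \<dots> \<le> 2 / t + 3 / t + 2 / t"
    by (intro order_trans[OF norm_triangle_ineq] add_mono 1 2 3)
  finally show ?thesis by (simp add: t_def)
qed

text \<open>
  Van der Corput's second derivative test for sequences: cutting the range into about
  \<open>8 * l * N + 1\<close> blocks of length about \<open>1 / (4 * l)\<close> makes the differences vary by at most \<open>1 / 2\<close>
  on each block.
\<close>

lemma second_difference_test:
  fixes x :: "nat \<Rightarrow> real" and l :: real
  assumes l: "0 < l"
    and c: "\<And>n. Suc (Suc n) < N \<Longrightarrow> l \<le> x (Suc (Suc n)) - 2 * x (Suc n) + x n \<and>
      x (Suc (Suc n)) - 2 * x (Suc n) + x n \<le> 2 * l"
  shows "norm (\<Sum>n<N. unit_exp (x n)) \<le> 56 * (N * sqrt l + 1 / sqrt l)"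
proof (cases "l \<le> 1 / 16")
  case False
  hence "sqrt (1 / 16) \<le> sqrt l" by (intro real_sqrt_le_mono) simp
  hence "1 / 4 \<le> sqrt l" by (simp add: real_sqrt_divide)
  hence "real N * 1 \<le> real N * (56 * sqrt l)" by (intro mult_left_mono) auto
  moreover have "norm (\<Sum>n<N. unit_exp (x n)) \<le> N"
    using norm_sum[of "\<lambda>n. unit_exp (x n)" "{..<N}"] by simp
  moreover have "0 \<le> 56 * (1 / sqrt l)" using l by simp
  ultimately show ?thesis unfolding distrib_left by linarith
next
  case True
  define H where "H = nat \<lfloor>1 / (4 * l)\<rfloor>"
  have l4: "4 \<le> 1 / (4 * l)" using l True by (simp add: field_simps)
  have H: "real H \<le> 1 / (4 * l)" "1 / (4 * l) - 1 \<le> real H"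
    using l4 unfolding H_def by linarith+
  hence H1: "H \<ge> 1" "real H \<ge> 1 / (8 * l)"
    using l4 by (auto simp: field_simps)
  have block: "norm (\<Sum>n<M. unit_exp (y n)) \<le> 7 / sqrt l"
    if M: "M \<le> H" and y: "\<And>n. Suc (Suc n) < M \<Longrightarrow> l \<le> y (Suc (Suc n)) - 2 * y (Suc n) + y n \<and>
      y (Suc (Suc n)) - 2 * y (Suc n) + y n \<le> 2 * l" for M and y :: "nat \<Rightarrow> real"
  proof (rule exp_sum_short_block[OF l \<open>l \<le> 1 / 16\<close>])
    fix j assume j: "Suc j < M"
    hence "(y (Suc j) - y j) - (y 1 - y 0) \<le> real j * (2 * l)"
    proof (induction j)
      case (Suc j)
      thus ?case using y[of j] by (simp add: algebra_simps)
    qed simp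
    also have "\<dots> \<le> real H * (2 * l)"
      using l j M by (intro mult_right_mono) auto
    also have "\<dots> \<le> 1 / (4 * l) * (2 * l)"
      using H l by (intro mult_right_mono) auto
    finally show "(y (Suc j) - y j) - (y 1 - y 0) \<le> 1 / 2" using l by simp
  qed (use y in auto)
  have "norm (\<Sum>n<N. unit_exp (x n)) \<le> (N / H + 1) * (7 / sqrt l)"
    using c
  proof (induction N arbitrary: x rule: less_induct)
    case (less N)
    show ?case
    proof (cases "N \<le> H")
      case True
      have "norm (\<Sum>n<N. unit_exp (x n)) \<le> 7 / sqrt l"
        by (rule block) (use less.prems True in auto)
      also have "\<dots> = 1 * (7 / sqrt l)" by simp
      also have "\<dots> \<le> (N / H + 1) * (7 / sqrt l)"
        using l by (intro mult_right_mono) auto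
      finally show ?thesis .
    next
      case False
      have "norm (\<Sum>n<H. unit_exp (x n)) \<le> 7 / sqrt l"
        by (rule block) (use less.prems False in auto)
      hence 1: "norm (\<Sum>n<H. unit_exp (x n)) \<le> (H / H + 1) * (7 / sqrt l) - 7 / sqrt l"
        using H1 by simp
      have 2: "norm (\<Sum>n<N - H. unit_exp (x (H + n))) \<le> (real (N - H) / H + 1) * (7 / sqrt l)"
      proof (rule less.IH)
        show "N - H < N" using H1 False by simp
        fix n assume "Suc (Suc n) < N - H"
        thus "l \<le> x (H + Suc (Suc n)) - 2 * x (H + Suc n) + x (H + n) \<and>
          x (H + Suc (Suc n)) - 2 * x (H + Suc n) + x (H + n) \<le> 2 * l"
          using less.prems[of "H + n"] by simp
      qed
      have "norm (\<Sum>n<N. unit_exp (x n)) \<le>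
          norm (\<Sum>n<H. unit_exp (x n)) + norm (\<Sum>n<N - H. unit_exp (x (H + n)))"
        using False by (simp add: sum_lessThan_shift_split[of H N] norm_triangle_ineq)
      also have "\<dots> \<le> (H / H + real (N - H) / H + 1) * (7 / sqrt l)"
        using 1 2 by (simp add: algebra_simps)
      also have "real H / H + real (N - H) / H = N / H"
      proof -
        have "real H + real (N - H) = real N" using False by simp
        thus ?thesis by (simp only: add_divide_distrib[symmetric])
      qed
      finally show ?thesis .
    qed
  qed
  also have "\<dots> \<le> (8 * l * N + 1) * (7 / sqrt l)"
  proof (intro mult_right_mono add_right_mono)
    have "real N / H \<le> real N / (1 / (8 * l))"
      using H1 l by (intro divide_left_mono) auto
    thus "real N / H \<le> 8 * l * N" by (simp add: mult.commute)
  qed (use l in auto)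
  also have "(8 * l * N + 1) * (7 / sqrt l) = 56 * (N * (l / sqrt l)) + 7 * (1 / sqrt l)"
    by (simp add: algebra_simps)
  also have "l / sqrt l = sqrt l" using l by (simp add: real_div_sqrt)
  also have "56 * (N * sqrt l) + 7 * (1 / sqrt l) \<le> 56 * (N * sqrt l + 1 / sqrt l)"
  proof -
    have "0 \<le> 1 / sqrt l" using l by simp
    thus ?thesis unfolding distrib_left by linarith
  qed
  finally show ?thesis .
qed

section \<open>An Erdos-Turan inequality for the sawtooth function\<close>

lemma sawtooth_bounds: "\<bar>sawtooth x\<bar> \<le> 1 / 2"
  unfolding sawtooth_def frac_def by linarith

lemma sawtooth_periodic: "sawtooth (x + 1) = sawtooth x"
  by (simp add: sawtooth_def frac_1_eq)

lemma sawtooth_add_le: "0 \<le> u \<Longrightarrow> sawtooth (x + u) \<le> sawtooth x + u"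
  by (simp add: sawtooth_def frac_def floor_mono)

lemma frac_add_cases:
  assumes "0 \<le> t" "t \<le> 1"
  shows "t < 1 - frac x \<Longrightarrow> frac (x + t) = frac x + t"
    and "1 - frac x \<le> t \<Longrightarrow> frac (x + t) = frac x + t - 1"
proof -
  have "x + t - (frac x + t) \<in> \<int>" "x + t - (frac x + t - 1) \<in> \<int>"
    by (simp_all add: frac_def)
  thus "t < 1 - frac x \<Longrightarrow> frac (x + t) = frac x + t"
    "1 - frac x \<le> t \<Longrightarrow> frac (x + t) = frac x + t - 1"
    using assms frac_ge_0[of x] frac_lt_1[of x] by (auto simp: frac_unique_iff)
qed

text \<open>
  The function \<open>t \<mapsto> sawtooth (x + t)\<close> is affine on \<open>[0, 1]\<close> apart from the jump at
  \<open>t = 1 - frac x\<close>, so its integral against a weight is read off from antiderivatives of the two affine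
  pieces.
\<close>

lemma has_integral_sawtooth_times:
  fixes w :: "real \<Rightarrow> real"
  assumes A: "\<And>a t. (A a has_vector_derivative (a + t) * w t) (at t)"
  shows "((\<lambda>t. sawtooth (x + t) * w t) has_integral
    (A (frac x - 1 / 2) (1 - frac x) - A (frac x - 1 / 2) 0) +
    (A (frac x - 3 / 2) 1 - A (frac x - 3 / 2) (1 - frac x))) {0..1}"
proof (rule has_integral_combine[of 0 "1 - frac x" 1])
  have f: "0 \<le> frac x" "frac x < 1" using frac_ge_0 frac_lt_1 by auto
  show "0 \<le> 1 - frac x" "1 - frac x \<le> 1" using f by auto
  have ft: "((\<lambda>t. (a + t) * w t) has_integral A a v - A a u) {u..v}" if "u \<le> v" for a u v
    using that by (intro fundamental_theorem_of_calculus) (auto intro: has_vector_derivative_at_within[OF A])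
  show "((\<lambda>t. sawtooth (x + t) * w t) has_integral A (frac x - 1 / 2) (1 - frac x) - A (frac x - 1 / 2) 0) {0..1 - frac x}"
  proof (rule has_integral_spike_finite[OF _ _ ft])
    fix t assume "t \<in> {0..1 - frac x} - {1 - frac x}"
    thus "sawtooth (x + t) * w t = (frac x - 1 / 2 + t) * w t"
      using frac_add_cases(1)[of t x] f by (simp add: sawtooth_def)
  qed (use f in auto)
  show "((\<lambda>t. sawtooth (x + t) * w t) has_integral A (frac x - 3 / 2) 1 - A (frac x - 3 / 2) (1 - frac x)) {1 - frac x..1}"
  proof (rule has_integral_spike_finite[OF _ _ ft])
    fix t assume "t \<in> {1 - frac x..1} - {}"
    thus "sawtooth (x + t) * w t = (frac x - 3 / 2 + t) * w t"
      using frac_add_cases(2)[of t x] f by (simp add: sawtooth_def)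
  qed (use f in auto)
qed

lemma sin_two_pi_frac: "sin (2 * pi * real k * frac x) = sin (2 * pi * real k * x)"
proof -
  have "2 * pi * real k * x = 2 * pi * real k * frac x + 2 * pi * of_int (int k * \<lfloor>x\<rfloor>)"
    by (simp add: frac_def algebra_simps)
  moreover have "sin (2 * pi * of_int (int k * \<lfloor>x\<rfloor>)) = 0" "cos (2 * pi * of_int (int k * \<lfloor>x\<rfloor>)) = 1"
    using sin_int_2pin[of "int k * \<lfloor>x\<rfloor>"] cos_int_2pin[of "int k * \<lfloor>x\<rfloor>"] by blast+
  ultimately show ?thesis by (simp add: sin_add)
qed

text \<open>
  The cosine coefficients of \<open>t \<mapsto> sawtooth (x + t)\<close> on \<open>[0, 1]\<close>.
\<close>

definition sawtooth_coeff :: "real \<Rightarrow> nat \<Rightarrow> real" where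
  "sawtooth_coeff x k = (if k = 0 then 0 else - sin (2 * pi * k * x) / (2 * pi * k))"

lemma has_integral_sawtooth_cos:
  "((\<lambda>t. sawtooth (x + t) * cos (2 * pi * real k * t)) has_integral sawtooth_coeff x k) {0..1}"
proof (cases "k = 0")
  case True
  have "((\<lambda>t. sawtooth (x + t) * 1) has_integral
    (((frac x - 1 / 2) * (1 - frac x) + (1 - frac x)\<^sup>2 / 2) - ((frac x - 1 / 2) * 0 + 0\<^sup>2 / 2)) +
    (((frac x - 3 / 2) * 1 + 1\<^sup>2 / 2) - ((frac x - 3 / 2) * (1 - frac x) + (1 - frac x)\<^sup>2 / 2))) {0..1}"
    by (rule has_integral_sawtooth_times[where A = "\<lambda>a t. a * t + t\<^sup>2 / 2"])
      (auto intro!: derivative_eq_intros simp flip: has_real_derivative_iff_has_vector_derivative)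
  moreover have "(((frac x - 1 / 2) * (1 - frac x) + (1 - frac x)\<^sup>2 / 2) - ((frac x - 1 / 2) * 0 + 0\<^sup>2 / 2)) +
    (((frac x - 3 / 2) * 1 + 1\<^sup>2 / 2) - ((frac x - 3 / 2) * (1 - frac x) + (1 - frac x)\<^sup>2 / 2)) = 0"
    by (simp add: power2_eq_square field_simps)
  ultimately show ?thesis using True by (simp add: sawtooth_coeff_def)
next
  case False
  define w where "w = 2 * pi * real k"
  define A where "A a t = (a + t) * sin (w * t) / w + cos (w * t) / w\<^sup>2" for a t
  have w: "w > 0" using False by (simp add: w_def)
  have "((\<lambda>t. sawtooth (x + t) * cos (w * t)) has_integral
    (A (frac x - 1 / 2) (1 - frac x) - A (frac x - 1 / 2) 0) +
    (A (frac x - 3 / 2) 1 - A (frac x - 3 / 2) (1 - frac x))) {0..1}"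
  proof (rule has_integral_sawtooth_times)
    fix a t
    have "(A a has_real_derivative (a + t) * cos (w * t)) (at t)"
      unfolding A_def using w
      by (auto intro!: derivative_eq_intros simp: field_simps power2_eq_square)
    thus "(A a has_vector_derivative (a + t) * cos (w * t)) (at t)"
      by (simp add: has_real_derivative_iff_has_vector_derivative)
  qed
  moreover have "(A (frac x - 1 / 2) (1 - frac x) - A (frac x - 1 / 2) 0) +
    (A (frac x - 3 / 2) 1 - A (frac x - 3 / 2) (1 - frac x)) = sin (w * (1 - frac x)) / w"
    using w cos_int_2pin[of k] sin_int_2pin[of k]
    by (simp add: A_def w_def field_simps)
  moreover have "sin (w * (1 - frac x)) = - sin (w * frac x)"
    using cos_int_2pin[of k] sin_int_2pin[of k]
    by (simp add: w_def right_diff_distrib sin_diff)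
  moreover have "sin (w * frac x) = sin (w * x)"
    unfolding w_def by (rule sin_two_pi_frac)
  ultimately show ?thesis using False by (simp add: sawtooth_coeff_def w_def)
qed

lemma has_integral_cos_nat:
  "((\<lambda>t. cos (2 * pi * real k * t)) has_integral (if k = 0 then 1 else 0)) {0..1}"
proof (cases "k = 0")
  case True
  thus ?thesis using has_integral_const_real[of "1::real" 0 1] by simp
next
  case False
  have "((\<lambda>t. cos (2 * pi * real k * t)) has_integral
      sin (2 * pi * real k * 1) / (2 * pi * real k) - sin (2 * pi * real k * 0) / (2 * pi * real k)) {0..1}"
    using False
    by (intro fundamental_theorem_of_calculus)
      (auto intro!: derivative_eq_intros simp flip: has_real_derivative_iff_has_vector_derivative)
  thus ?thesis using False sin_int_2pin[of k] by simp
qed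

definition nat_dist :: "nat \<Rightarrow> nat \<Rightarrow> nat" where
  "nat_dist i j = (if i \<le> j then j - i else i - j)"

definition fejer :: "nat \<Rightarrow> real \<Rightarrow> real" where
  "fejer K t = (norm (\<Sum>j<K. unit_exp (real j * t)))\<^sup>2 / K"

lemma fejer_nonneg: "0 \<le> fejer K t"
  by (simp add: fejer_def)

lemma fejer_expand: "fejer K t = (\<Sum>i<K. \<Sum>j<K. cos (2 * pi * real (nat_dist i j) * t)) / K"
proof -
  have "(norm (\<Sum>j<K. unit_exp (real j * t)))\<^sup>2 =
     (\<Sum>j<K. cos (2 * pi * (real j * t)))\<^sup>2 + (\<Sum>j<K. sin (2 * pi * (real j * t)))\<^sup>2"
    by (simp add: cmod_power2 unit_exp_def)
  also have "\<dots> = (\<Sum>i<K. \<Sum>j<K. cos (2 * pi * (real i * t) - 2 * pi * (real j * t)))"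
    by (simp add: power2_eq_square sum_product cos_diff sum.distrib)
  also have "\<dots> = (\<Sum>i<K. \<Sum>j<K. cos (2 * pi * real (nat_dist i j) * t))"
  proof (intro sum.cong refl)
    fix i j
    have "cos (2 * pi * (real i * t) - 2 * pi * (real j * t)) = cos (2 * pi * (real j * t) - 2 * pi * (real i * t))"
      using cos_minus[of "2 * pi * (real i * t) - 2 * pi * (real j * t)"] by (simp add: algebra_simps)
    thus "cos (2 * pi * (real i * t) - 2 * pi * (real j * t)) = cos (2 * pi * real (nat_dist i j) * t)"
      by (auto simp: nat_dist_def of_nat_diff algebra_simps)
  qed
  finally show ?thesis by (simp add: fejer_def)
qed

lemma fejer_le:
  assumes "sin (pi * t) \<noteq> 0"
  shows "fejer K t \<le> inverse ((sin (pi * t))\<^sup>2) / K"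
proof -
  have *: "norm (unit_exp y - 1) = 2 * \<bar>sin (pi * y)\<bar>" for y
  proof -
    have "(norm (unit_exp y - 1))\<^sup>2 = (cos (2 * (pi * y)) - 1)\<^sup>2 + (sin (2 * (pi * y)))\<^sup>2"
      by (simp add: cmod_power2 unit_exp_def mult.assoc)
    also have "\<dots> = 2 - 2 * cos (2 * (pi * y))"
      using sin_cos_squared_add[of "2 * (pi * y)"] by (simp add: power2_eq_square algebra_simps)
    also have "\<dots> = (2 * \<bar>sin (pi * y)\<bar>)\<^sup>2"
      unfolding cos_double_sin[of "pi * y"] by (simp add: power_mult_distrib)
    finally show ?thesis by (rule power2_eq_imp_eq) auto
  qed
  have "(\<Sum>j<K. unit_exp (real j * t)) * (unit_exp t - 1) = unit_exp (real K * t) - 1"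
  proof (induction K)
    case 0 show ?case by (simp add: unit_exp_def)
  next
    case (Suc K)
    have "unit_exp (real (Suc K) * t) = unit_exp (real K * t) * unit_exp t"
      by (simp add: distrib_right add.commute flip: unit_exp_add)
    thus ?case using Suc by (simp add: algebra_simps)
  qed
  hence "norm (\<Sum>j<K. unit_exp (real j * t)) * (2 * \<bar>sin (pi * t)\<bar>) = 2 * \<bar>sin (pi * (real K * t))\<bar>"
    by (metis * norm_mult)
  hence "norm (\<Sum>j<K. unit_exp (real j * t)) * \<bar>sin (pi * t)\<bar> \<le> 1" by simp
  hence "norm (\<Sum>j<K. unit_exp (real j * t)) \<le> inverse \<bar>sin (pi * t)\<bar>"
    using assms by (simp add: field_simps)
  hence "(norm (\<Sum>j<K. unit_exp (real j * t)))\<^sup>2 \<le> (inverse \<bar>sin (pi * t)\<bar>)\<^sup>2"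
    by (intro power_mono) auto
  thus ?thesis unfolding fejer_def by (intro divide_right_mono) (auto simp: power_inverse)
qed

lemma has_integral_fejer:
  assumes "K > 0"
  shows "(fejer K has_integral 1) {0..1}"
proof -
  have "((\<lambda>t. (\<Sum>i<K. \<Sum>j<K. cos (2 * pi * real (nat_dist i j) * t)) / K) has_integral
      (\<Sum>i<K. \<Sum>j<K. (if nat_dist i j = 0 then 1 else 0)) / K) {0..1}"
    by (intro has_integral_divide has_integral_sum has_integral_cos_nat finite_lessThan)
  moreover have "(nat_dist i j = 0) = (i = j)" for i j by (auto simp: nat_dist_def)
  ultimately show ?thesis using assms
    by (simp add: sum.delta fejer_expand[abs_def])
qed

lemma has_integral_csc_squared:
  assumes "0 < u" "u \<le> v" "v < 1"
  shows "((\<lambda>t. inverse ((sin (pi * t))\<^sup>2)) has_integral (cot (pi * u) - cot (pi * v)) / pi) {u..v}"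
proof -
  have "((\<lambda>t. inverse ((sin (pi * t))\<^sup>2)) has_integral (- cot (pi * v) / pi - (- cot (pi * u) / pi))) {u..v}"
  proof (rule fundamental_theorem_of_calculus)
    fix t assume "t \<in> {u..v}"
    hence "sin (pi * t) > 0" using assms by (intro sin_gt_zero) auto
    hence "((\<lambda>t. - cot (pi * t) / pi) has_real_derivative inverse ((sin (pi * t))\<^sup>2)) (at t)"
      by (auto intro!: derivative_eq_intros DERIV_chain2[OF DERIV_cot])
    thus "((\<lambda>t. - cot (pi * t) / pi) has_vector_derivative inverse ((sin (pi * t))\<^sup>2)) (at t within {u..v})"
      by (simp add: has_vector_derivative_at_within has_real_derivative_iff_has_vector_derivative)
  qed (use assms in auto)
  thus ?thesis by (simp add: diff_divide_distrib)
qed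

text \<open>
  Most of the mass of the Fejer kernel lies within \<open>1 / K\<close> of the integers: the rest has mass at
  most \<open>2 / pi\<^sup>2 \<le> 2 / 9\<close>.  Hence a function bounded below by \<open>v\<close> near the integers and by \<open>- E\<close>
  everywhere has Fejer mean at least \<open>v - 4 / 9 * E\<close>.
\<close>

lemma fejer_window:
  fixes G :: "real \<Rightarrow> real"
  assumes K: "K \<ge> 2" and E: "0 \<le> E" "v \<le> E"
    and I: "((\<lambda>t. G t * fejer K t) has_integral I) {0..1}"
    and low: "\<And>t. t \<in> {0..1} \<Longrightarrow> - E \<le> G t"
    and win: "\<And>t. t \<in> {0..1} \<Longrightarrow> t \<le> 1 / K \<or> 1 - 1 / K \<le> t \<Longrightarrow> v \<le> G t"
  shows "v \<le> I + 4 / 9 * E"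
proof -
  define u where "u = 1 / real K"
  have u: "0 < u" "u \<le> 1 / 2" using K by (auto simp: u_def field_simps)
  \<comment> \<open>The bound \<open>fejer_le\<close> for the kernel, restricted to the part away from the integers.\<close>
  define w where "w t = (if t \<in> {u..1 - u} then inverse ((sin (pi * t))\<^sup>2) / K else 0)" for t
  define p where "p = (cot (pi * u) - cot (pi * (1 - u))) / pi / K"
  have wint: "(w has_integral p) {0..1}"
    unfolding w_def
  proof (subst has_integral_restrict)
    show "((\<lambda>t. inverse ((sin (pi * t))\<^sup>2) / real K) has_integral p) {u..1 - u}"
      unfolding p_def using u by (intro has_integral_divide has_integral_csc_squared) auto
  qed (use u in auto)
  have "((\<lambda>t. v * fejer K t - 2 * E * w t) has_integral v * 1 - 2 * E * p) {0..1}"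
    using K by (intro has_integral_diff has_integral_mult_right wint has_integral_fejer) auto
  hence "v * 1 - 2 * E * p \<le> I"
  proof (rule has_integral_le[OF _ I])
    fix t :: real assume t: "t \<in> {0..1}"
    have w0: "0 \<le> w t" by (simp add: w_def)
    have F0: "0 \<le> fejer K t" by (rule fejer_nonneg)
    show "v * fejer K t - 2 * E * w t \<le> G t * fejer K t"
    proof (cases "t \<le> u \<or> 1 - u \<le> t")
      case True
      hence "v * fejer K t \<le> G t * fejer K t" using win[OF t] F0 by (intro mult_right_mono) (auto simp: u_def)
      moreover have "0 \<le> 2 * E * w t" using E w0 by simp
      ultimately show ?thesis by linarith
    next
      case False
      hence tu: "u < t" "t < 1 - u" by auto
      have "sin (pi * t) > 0" using tu u by (intro sin_gt_zero) auto
      hence "fejer K t \<le> w t" using fejer_le[of t K] tu by (simp add: w_def)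
      hence "E * fejer K t \<le> E * w t" using E by (intro mult_left_mono)
      moreover have "v * fejer K t \<le> E * fejer K t" using E F0 by (intro mult_right_mono)
      moreover have "- E * fejer K t \<le> G t * fejer K t" using low[OF t] F0 by (intro mult_right_mono)
      ultimately show ?thesis by linarith
    qed
  qed
  moreover have "p \<le> 2 / 9"
  proof -
    have "cot (pi * (1 - u)) = - cot (pi * u)" using cot_pi_minus[of "pi * u"] by (simp add: right_diff_distrib)
    hence "p = 2 * cot (pi * u) / pi / K" by (simp add: p_def)
    also have "\<dots> \<le> 2 * (1 / (pi * u)) / pi / K"
      using u by (intro divide_right_mono mult_left_mono cot_le_inverse) auto
    also have "\<dots> = 2 / (pi * pi)" using K by (simp add: u_def field_simps)
    also have "\<dots> \<le> 2 / (3 * 3)"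
      using pi_gt3 by (intro divide_left_mono mult_mono) auto
    finally show ?thesis by simp
  qed
  hence "2 * E * p \<le> 2 * E * (2 / 9)" using E by (intro mult_left_mono) auto
  ultimately show ?thesis by simp
qed

lemma sum_nat_dist_le:
  fixes b :: "nat \<Rightarrow> real"
  assumes "i < K" "b 0 = 0" "\<And>k. 0 \<le> b k"
  shows "(\<Sum>j<K. b (nat_dist i j)) \<le> 2 * (\<Sum>k\<in>{1..<K}. b k)"
proof -
  have "(\<Sum>j<K. b (nat_dist i j)) = (\<Sum>j<i. b (nat_dist i j)) + (\<Sum>j<K - i. b (nat_dist i (i + j)))"
    using assms by (intro sum_lessThan_shift_split) auto
  also have "(\<Sum>j<i. b (nat_dist i j)) = (\<Sum>k\<in>{1..i}. b k)"
    by (rule sum.reindex_bij_witness[of _ "\<lambda>k. i - k" "\<lambda>j. i - j"]) (auto simp: nat_dist_def)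
  also have "\<dots> \<le> (\<Sum>k\<in>{1..<K}. b k)"
    using assms by (intro sum_mono2) auto
  also have "(\<Sum>j<K - i. b (nat_dist i (i + j))) = (\<Sum>j<K - i. b j)"
    by (simp add: nat_dist_def)
  also have "\<dots> = (\<Sum>j\<in>{1..<K - i}. b j)"
    using assms(2) by (intro sum.mono_neutral_right) (auto simp: not_le less_Suc_eq_0_disj)
  also have "\<dots> \<le> (\<Sum>k\<in>{1..<K}. b k)"
    using assms by (intro sum_mono2) auto
  finally show ?thesis by simp
qed

text \<open>
  An inequality of Erdos-Turan type.  Let \<open>G y\<close> be the sum of \<open>sawtooth (x n + y)\<close>, and \<open>E\<close> the supremum
  of its absolute value.  Since \<open>G\<close> grows at most with slope \<open>N\<close>, being nearly \<open>E\<close> at \<open>y\<close> forces it to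
  be at least \<open>9 / 10 * E - 2 * N / K\<close> on the window of length \<open>2 / K\<close> to the left of \<open>y\<close>; when it is
  nearly \<open>- E\<close>, the window to the right plays the same role.  Averaging over this window with the Fejer
  kernel leaves a finite trigonometric sum, and the kernel's mass outside the window is too small
  to undo the lower bound.  Working with the supremum over all shifts makes the estimate
  self-improving, so that no infinite Fourier series is involved.
\<close>

lemma erdos_turan_sawtooth:
  fixes x :: "nat \<Rightarrow> real" and K N :: nat
  assumes "K \<ge> 1"
  shows "\<bar>\<Sum>n<N. sawtooth (x n)\<bar> \<le> 5 * N / K + (\<Sum>k\<in>{1..<K}. norm (\<Sum>n<N. unit_exp (k * x n)) / k)"
proof (cases "K = 1")
  case True
  have "\<bar>\<Sum>n<N. sawtooth (x n)\<bar> \<le> (\<Sum>n<N. 1 / 2)"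
    by (intro order_trans[OF sum_abs] sum_mono sawtooth_bounds)
  thus ?thesis using True by simp
next
  case False
  hence K: "K \<ge> 2" using assms by simp
  define S where "S k = norm (\<Sum>n<N. unit_exp (real k * x n))" for k
  define B where "B = (\<Sum>k\<in>{1..<K}. S k / k)"
  define G where "G y = (\<Sum>n<N. sawtooth (x n + y))" for y
  define I where "I y = (\<Sum>i<K. \<Sum>j<K. \<Sum>n<N. sawtooth_coeff (x n + y) (nat_dist i j)) / K" for y
  have G_periodic: "G (y + 1) = G y" for y
    unfolding G_def by (simp add: sawtooth_periodic flip: add.assoc)
  have G_add: "G (y + u) \<le> G y + N * u" if "0 \<le> u" for y u :: real
  proof -
    have "G (y + u) \<le> (\<Sum>n<N. sawtooth (x n + y) + u)"
      unfolding G_def using sawtooth_add_le[OF that] by (intro sum_mono) (simp flip: add.assoc)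
    thus ?thesis by (simp add: G_def sum.distrib)
  qed
  have G_int: "((\<lambda>t. G (y + t) * fejer K t) has_integral I y) {0..1}" for y
  proof -
    have "G (y + t) * fejer K t =
      (\<Sum>i<K. \<Sum>j<K. \<Sum>n<N. sawtooth (x n + y + t) * cos (2 * pi * real (nat_dist i j) * t)) / K" for t
      by (simp add: G_def fejer_expand sum_distrib_left sum_distrib_right add.assoc)
    moreover have "((\<lambda>t. (\<Sum>i<K. \<Sum>j<K. \<Sum>n<N. sawtooth (x n + y + t) * cos (2 * pi * real (nat_dist i j) * t)) / K)
        has_integral I y) {0..1}"
      unfolding I_def
      by (intro has_integral_divide has_integral_sum has_integral_sawtooth_cos finite_lessThan)
    ultimately show ?thesis by simp
  qed
  have I_le: "\<bar>I y\<bar> \<le> B / 3" for y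
  proof -
    define b where "b k = (if k = 0 then 0 else S k / (6 * k))" for k :: nat
    have *: "\<bar>\<Sum>n<N. sawtooth_coeff (x n + y) k\<bar> \<le> b k" for k
    proof (cases "k = 0")
      case True thus ?thesis by (simp add: sawtooth_coeff_def b_def)
    next
      case False
      have "(\<Sum>n<N. sawtooth_coeff (x n + y) k) = - Im (\<Sum>n<N. unit_exp (k * (x n + y))) / (2 * pi * k)"
        using False by (simp add: sawtooth_coeff_def unit_exp_def sum_negf sum_divide_distrib mult.assoc)
      also have "\<bar>\<dots>\<bar> \<le> norm (\<Sum>n<N. unit_exp (k * (x n + y))) / (2 * pi * k)"
        using abs_Im_le_cmod[of "\<Sum>n<N. unit_exp (k * (x n + y))"]
          by (simp add: abs_mult divide_right_mono del: Im_sum)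
      also have "(\<Sum>n<N. unit_exp (k * (x n + y))) = (\<Sum>n<N. unit_exp (k * x n)) * unit_exp (k * y)"
        by (simp add: sum_distrib_right distrib_left unit_exp_add)
      also have "norm \<dots> = S k" by (simp add: norm_mult S_def)
      also have "S k / (2 * pi * k) \<le> S k / (6 * k)"
        using pi_gt3 False by (intro divide_left_mono mult_right_mono) (auto simp: S_def)
      finally show ?thesis using False by (simp add: b_def)
    qed
    have "\<bar>I y\<bar> \<le> (\<Sum>i<K. \<Sum>j<K. b (nat_dist i j)) / K"
      unfolding I_def abs_divide abs_of_nat
      by (intro divide_right_mono order_trans[OF sum_abs] sum_mono *) auto
    also have "\<dots> \<le> (\<Sum>i<K. 2 * (\<Sum>k\<in>{1..<K}. b k)) / K"
      by (intro divide_right_mono sum_mono sum_nat_dist_le) (auto simp: b_def S_def)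
    also have "\<dots> = 2 * (\<Sum>k\<in>{1..<K}. b k)" using K by simp
    also have "(\<Sum>k\<in>{1..<K}. b k) = B / 6"
      unfolding B_def sum_divide_distrib by (intro sum.cong) (auto simp: b_def)
    finally show ?thesis by simp
  qed
  define E where "E = (SUP y. \<bar>G y\<bar>)"
  have bdd: "bdd_above (range (\<lambda>y. \<bar>G y\<bar>))"
  proof (rule bdd_aboveI2)
    fix y
    show "\<bar>G y\<bar> \<le> (\<Sum>n<N. 1 / 2)"
      unfolding G_def by (intro order_trans[OF sum_abs] sum_mono sawtooth_bounds)
  qed
  have GE: "\<bar>G y\<bar> \<le> E" for y
    unfolding E_def by (rule cSUP_upper[OF _ bdd]) simp
  have E0: "0 \<le> E" using GE[of 0] by linarith
  have B0: "0 \<le> B" by (auto simp: B_def S_def intro!: sum_nonneg)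
  have "E \<le> 5 * N / K + B"
  proof (cases "E = 0")
    case True thus ?thesis using B0 by simp
  next
    case False
    hence "9 / 10 * E < (SUP y. \<bar>G y\<bar>)" using E0 by (simp add: E_def[symmetric])
    then obtain y where y: "9 / 10 * E < \<bar>G y\<bar>"
      using less_cSUP_iff[OF _ bdd, of "9 / 10 * E"] by blast
    define v where "v = 9 / 10 * E - 2 * N / K"
    define h where "h = 1 / real K"
    have vE: "v \<le> E"
    proof -
      have "0 \<le> 2 * real N / K" by simp
      thus ?thesis using E0 unfolding v_def by linarith
    qed
    have v: "v + N * u \<le> 9 / 10 * E" if "u \<le> 2 * h" for u :: real
    proof -
      have "N * u \<le> N * (2 * h)" using that by (intro mult_left_mono) auto
      thus ?thesis by (simp add: v_def h_def)
    qed
    have "v \<le> B / 3 + 4 / 9 * E"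
    proof (cases "G y \<ge> 0")
      case True
      have win: "v \<le> G (y - u)" if "0 \<le> u" "u \<le> 2 * h" for u :: real
        using G_add[of u "y - u"] that v[of u] y True by simp
      have "v \<le> I (y - h) + 4 / 9 * E"
      proof (rule fejer_window[OF K E0 vE G_int])
        fix t :: real assume t: "t \<in> {0..1}"
        show "- E \<le> G (y - h + t)" using GE[of "y - h + t"] by linarith
        assume "t \<le> 1 / real K \<or> 1 - 1 / real K \<le> t"
        hence "t \<le> h \<or> 1 - h \<le> t" by (simp add: h_def)
        thus "v \<le> G (y - h + t)"
        proof
          assume "t \<le> h"
          thus ?thesis using win[of "h - t"] t by (simp add: algebra_simps)
        next
          assume *: "1 - h \<le> t"
          have "h \<ge> 0" by (simp add: h_def)
          hence "v \<le> G (y - (h + 1 - t))" using win[of "h + 1 - t"] t * by simp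
          also have "\<dots> = G (y - (h + 1 - t) + 1)" by (rule G_periodic[symmetric])
          finally show ?thesis by (simp add: algebra_simps)
        qed
      qed
      thus ?thesis using I_le[of "y - h"] by linarith
    next
      case False
      have win: "v \<le> - G (y + u)" if "0 \<le> u" "u \<le> 2 * h" for u :: real
        using G_add[of u y] that v[of u] y False by simp
      have "v \<le> - I (y + h) + 4 / 9 * E"
      proof (rule fejer_window[OF K E0 vE])
        show "((\<lambda>t. - G (y + h + t) * fejer K t) has_integral - I (y + h)) {0..1}"
          using has_integral_neg[OF G_int[of "y + h"]] by simp
        fix t :: real assume t: "t \<in> {0..1}"
        show "- E \<le> - G (y + h + t)" using GE[of "y + h + t"] by linarith
        assume "t \<le> 1 / real K \<or> 1 - 1 / real K \<le> t"
        hence "t \<le> h \<or> 1 - h \<le> t" by (simp add: h_def)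
        thus "v \<le> - G (y + h + t)"
        proof
          assume "t \<le> h"
          moreover have "h \<ge> 0" by (simp add: h_def)
          ultimately show ?thesis using win[of "h + t"] t by (simp add: algebra_simps)
        next
          assume *: "1 - h \<le> t"
          have "v \<le> - G (y + (h + t - 1))" using win[of "h + t - 1"] t * by simp
          also have "\<dots> = - G (y + (h + t - 1) + 1)" by (simp only: G_periodic)
          finally show ?thesis by (simp add: algebra_simps)
        qed
      qed
      thus ?thesis using I_le[of "y + h"] by linarith
    qed
    define a where "a = real N / K"
    have "0 \<le> a" by (simp add: a_def)
    moreover have "v = 9 / 10 * E - 2 * a" by (simp add: v_def a_def)
    hence "81 * E - 180 * a \<le> 30 * B + 40 * E"
      using \<open>v \<le> B / 3 + 4 / 9 * E\<close> by (simp add: field_simps)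
    ultimately have "E \<le> 5 * a + B" using B0 by linarith
    thus ?thesis by (simp add: a_def)
  qed
  moreover have "G 0 = (\<Sum>n<N. sawtooth (x n))" by (simp add: G_def)
  ultimately show ?thesis using GE[of 0] by (simp add: B_def S_def)
qed

section \<open>Sawtooth sums along concave sequences\<close>

lemma sum_inverse_sqrt_le: "(\<Sum>k\<in>{1..<Suc K}. 1 / sqrt (real k)) \<le> 2 * sqrt K"
proof (induction K)
  case (Suc K)
  define a b where "a = sqrt (real (Suc K))" and "b = sqrt (real K)"
  have ab: "a > 0" "b \<ge> 0" "a * a = b * b + 1" by (auto simp: a_def b_def)
  have "1 / a \<le> 2 * (a - b)"
  proof -
    have "0 \<le> (a - b)\<^sup>2" by simp
    hence "1 \<le> 2 * (a - b) * a" using ab by (simp add: power2_eq_square algebra_simps)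
    thus ?thesis using ab by (simp add: field_simps)
  qed
  thus ?case using Suc by (simp add: a_def b_def)
qed simp

lemma sum_inverse_k_sqrt_le: "(\<Sum>k\<in>{1..<Suc K}. 1 / (real k * sqrt (real k))) \<le> 3"
proof (cases "K = 0")
  case False
  hence "0 < K" by simp
  hence "(\<Sum>k\<in>{1..<Suc K}. 1 / (real k * sqrt (real k))) \<le> 3 - 2 / sqrt (real K)"
  proof (induction K rule: nat_induct_non_zero)
    case (Suc K)
    define a b where "a = sqrt (real (Suc K))" and "b = sqrt (real K)"
    have ab: "a > 0" "b > 0" "a * a = b * b + 1" "b \<le> a" "a * a = real (Suc K)"
      using Suc.hyps by (auto simp: a_def b_def)
    have "1 / (a * a * a) \<le> 2 / b - 2 / a"
    proof -
      have "(a - b) * (a + b) = 1" using ab by (simp add: algebra_simps)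
      hence "a - b = 1 / (a + b)" using ab by (simp add: field_simps)
      hence "2 * (a - b) / (a * b) = 2 / (a * b * (a + b))" by (simp add: mult_ac)
      moreover have "2 / b - 2 / a = 2 * (a - b) / (a * b)" using ab by (simp add: field_simps)
      moreover have "2 / (a * a * (a + a)) \<le> 2 / (a * b * (a + b))"
        using ab by (intro divide_left_mono mult_mono) auto
      ultimately show ?thesis by (simp add: mult_2[symmetric])
    qed
    hence "1 / (real (Suc K) * a) \<le> 2 / b - 2 / a" using ab(5) by simp
    moreover have "(\<Sum>k\<in>{1..<Suc K}. 1 / (real k * sqrt (real k))) \<le> 3 - 2 / b"
      using Suc.IH by (simp add: b_def)
    moreover have "(\<Sum>k\<in>{1..<Suc (Suc K)}. 1 / (real k * sqrt (real k))) =
        (\<Sum>k\<in>{1..<Suc K}. 1 / (real k * sqrt (real k))) + 1 / (real (Suc K) * a)"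
      unfolding a_def by (rule sum.atLeastLessThan_Suc) simp
    ultimately have "(\<Sum>k\<in>{1..<Suc (Suc K)}. 1 / (real k * sqrt (real k))) \<le> 3 - 2 / a"
      by linarith
    thus ?case unfolding a_def .
  qed simp
  moreover have "0 \<le> 2 / sqrt (real K)" by simp
  ultimately show ?thesis by linarith
qed simp

text \<open>
  The sawtooth sum when all second differences agree up to a factor \<open>2\<close>.  Inserting the second
  derivative test into the Erdos-Turan inequality gives the main term \<open>N * sqrt (K * l)\<close>, and
  \<open>sqrt (K * l) \<le> 1 / K + K\<^sup>2 * l\<close> turns it into quantities that are additive over blocks.  With this form
  the parameter \<open>K\<close> need not depend on the block, and \<open>N * l\<close> is bounded by the sum of the second
  differences.
\<close>

lemma sawtooth_sum_block:
  fixes x :: "nat \<Rightarrow> real" and l :: real and K N :: nat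
  assumes K: "K \<ge> 1" and l: "0 < l" and N: "N \<ge> 3"
    and c: "\<And>n. Suc (Suc n) < N \<Longrightarrow> l \<le> 2 * x (Suc n) - x n - x (Suc (Suc n)) \<and>
      2 * x (Suc n) - x n - x (Suc (Suc n)) \<le> 2 * l"
  shows "\<bar>\<Sum>n<N. sawtooth (x n)\<bar> \<le>
    504 * (N / K + (real K)\<^sup>2 * (\<Sum>n<N - 2. 2 * x (Suc n) - x n - x (Suc (Suc n))) + 1 / sqrt l)"
proof -
  have *: "norm (\<Sum>n<N. unit_exp (real k * x n)) \<le> 56 * (N * sqrt (k * l) + 1 / sqrt (k * l))"
    if "k \<ge> 1" for k :: nat
  proof -
    have "(\<Sum>n<N. unit_exp (- (real k * x n))) = cnj (\<Sum>n<N. unit_exp (real k * x n))"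
      by (simp add: unit_exp_minus)
    moreover have "norm (\<Sum>n<N. unit_exp (- (real k * x n))) \<le> 56 * (N * sqrt (k * l) + 1 / sqrt (k * l))"
    proof (rule second_difference_test)
      fix n assume n: "Suc (Suc n) < N"
      have "real k * l \<le> real k * (2 * x (Suc n) - x n - x (Suc (Suc n)))"
        "real k * (2 * x (Suc n) - x n - x (Suc (Suc n))) \<le> real k * (2 * l)"
        using c[OF n] by (intro mult_left_mono; simp)+
      thus "real k * l \<le> - (real k * x (Suc (Suc n))) - 2 * (- (real k * x (Suc n))) + - (real k * x n) \<and>
         - (real k * x (Suc (Suc n))) - 2 * (- (real k * x (Suc n))) + - (real k * x n) \<le> 2 * (real k * l)"
        by (simp add: algebra_simps)
    qed (use that l in simp)
    ultimately show ?thesis by (metis complex_mod_cnj)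
  qed
  have "(\<Sum>k\<in>{1..<K}. norm (\<Sum>n<N. unit_exp (real k * x n)) / k) \<le>
     (\<Sum>k\<in>{1..<K}. 56 * (N * sqrt l) * (1 / sqrt k) + 56 / sqrt l * (1 / (k * sqrt k)))"
  proof (rule sum_mono)
    fix k assume k: "k \<in> {1..<K}"
    hence "norm (\<Sum>n<N. unit_exp (real k * x n)) / k \<le> 56 * (N * sqrt (k * l) + 1 / sqrt (k * l)) / k"
      by (intro divide_right_mono *) auto
    also have "\<dots> = 56 * (N * sqrt l) * (sqrt k / k) + 56 / sqrt l * (1 / (k * sqrt k))"
      by (simp add: real_sqrt_mult add_divide_distrib distrib_left mult_ac)
    also have "sqrt k / k = 1 / sqrt k" using k by (simp add: field_simps)
    finally show "norm (\<Sum>n<N. unit_exp (real k * x n)) / k \<le>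
      56 * (N * sqrt l) * (1 / sqrt k) + 56 / sqrt l * (1 / (k * sqrt k))" .
  qed
  also have "\<dots> = 56 * (N * sqrt l) * (\<Sum>k\<in>{1..<K}. 1 / sqrt k) + 56 / sqrt l * (\<Sum>k\<in>{1..<K}. 1 / (k * sqrt k))"
    by (simp only: sum.distrib sum_distrib_left)
  also have "\<dots> \<le> 56 * (N * sqrt l) * (2 * sqrt K) + 56 / sqrt l * 3"
  proof (intro add_mono mult_left_mono)
    have K': "K = Suc (K - 1)" using K by simp
    have "(\<Sum>k\<in>{1..<K}. 1 / sqrt k) \<le> 2 * sqrt (real (K - 1))"
      using sum_inverse_sqrt_le[of "K - 1"] K' by simp
    also have "\<dots> \<le> 2 * sqrt K" by simp
    finally show "(\<Sum>k\<in>{1..<K}. 1 / sqrt k) \<le> 2 * sqrt K" .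
    show "(\<Sum>k\<in>{1..<K}. 1 / (k * sqrt k)) \<le> 3"
      using sum_inverse_k_sqrt_le[of "K - 1"] K' by simp
  qed (use l in auto)
  also have "\<dots> = 112 * (N * (sqrt l * sqrt K)) + 168 * (1 / sqrt l)" by simp
  finally have 1: "\<bar>\<Sum>n<N. sawtooth (x n)\<bar> \<le> 5 * (N / K) + (112 * (N * (sqrt l * sqrt K)) + 168 * (1 / sqrt l))"
    using erdos_turan_sawtooth[OF K, where N = N and x = x] by simp
  have 2: "sqrt l * sqrt K \<le> 1 / K + (real K)\<^sup>2 * l"
  proof -
    define a b where "a = 1 / sqrt K" and "b = sqrt l * K"
    have "sqrt l * sqrt K = a * b" using K by (simp add: a_def b_def field_simps)
    also have "0 \<le> (a - b)\<^sup>2 + a\<^sup>2 + b\<^sup>2" by simp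
    hence "a * b \<le> a\<^sup>2 + b\<^sup>2" by (simp add: power2_eq_square algebra_simps)
    also have "\<dots> = 1 / K + (real K)\<^sup>2 * l" using l by (simp add: a_def b_def power_divide power_mult_distrib mult.commute)
    finally show ?thesis .
  qed
  have "real N * (sqrt l * sqrt K) \<le> real N * (1 / K + (real K)\<^sup>2 * l)"
    by (intro mult_left_mono 2) simp
  also have "\<dots> = N / K + (real K)\<^sup>2 * (N * l)" by (simp add: algebra_simps)
  also have "(real K)\<^sup>2 * (N * l) \<le> (real K)\<^sup>2 * (3 * (\<Sum>n<N - 2. 2 * x (Suc n) - x n - x (Suc (Suc n))))"
  proof (rule mult_left_mono)
    have "real (N - 2) * l \<le> (\<Sum>n<N - 2. 2 * x (Suc n) - x n - x (Suc (Suc n)))"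
      using sum_bounded_below[of "{..<N - 2}" l "\<lambda>n. 2 * x (Suc n) - x n - x (Suc (Suc n))"] c by auto
    moreover have "real N * l \<le> (3 * real (N - 2)) * l"
      using N l by (intro mult_right_mono) auto
    ultimately show "N * l \<le> 3 * (\<Sum>n<N - 2. 2 * x (Suc n) - x n - x (Suc (Suc n)))" by linarith
  qed simp
  finally have 3: "real N * (sqrt l * sqrt K) \<le> N / K + 3 * ((real K)\<^sup>2 * (\<Sum>n<N - 2. 2 * x (Suc n) - x n - x (Suc (Suc n))))"
    by simp
  define u v w where "u = N / K" and "v = (real K)\<^sup>2 * (\<Sum>n<N - 2. 2 * x (Suc n) - x n - x (Suc (Suc n)))"
    and "w = 1 / sqrt l"
  have "0 \<le> u" "0 \<le> w" using l by (auto simp: u_def w_def)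
  moreover have "0 \<le> v" unfolding v_def using c l by (intro mult_nonneg_nonneg sum_nonneg) (force simp: less_diff_conv)+
  ultimately show ?thesis using 1 3 unfolding u_def[symmetric] v_def[symmetric] w_def[symmetric]
    by (simp add: algebra_simps)
qed

text \<open>
  A dyadic decomposition according to the size of the second differences.  They are monotone, so each
  dyadic level set is a block to which \<open>sawtooth_sum_block\<close> applies; the first two error terms
  add up over the blocks, and the third is a geometric series dominated by the flattest block.
\<close>

lemma sawtooth_sum_increasing:
  fixes x :: "nat \<Rightarrow> real" and \<mu> :: real and K N :: nat
  assumes K: "K \<ge> 1" and mu: "0 < \<mu>"
    and low: "\<And>n. Suc (Suc n) < N \<Longrightarrow> \<mu> \<le> 2 * x (Suc n) - x n - x (Suc (Suc n))"
    and mono: "\<And>n. Suc (Suc (Suc n)) < N \<Longrightarrow> 2 * x (Suc n) - x n - x (Suc (Suc n)) \<le>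
      2 * x (Suc (Suc n)) - x (Suc n) - x (Suc (Suc (Suc n)))"
  shows "\<bar>\<Sum>n<N. sawtooth (x n)\<bar> \<le>
    504 * (N / K + (real K)\<^sup>2 * (\<Sum>n<N - 2. 2 * x (Suc n) - x n - x (Suc (Suc n))) + 4 / sqrt \<mu>) + 1"
  using mu low mono
proof (induction N arbitrary: x \<mu> rule: less_induct)
  case (less N)
  define c where "c n = 2 * x (Suc n) - x n - x (Suc (Suc n))" for n
  show ?case
  proof (cases "N \<le> 2")
    case True
    have "\<bar>\<Sum>n<N. sawtooth (x n)\<bar> \<le> (\<Sum>n<N. 1 / 2)"
      by (intro order_trans[OF sum_abs] sum_mono sawtooth_bounds)
    moreover have "0 \<le> 504 * (real N / K + 4 / sqrt \<mu>)" using less.prems by simp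
    ultimately show ?thesis using True by simp
  next
    case False
    define \<nu> where "\<nu> = c 0"
    have nu: "\<mu> \<le> \<nu>" using less.prems(2)[of 0] False by (simp add: \<nu>_def c_def)
    hence nu0: "0 < \<nu>" using less.prems by simp
    have cmono: "c n \<le> c (Suc n)" if "Suc n < N - 2" for n
      using less.prems(3)[of n] that by (simp add: c_def)
    have cnu: "\<nu> \<le> c n" if "n < N - 2" for n
      using that by (induction n) (auto simp: \<nu>_def intro: order_trans[OF _ cmono])
    have "c n < 2 * \<nu>" if "Suc n < N - 2" "c (Suc n) < 2 * \<nu>" for n
      using cmono[OF that(1)] that(2) by simp
    then obtain i where i: "i \<le> N - 2" "\<And>n. n < N - 2 \<Longrightarrow> c n < 2 * \<nu> \<longleftrightarrow> n < i"
      using initial_segment_split[of "N - 2" "\<lambda>n. c n < 2 * \<nu>"] by blast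
    have i0: "0 < i" using i(2)[of 0] False nu0 by (simp add: \<nu>_def)
    define j where "j = i + 2"
    have j: "j \<le> N" "3 \<le> j" using i i0 False by (auto simp: j_def)
    have 1: "\<bar>\<Sum>n<j. sawtooth (x n)\<bar> \<le> 504 * (j / K + (real K)\<^sup>2 * (\<Sum>n<j - 2. c n) + 1 / sqrt \<nu>)"
      unfolding c_def
    proof (rule sawtooth_sum_block[OF K nu0 j(2)])
      fix n assume "Suc (Suc n) < j"
      hence "n < i" "n < N - 2" using i by (auto simp: j_def)
      thus "\<nu> \<le> 2 * x (Suc n) - x n - x (Suc (Suc n)) \<and> 2 * x (Suc n) - x n - x (Suc (Suc n)) \<le> 2 * \<nu>"
        using cnu[of n] i(2)[of n] by (simp add: c_def)
    qed
    have 2: "\<bar>\<Sum>n<N - j. sawtooth (x (j + n))\<bar> \<le>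
      504 * (real (N - j) / K + (real K)\<^sup>2 * (\<Sum>n<N - j - 2. 2 * x (j + Suc n) - x (j + n) - x (j + Suc (Suc n))) + 4 / sqrt (2 * \<nu>)) + 1"
    proof (rule less.IH)
      show "N - j < N" using j by simp
      show "0 < 2 * \<nu>" using nu0 by simp
      fix n
      show "2 * \<nu> \<le> 2 * x (j + Suc n) - x (j + n) - x (j + Suc (Suc n))" if "Suc (Suc n) < N - j"
      proof -
        have "j + n < N - 2" "\<not> j + n < i" using that by (auto simp: j_def)
        thus ?thesis using i(2)[of "j + n"] by (simp add: c_def)
      qed
      show "2 * x (j + Suc n) - x (j + n) - x (j + Suc (Suc n)) \<le>
        2 * x (j + Suc (Suc n)) - x (j + Suc n) - x (j + Suc (Suc (Suc n)))" if "Suc (Suc (Suc n)) < N - j"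
      proof -
        have "Suc (j + n) < N - 2" using that by arith
        thus ?thesis using cmono[of "j + n"] by (simp add: c_def)
      qed
    qed
    have "(\<Sum>n<N. sawtooth (x n)) = (\<Sum>n<j. sawtooth (x n)) + (\<Sum>n<N - j. sawtooth (x (j + n)))"
      by (rule sum_lessThan_shift_split[OF j(1)])
    hence "\<bar>\<Sum>n<N. sawtooth (x n)\<bar> \<le> 504 * (j / K + (real K)\<^sup>2 * (\<Sum>n<j - 2. c n) + 1 / sqrt \<nu>) +
       (504 * (real (N - j) / K + (real K)\<^sup>2 * (\<Sum>n<N - j - 2. c (j + n)) + 4 / sqrt (2 * \<nu>)) + 1)"
    proof -
      have "\<bar>\<Sum>n<N - j. sawtooth (x (j + n))\<bar> \<le>
        504 * (real (N - j) / K + (real K)\<^sup>2 * (\<Sum>n<N - j - 2. c (j + n)) + 4 / sqrt (2 * \<nu>)) + 1"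
        using 2 by (simp only: c_def add_Suc_right)
      thus "(\<Sum>n<N. sawtooth (x n)) = (\<Sum>n<j. sawtooth (x n)) + (\<Sum>n<N - j. sawtooth (x (j + n))) \<Longrightarrow> ?thesis"
        using order_trans[OF abs_triangle_ineq add_mono[OF 1]] by simp
    qed
    also have "\<dots> = 504 * ((real j + real (N - j)) / K + (real K)\<^sup>2 * ((\<Sum>n<j - 2. c n) + (\<Sum>n<N - j - 2. c (j + n)))
       + (1 / sqrt \<nu> + 4 / sqrt (2 * \<nu>))) + 1"
      by (simp only: add_divide_distrib distrib_left)
    also have "\<dots> \<le> 504 * (N / K + (real K)\<^sup>2 * (\<Sum>n<N - 2. c n) + 4 / sqrt \<mu>) + 1"
    proof (intro add_mono mult_left_mono order_refl)
      show "(real j + real (N - j)) / K \<le> N / K" using j by simp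
      have "(\<Sum>n<j - 2. c n) + (\<Sum>n<N - j - 2. c (j + n)) = (\<Sum>n\<in>{..<j - 2} \<union> {j..<N - 2}. c n)"
      proof (subst sum.union_disjoint)
        have "(\<Sum>n<N - j - 2. c (j + n)) = (\<Sum>n\<in>{j..<N - 2}. c n)"
          by (rule sum.reindex_bij_witness[of _ "\<lambda>n. n - j" "\<lambda>n. j + n"]) auto
        thus "(\<Sum>n<j - 2. c n) + (\<Sum>n<N - j - 2. c (j + n)) = (\<Sum>n<j - 2. c n) + (\<Sum>n\<in>{j..<N - 2}. c n)"
          by simp
      qed auto
      also have "\<dots> \<le> (\<Sum>n<N - 2. c n)"
        using j cnu nu0 by (intro sum_mono2) (auto intro: order_trans[OF less_imp_le])
      finally show "(\<Sum>n<j - 2. c n) + (\<Sum>n<N - j - 2. c (j + n)) \<le> (\<Sum>n<N - 2. c n)" .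
      \<comment> \<open>The geometric decay: \<open>1 + 4 / sqrt 2 \<le> 4\<close>.\<close>
      have "4 / sqrt (2 * \<nu>) \<le> 3 / sqrt \<nu>"
      proof -
        have "sqrt (16 / 9) \<le> sqrt 2" by (intro real_sqrt_le_mono) simp
        hence "4 / 3 \<le> sqrt 2" by (simp add: real_sqrt_divide)
        hence "4 * sqrt \<nu> \<le> 3 * (sqrt 2 * sqrt \<nu>)" using nu0 by simp
        thus ?thesis using nu0 by (simp add: real_sqrt_mult field_simps)
      qed
      moreover have "4 / sqrt \<nu> \<le> 4 / sqrt \<mu>"
        using nu nu0 less.prems(1) by (intro divide_left_mono) auto
      ultimately show "1 / sqrt \<nu> + 4 / sqrt (2 * \<nu>) \<le> 4 / sqrt \<mu>"
        by (simp add: field_simps)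
    qed auto
    finally show ?thesis by (simp add: c_def)
  qed
qed

text \<open>
  The case of decreasing second differences follows by reversing the sequence.
\<close>

lemma sawtooth_sum_concave:
  fixes x :: "nat \<Rightarrow> real" and \<mu> M :: real and K N :: nat
  defines "c \<equiv> \<lambda>n. 2 * x (Suc n) - x n - x (Suc (Suc n))"
  assumes K: "K \<ge> 1" and mu: "0 < \<mu>"
    and low: "\<And>n. n < N - 2 \<Longrightarrow> \<mu> \<le> c n"
    and mono: "(\<forall>n. Suc n < N - 2 \<longrightarrow> c n \<le> c (Suc n)) \<or> (\<forall>n. Suc n < N - 2 \<longrightarrow> c (Suc n) \<le> c n)"
    and M: "(\<Sum>n<N - 2. c n) \<le> M"
  shows "\<bar>\<Sum>n<N. sawtooth (x n)\<bar> \<le> 504 * (N / K + (real K)\<^sup>2 * M + 4 / sqrt \<mu>) + 1"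
proof -
  have "\<bar>\<Sum>n<N. sawtooth (x n)\<bar> \<le> 504 * (N / K + (real K)\<^sup>2 * (\<Sum>n<N - 2. c n) + 4 / sqrt \<mu>) + 1"
    using mono
  proof
    assume *: "\<forall>n. Suc n < N - 2 \<longrightarrow> c n \<le> c (Suc n)"
    show ?thesis
      unfolding c_def
      using * low
      by (intro sawtooth_sum_increasing[OF K mu]) (auto simp: c_def)
  next
    assume *: "\<forall>n. Suc n < N - 2 \<longrightarrow> c (Suc n) \<le> c n"
    define y where "y n = x (N - 1 - n)" for n
    have cy: "2 * y (Suc n) - y n - y (Suc (Suc n)) = c (N - 3 - n)" if "Suc (Suc n) < N" for n
    proof -
      have "N - 1 - n = Suc (Suc (N - 3 - n))" "N - 1 - Suc n = Suc (N - 3 - n)" "N - 1 - Suc (Suc n) = N - 3 - n"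
        using that by auto
      thus ?thesis by (simp add: y_def c_def)
    qed
    have "\<bar>\<Sum>n<N. sawtooth (y n)\<bar> \<le>
      504 * (N / K + (real K)\<^sup>2 * (\<Sum>n<N - 2. 2 * y (Suc n) - y n - y (Suc (Suc n))) + 4 / sqrt \<mu>) + 1"
    proof (rule sawtooth_sum_increasing[OF K mu])
      fix n
      show "\<mu> \<le> 2 * y (Suc n) - y n - y (Suc (Suc n))" if "Suc (Suc n) < N"
        unfolding cy[OF that] using that by (intro low) auto
      show "2 * y (Suc n) - y n - y (Suc (Suc n)) \<le> 2 * y (Suc (Suc n)) - y (Suc n) - y (Suc (Suc (Suc n)))"
        if n: "Suc (Suc (Suc n)) < N"
      proof -
        have "N - 3 - n = Suc (N - 3 - Suc n)" using n by auto
        thus ?thesis using cy[of n] cy[of "Suc n"] *[rule_format, of "N - 3 - Suc n"] n by simp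
      qed
    qed
    moreover have "(\<Sum>n<N. sawtooth (y n)) = (\<Sum>n<N. sawtooth (x n))"
      unfolding y_def using sum.nat_diff_reindex[of "\<lambda>n. sawtooth (x n)" N] by simp
    moreover have "(\<Sum>n<N - 2. 2 * y (Suc n) - y n - y (Suc (Suc n))) = (\<Sum>n<N - 2. c (N - 2 - Suc n))"
      by (intro sum.cong refl) (auto simp: cy numeral_3_eq_3 numeral_2_eq_2)
    moreover have "\<dots> = (\<Sum>n<N - 2. c n)"
      by (rule sum.nat_diff_reindex)
    ultimately show ?thesis by simp
  qed
  also have "\<dots> \<le> 504 * (N / K + (real K)\<^sup>2 * M + 4 / sqrt \<mu>) + 1"
    using M by (intro add_mono mult_left_mono) auto
  finally show ?thesis .
qed

section \<open>Second differences of functions with monotone second derivative\<close>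

lemma second_difference_lower:
  fixes f f1 f2 :: "real \<Rightarrow> real"
  assumes cont: "continuous_on {u..v} f"
    and d1: "\<And>x. u < x \<Longrightarrow> x < v \<Longrightarrow> (f has_real_derivative f1 x) (at x)"
    and d2: "\<And>x. u < x \<Longrightarrow> x < v \<Longrightarrow> (f1 has_real_derivative f2 x) (at x)"
    and f2: "\<And>x. u < x \<Longrightarrow> x < v \<Longrightarrow> f2 x \<le> - \<kappa>"
    and h: "0 < h" and x: "u \<le> x" "x + 2 * h \<le> v"
  shows "\<kappa> * h\<^sup>2 \<le> 2 * f (x + h) - f x - f (x + 2 * h)"
proof -
  define w where "w z = f (z + h) - f z" for z
  have dw: "(w has_real_derivative f1 (z + h) - f1 z) (at z)" if "x < z" "z < x + h" for z
    unfolding w_def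
    by (intro DERIV_diff d1 DERIV_shift[THEN iffD1, OF d1]) (use that x h in auto)
  have "\<exists>l z. x < z \<and> z < x + h \<and> (w has_real_derivative l) (at z) \<and> w (x + h) - w x = (x + h - x) * l"
  proof (rule MVT)
    show "continuous_on {x..x + h} w" unfolding w_def
      by (intro continuous_on_diff continuous_on_compose2[OF cont] continuous_intros) (use x h in auto)
  qed (use h dw in \<open>auto simp: real_differentiable_def\<close>)
  then obtain l z where z: "x < z" "z < x + h" "(w has_real_derivative l) (at z)" "w (x + h) - w x = h * l"
    by auto
  have l: "l = f1 (z + h) - f1 z" using DERIV_unique[OF z(3) dw] z by simp
  have "\<exists>y. z < y \<and> y < z + h \<and> f1 (z + h) - f1 z = (z + h - z) * f2 y"
    by (rule MVT2) (use h x z d2 in auto)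
  then obtain y where y: "z < y" "y < z + h" "l = h * f2 y" using l by auto
  have "f2 y \<le> - \<kappa>" using y z x by (intro f2) auto
  hence "h * (h * f2 y) \<le> h * (h * (- \<kappa>))" using h by (intro mult_left_mono) auto
  moreover have "w (x + h) - w x = f (x + 2 * h) - 2 * f (x + h) + f x"
    by (simp add: w_def algebra_simps)
  ultimately show ?thesis using z(4) y(3) by (simp add: power2_eq_square algebra_simps)
qed

text \<open>
  The sign of \<open>f2 a - f2 b\<close> with \<open>a \<le> b\<close> is determined by monotonicity of \<open>f2\<close>; so second differences
  inherit the monotonicity of the second derivative.
\<close>

lemma second_difference_increment:
  fixes f f1 f2 :: "real \<Rightarrow> real"
  assumes cont: "continuous_on {u..v} f"
    and d1: "\<And>x. u < x \<Longrightarrow> x < v \<Longrightarrow> (f has_real_derivative f1 x) (at x)"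
    and d2: "\<And>x. u < x \<Longrightarrow> x < v \<Longrightarrow> (f1 has_real_derivative f2 x) (at x)"
    and h: "0 < h" and x: "u \<le> x" "x < y" "y + 2 * h \<le> v"
  obtains a b where "u < a" "a \<le> b" "b < v"
    "(2 * f (y + h) - f y - f (y + 2 * h)) - (2 * f (x + h) - f x - f (x + 2 * h)) = (y - x) * h * (f2 a - f2 b)"
proof -
  define w where "w z = 2 * f (z + h) - f z - f (z + 2 * h)" for z
  have dw: "(w has_real_derivative 2 * f1 (z + h) - f1 z - f1 (z + 2 * h)) (at z)" if "x < z" "z < y" for z
    unfolding w_def
    by (intro DERIV_diff DERIV_cmult d1 DERIV_shift[THEN iffD1, OF d1]) (use that x h in auto)
  have "\<exists>l z. x < z \<and> z < y \<and> (w has_real_derivative l) (at z) \<and> w y - w x = (y - x) * l"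
  proof (rule MVT)
    show "continuous_on {x..y} w" unfolding w_def
      by (intro continuous_intros continuous_on_compose2[OF cont]) (use x h in auto)
  qed (use x dw in \<open>auto simp: real_differentiable_def\<close>)
  then obtain l z where z: "x < z" "z < y" "(w has_real_derivative l) (at z)" "w y - w x = (y - x) * l"
    by auto
  have l: "l = 2 * f1 (z + h) - f1 z - f1 (z + 2 * h)" using DERIV_unique[OF z(3) dw] z by simp
  have "\<exists>a. z < a \<and> a < z + h \<and> f1 (z + h) - f1 z = (z + h - z) * f2 a"
    by (rule MVT2) (use h x z d2 in auto)
  then obtain a where a: "z < a" "a < z + h" "f1 (z + h) - f1 z = h * f2 a" by auto
  have "\<exists>b. z + h < b \<and> b < z + 2 * h \<and> f1 (z + 2 * h) - f1 (z + h) = (z + 2 * h - (z + h)) * f2 b"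
    by (rule MVT2) (use h x z d2 in auto)
  then obtain b where b: "z + h < b" "b < z + 2 * h" "f1 (z + 2 * h) - f1 (z + h) = h * f2 b" by auto
  have "l = h * (f2 a - f2 b)" using l a(3) b(3) by (simp add: algebra_simps)
  thus ?thesis using that[of a b] a b z x by (simp add: w_def)
qed

lemma sum_second_differences:
  fixes x :: "nat \<Rightarrow> real"
  shows "(\<Sum>n<m. 2 * x (Suc n) - x n - x (Suc (Suc n))) = (x 1 - x 0) - (x (Suc m) - x m)"
  by (induction m) auto

text \<open>
  The sequence \<open>x n = r * s * f (n * s / r)\<close> has step \<open>h = s / r\<close>; its second differences are at least
  \<open>r * s * (\<kappa> * h\<^sup>2) = \<kappa> * s ^ 3 / r\<close>, and their sum telescopes to a difference of two slopes, so it
  is at most \<open>s\<^sup>2 * M\<close> however large the second derivative of \<open>f\<close> becomes.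
\<close>

lemma sawtooth_sum_piece:
  fixes f f1 f2 :: "real \<Rightarrow> real" and K :: nat
  assumes cont: "continuous_on {u..v} f"
    and d1: "\<And>x. u < x \<Longrightarrow> x < v \<Longrightarrow> (f has_real_derivative f1 x) (at x)"
    and d2: "\<And>x. u < x \<Longrightarrow> x < v \<Longrightarrow> (f1 has_real_derivative f2 x) (at x)"
    and f2: "\<And>x. u < x \<Longrightarrow> x < v \<Longrightarrow> f2 x \<le> - \<kappa>"
    and mono: "mono_on {u<..<v} f2 \<or> antimono_on {u<..<v} f2"
    and slope: "\<And>x y. u \<le> x \<Longrightarrow> x \<le> y \<Longrightarrow> y \<le> v \<Longrightarrow> 0 \<le> f x - f y \<and> f x - f y \<le> M * (y - x)"
    and uv: "0 \<le> u" "u \<le> v" and k: "0 < \<kappa>" and M: "0 \<le> M" and rs: "0 < r" "0 < s" and K: "1 \<le> K"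
  shows "\<bar>\<Sum>n | u < real n * s / r \<and> real n * s / r \<le> v. sawtooth (r * s * f (real n * s / r))\<bar> \<le>
    504 * ((r * v / s) / K + (real K)\<^sup>2 * (s\<^sup>2 * M) + 4 / sqrt (\<kappa> * s ^ 3 / r)) + 1"
proof -
  define h where "h = s / r"
  have h: "0 < h" using rs by (simp add: h_def)
  have nh: "real n * s / r = real n * h" for n by (simp add: h_def)
  define n0 n1 N where "n0 = Suc (nat \<lfloor>u / h\<rfloor>)" and "n1 = nat \<lfloor>v / h\<rfloor>" and "N = Suc n1 - n0"
  have n0: "u < real n * h \<longleftrightarrow> n0 \<le> n" for n
  proof -
    have "u < real n * h \<longleftrightarrow> u / h < real n" using h by (simp add: field_simps)
    also have "\<dots> \<longleftrightarrow> \<lfloor>u / h\<rfloor> < int n" by (simp add: floor_less_iff)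
    also have "\<dots> \<longleftrightarrow> n0 \<le> n" using uv h unfolding n0_def by (simp add: nat_less_iff Suc_le_eq)
    finally show ?thesis .
  qed
  have n1: "real n * h \<le> v \<longleftrightarrow> n \<le> n1" for n
  proof -
    have "real n * h \<le> v \<longleftrightarrow> real n \<le> v / h" using h by (simp add: field_simps)
    also have "\<dots> \<longleftrightarrow> n \<le> n1" using uv h unfolding n1_def by (simp add: le_nat_floor nat_le_iff le_nat_iff le_floor_iff)
    finally show ?thesis .
  qed
  have set: "{n. u < real n * s / r \<and> real n * s / r \<le> v} = {n0..n1}"
    unfolding nh by (auto simp: n0 n1)
  define x where "x n = r * s * f (real (n0 + n) * h)" for n
  define c where "c n = 2 * x (Suc n) - x n - x (Suc (Suc n))" for n
  have sum: "(\<Sum>n | u < real n * s / r \<and> real n * s / r \<le> v. sawtooth (r * s * f (real n * s / r))) = (\<Sum>n<N. sawtooth (x n))"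
    unfolding set unfolding nh x_def N_def
    by (rule sum.reindex_bij_witness[of _ "\<lambda>n. n0 + n" "\<lambda>n. n - n0"]) auto
  have Nv: "real N \<le> r * v / s"
  proof -
    have "real N \<le> real n1" by (simp add: N_def n0_def)
    also have "\<dots> \<le> v / h" using uv h unfolding n1_def by (intro of_nat_floor) auto
    finally show ?thesis by (simp add: h_def mult.commute)
  qed
  have pt: "u \<le> real (n0 + n) * h" "real (n0 + n) * h \<le> v" if "n < N" for n
    using n0[of "n0 + n"] n1[of "n0 + n"] that by (auto simp: N_def)
  have c_eq: "c n = r * s * (2 * f (real (n0 + n) * h + h) - f (real (n0 + n) * h) - f (real (n0 + n) * h + 2 * h))" for n
    by (simp add: c_def x_def algebra_simps)
  have low: "\<kappa> * s ^ 3 / r \<le> c n" if "n < N - 2" for n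
  proof -
    have "\<kappa> * h\<^sup>2 \<le> 2 * f (real (n0 + n) * h + h) - f (real (n0 + n) * h) - f (real (n0 + n) * h + 2 * h)"
    proof (rule second_difference_lower[OF cont d1 d2 f2 h])
      show "u \<le> real (n0 + n) * h" using pt[of n] that by simp
      show "real (n0 + n) * h + 2 * h \<le> v" using pt[of "Suc (Suc n)"] that by (simp add: algebra_simps)
    qed
    hence "r * s * (\<kappa> * h\<^sup>2) \<le> c n" unfolding c_eq using rs by (intro mult_left_mono) auto
    moreover have "r * s * (\<kappa> * h\<^sup>2) = \<kappa> * s ^ 3 / r"
      using rs by (simp add: h_def power2_eq_square power3_eq_cube field_simps)
    ultimately show ?thesis by simp
  qed
  have incr: "\<exists>a b. u < a \<and> a \<le> b \<and> b < v \<and> c (Suc n) - c n = r * s * (h * h) * (f2 a - f2 b)" if nN: "Suc n < N - 2" for n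
  proof -
    obtain a b where ab: "u < a" "a \<le> b" "b < v"
      "(2 * f (real (n0 + Suc n) * h + h) - f (real (n0 + Suc n) * h) - f (real (n0 + Suc n) * h + 2 * h)) -
       (2 * f (real (n0 + n) * h + h) - f (real (n0 + n) * h) - f (real (n0 + n) * h + 2 * h)) =
       (real (n0 + Suc n) * h - real (n0 + n) * h) * h * (f2 a - f2 b)"
    proof (rule second_difference_increment[OF cont d1 d2 h])
      show "u \<le> real (n0 + n) * h" using pt[of n] nN by simp
      show "real (n0 + n) * h < real (n0 + Suc n) * h" using h by simp
      show "real (n0 + Suc n) * h + 2 * h \<le> v" using pt[of "Suc (Suc (Suc n))"] nN by (simp add: algebra_simps)
    qed blast
    have "c (Suc n) - c n = r * s * ((real (n0 + Suc n) * h - real (n0 + n) * h) * h * (f2 a - f2 b))"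
      unfolding c_eq right_diff_distrib[symmetric, of "r * s"] ab(4) ..
    also have "real (n0 + Suc n) * h - real (n0 + n) * h = h" by (simp add: algebra_simps)
    finally show ?thesis using ab by (intro exI[of _ a] exI[of _ b]) simp
  qed
  have P: "0 \<le> r * s * (h * h)" using rs h by simp
  have cmono: "(\<forall>n. Suc n < N - 2 \<longrightarrow> c n \<le> c (Suc n)) \<or> (\<forall>n. Suc n < N - 2 \<longrightarrow> c (Suc n) \<le> c n)"
    using mono
  proof
    assume m: "mono_on {u<..<v} f2"
    have "c (Suc n) \<le> c n" if n: "Suc n < N - 2" for n
    proof -
      from incr[OF n] obtain a b where ab: "u < a" "a \<le> b" "b < v" "c (Suc n) - c n = r * s * (h * h) * (f2 a - f2 b)" by auto
      have "f2 a \<le> f2 b" using m ab by (auto intro!: mono_onD[OF m])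
      hence "r * s * (h * h) * (f2 a - f2 b) \<le> 0" using P by (intro mult_nonneg_nonpos) auto
      thus ?thesis using ab(4) by simp
    qed
    thus ?thesis by blast
  next
    assume m: "antimono_on {u<..<v} f2"
    have "c n \<le> c (Suc n)" if n: "Suc n < N - 2" for n
    proof -
      from incr[OF n] obtain a b where ab: "u < a" "a \<le> b" "b < v" "c (Suc n) - c n = r * s * (h * h) * (f2 a - f2 b)" by auto
      have "f2 b \<le> f2 a" using ab by (auto intro!: monotone_onD[OF m])
      hence "0 \<le> r * s * (h * h) * (f2 a - f2 b)" by (intro mult_nonneg_nonneg[OF P]) simp
      thus ?thesis using ab(4) by simp
    qed
    thus ?thesis by blast
  qed
  have sumM: "(\<Sum>n<N - 2. c n) \<le> s\<^sup>2 * M"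
  proof (cases "N < 3")
    case True
    thus ?thesis using M by simp
  next
    case False
    have sl: "0 \<le> x n - x (Suc n) \<and> x n - x (Suc n) \<le> s\<^sup>2 * M" if "Suc n < N" for n
    proof -
      have "0 \<le> f (real (n0 + n) * h) - f (real (n0 + Suc n) * h) \<and>
        f (real (n0 + n) * h) - f (real (n0 + Suc n) * h) \<le> M * (real (n0 + Suc n) * h - real (n0 + n) * h)"
        using pt[of n] pt[of "Suc n"] that h by (intro slope) auto
      moreover have "real (n0 + Suc n) * h - real (n0 + n) * h = h" by (simp add: algebra_simps)
      ultimately have *: "0 \<le> f (real (n0 + n) * h) - f (real (n0 + Suc n) * h)"
        "f (real (n0 + n) * h) - f (real (n0 + Suc n) * h) \<le> M * h" by auto
      have "x n - x (Suc n) = r * s * (f (real (n0 + n) * h) - f (real (n0 + Suc n) * h))"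
        by (simp add: x_def right_diff_distrib)
      moreover have "r * s * (M * h) = s\<^sup>2 * M" using rs by (simp add: h_def power2_eq_square)
      moreover have "0 \<le> r * s" using rs by simp
      ultimately show ?thesis
        using mult_left_mono[OF *(2), of "r * s"] mult_nonneg_nonneg[OF _ *(1), of "r * s"] by presburger
    qed
    have "(\<Sum>n<N - 2. c n) = (x 1 - x 0) - (x (Suc (N - 2)) - x (N - 2))"
      unfolding c_def by (rule sum_second_differences)
    moreover have "0 < N - 1" "Suc (N - 2) < N" using False by arith+
    ultimately show ?thesis using sl[of 0] sl[of "N - 2"] by simp
  qed
  have "\<bar>\<Sum>n<N. sawtooth (x n)\<bar> \<le> 504 * (N / K + (real K)\<^sup>2 * (s\<^sup>2 * M) + 4 / sqrt (\<kappa> * s ^ 3 / r)) + 1"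
    by (rule sawtooth_sum_concave[OF K]) (use k rs low cmono sumM in \<open>auto simp: c_def\<close>)
  also have "\<dots> \<le> 504 * ((r * v / s) / K + (real K)\<^sup>2 * (s\<^sup>2 * M) + 4 / sqrt (\<kappa> * s ^ 3 / r)) + 1"
    by (intro add_mono mult_left_mono divide_right_mono Nv order_refl) auto
  finally show ?thesis unfolding sum .
qed


section \<open>Sawtooth sums along a piecewise smooth concave curve\<close>

definition sawtooth_sum :: "(real \<Rightarrow> real) \<Rightarrow> real \<Rightarrow> real \<Rightarrow> real \<Rightarrow> real" where
  "sawtooth_sum f a r s = (\<Sum>n | real n * s / r \<le> a. sawtooth (r * s * f (real n * s / r)))"

text \<open>
  A two-sided bound for the chord slopes, playing the part of a bound for the first derivative.
  Concavity supplies it on any arc that stops short of the right end of the curve.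
\<close>

definition lipschitz_decreasing :: "real \<Rightarrow> real \<Rightarrow> (real \<Rightarrow> real) \<Rightarrow> bool" where
  "lipschitz_decreasing M a f \<longleftrightarrow>
     (\<forall>x y. 0 \<le> x \<longrightarrow> x \<le> y \<longrightarrow> y \<le> a \<longrightarrow> 0 \<le> f x - f y \<and> f x - f y \<le> M * (y - x))"

lemma C2_on_interior:
  assumes "C2_on S f" "x \<in> interior S"
  shows "(f has_real_derivative D1 S f x) (at x)"
    and "(D1 S f has_real_derivative D2 S f x) (at x)"
proof -
  have x: "x \<in> S" "at x within S = at x"
    using assms interior_subset at_within_interior[of x S] by auto
  have "f differentiable (at x within S)" "D1 S f differentiable (at x within S)"
    using assms x by (auto simp: C2_on_def differentiable_on_def)
  thus "(f has_real_derivative D1 S f x) (at x)" "(D1 S f has_real_derivative D2 S f x) (at x)"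
    unfolding vector_derivative_works D2_def D1_def[of S f x] D1_def[of S "D1 S f" x]
      has_real_derivative_iff_has_vector_derivative x(2) by blast+
qed

text \<open>
  One-sided derivatives on different subintervals agree at common interior points, where they are
  ordinary derivatives.
\<close>

lemma D2_cong_interior:
  assumes "x \<in> interior S" "x \<in> interior T"
  shows "D2 S f x = D2 T f x"
proof -
  have "eventually (\<lambda>y. y \<in> interior S \<inter> interior T) (nhds x)"
    using assms by (intro eventually_nhds_in_open) auto
  hence "eventually (\<lambda>y. y \<in> UNIV \<longrightarrow> D1 S f y = D1 T f y) (nhds x)"
    by eventually_elim (auto simp: D1_def at_within_interior[of _ S] at_within_interior[of _ T])
  hence "vector_derivative (D1 S f) (at x within UNIV) = vector_derivative (D1 T f) (at x within UNIV)"
    by (intro vector_derivative_cong_eq) auto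
  thus ?thesis using assms by (simp add: D2_def D1_def[of S "D1 S f"] D1_def[of T "D1 T f"]
    at_within_interior[of x S] at_within_interior[of x T])
qed

text \<open>
  The choice \<open>K \<approx> r powr (1 / 3)\<close> balances \<open>N / K\<close>, with \<open>N\<close> of order \<open>r\<close>, against \<open>K\<^sup>2\<close>.  Monotonicity
  makes the second derivative largest at an endpoint, which gives the lower bound for the curvature.
\<close>

lemma sawtooth_sum_smooth_piece:
  fixes f :: "real \<Rightarrow> real"
  assumes C2: "C2_on S f" and S: "{u..v} \<subseteq> S"
    and neg: "\<And>x. x \<in> S \<Longrightarrow> D2 S f x < 0" and mono: "monotonic_on S (D2 S f)"
    and lip: "lipschitz_decreasing M \<alpha> f" and uv: "0 \<le> u" "u \<le> v" "v \<le> \<alpha>"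
    and M: "0 \<le> M" and Q: "1 \<le> Q" and r: "1 \<le> r" and s: "1 / Q \<le> s" "s \<le> Q"
  shows "\<bar>\<Sum>n | u < real n * s / r \<and> real n * s / r \<le> v. sawtooth (r * s * f (real n * s / r))\<bar> \<le>
    (504 * (Q * \<alpha> + 4 * Q\<^sup>2 * M + 4 * Q\<^sup>2) + 1) *
      (r powr (2 / 3) + sqrt (r * (1 / - D2 S f u + 1 / - D2 S f v)))"
proof -
  define a b \<kappa> where "a = - D2 S f u" and "b = - D2 S f v" and "\<kappa> = min a b"
  have ab: "0 < a" "0 < b" "0 < \<kappa>" using neg[of u] neg[of v] S uv by (auto simp: a_def b_def \<kappa>_def)
  have s0: "0 < s" using s Q by (smt (verit) divide_pos_pos)
  have alpha: "0 \<le> \<alpha>" using uv by simp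
  have int: "x \<in> interior S" if "u < x" "x < v" for x
  proof -
    have "{u<..<v} \<subseteq> interior S" using S by (intro interior_maximal) auto
    thus ?thesis using that by auto
  qed
  define t where "t = r powr (1 / 3)"
  have t1: "1 \<le> t" unfolding t_def using r by (intro ge_one_powr_ge_zero) auto
  have tt: "t\<^sup>2 = r powr (2 / 3)" "t * t\<^sup>2 = r"
    using r by (auto simp: t_def power2_eq_square simp flip: powr_add)
  define K where "K = nat \<lceil>t\<rceil>"
  have K: "1 \<le> K" "t \<le> real K" "real K \<le> 2 * t"
    using t1 unfolding K_def by linarith+
  have kap: "D2 S f x \<le> - \<kappa>" if "u < x" "x < v" for x
  proof -
    have mem: "x \<in> S" "u \<in> S" "v \<in> S" using S that by auto
    have "D2 S f x \<le> max (D2 S f u) (D2 S f v)"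
      using mono unfolding monotonic_on_def
    proof
      assume "mono_on S (D2 S f)"
      from mono_onD[OF this mem(1,3)] show ?thesis using that by simp
    next
      assume "antimono_on S (D2 S f)"
      from monotone_onD[OF this mem(2,1)] show ?thesis using that by simp
    qed
    thus ?thesis by (auto simp: \<kappa>_def a_def b_def)
  qed
  have "\<bar>\<Sum>n | u < real n * s / r \<and> real n * s / r \<le> v. sawtooth (r * s * f (real n * s / r))\<bar> \<le>
    504 * ((r * v / s) / K + (real K)\<^sup>2 * (s\<^sup>2 * M) + 4 / sqrt (\<kappa> * s ^ 3 / r)) + 1"
  proof (rule sawtooth_sum_piece[where ?f1.0 = "D1 S f" and ?f2.0 = "D2 S f"])
    show "continuous_on {u..v} f"
      using C2 S by (auto simp: C2_on_def intro: continuous_on_subset differentiable_imp_continuous_on)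
    show "mono_on {u<..<v} (D2 S f) \<or> antimono_on {u<..<v} (D2 S f)"
    proof -
      have "{u<..<v} \<subseteq> S" using S by auto
      thus ?thesis using mono unfolding monotonic_on_def by (meson mono_on_subset monotone_on_subset)
    qed
    show "0 \<le> f x - f y \<and> f x - f y \<le> M * (y - x)" if "u \<le> x" "x \<le> y" "y \<le> v" for x y
      using lip that uv by (auto simp: lipschitz_decreasing_def)
  qed (use C2_on_interior[OF C2 int] kap uv ab M s0 r K in auto)
  also have "\<dots> \<le> 504 * (Q * \<alpha> * t\<^sup>2 + 4 * Q\<^sup>2 * M * t\<^sup>2 + 4 * Q\<^sup>2 * sqrt (r * (1 / a + 1 / b))) + 1"
  proof (intro add_mono mult_left_mono order_refl)
    have "(r * v / s) / K \<le> (r * v / s) / t"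
      using K t1 uv s0 r by (intro divide_left_mono) auto
    also have "\<dots> = t\<^sup>2 * (v * (1 / s))" using t1 by (simp add: tt(2)[symmetric] power2_eq_square)
    also have "\<dots> \<le> t\<^sup>2 * (\<alpha> * Q)"
    proof (intro mult_left_mono mult_mono)
      show "1 / s \<le> Q" using s s0 Q by (simp add: field_simps)
    qed (use uv s0 in auto)
    finally show "(r * v / s) / K \<le> Q * \<alpha> * t\<^sup>2" by (simp add: mult_ac)
    have "(real K)\<^sup>2 * (s\<^sup>2 * M) \<le> (2 * t)\<^sup>2 * (Q\<^sup>2 * M)"
      using K s s0 M by (intro mult_mono power_mono) auto
    thus "(real K)\<^sup>2 * (s\<^sup>2 * M) \<le> 4 * Q\<^sup>2 * M * t\<^sup>2" by (simp add: power_mult_distrib mult_ac)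
    have "1 / (\<kappa> * s ^ 3 / r) \<le> Q ^ 4 * (r * (1 / a + 1 / b))"
    proof -
      have "1 / \<kappa> \<le> 1 / a + 1 / b" using ab by (auto simp: \<kappa>_def min_def)
      moreover have "1 / s ^ 3 \<le> Q ^ 4"
      proof -
        have "1 / s \<le> Q" using s s0 Q by (simp add: field_simps)
        hence "(1 / s) ^ 3 \<le> Q ^ 3" using s0 by (intro power_mono) auto
        also have "\<dots> \<le> Q ^ 4" using Q by (intro power_increasing) auto
        finally show ?thesis by (simp add: power_divide)
      qed
      ultimately have "(1 / s ^ 3) * (r * (1 / \<kappa>)) \<le> Q ^ 4 * (r * (1 / a + 1 / b))"
        using r ab Q by (intro mult_mono) auto
      thus ?thesis by (simp add: mult_ac)
    qed
    hence "sqrt (1 / (\<kappa> * s ^ 3 / r)) \<le> sqrt (Q ^ 4 * (r * (1 / a + 1 / b)))"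
      by (rule real_sqrt_le_mono)
    moreover have "sqrt (Q ^ 4) = Q\<^sup>2" using real_sqrt_abs[of "Q\<^sup>2"] by (simp flip: power_mult)
    ultimately show "4 / sqrt (\<kappa> * s ^ 3 / r) \<le> 4 * Q\<^sup>2 * sqrt (r * (1 / a + 1 / b))"
      by (simp add: real_sqrt_divide real_sqrt_mult)
  qed auto
  also have "\<dots> \<le> (504 * (Q * \<alpha> + 4 * Q\<^sup>2 * M + 4 * Q\<^sup>2) + 1) * (t\<^sup>2 + sqrt (r * (1 / a + 1 / b)))"
  proof -
    define w where "w = sqrt (r * (1 / a + 1 / b))"
    have w: "0 \<le> w" using r ab by (auto simp: w_def)
    have T: "1 \<le> t\<^sup>2" using t1 by simp
    have *: "504 * (A * T + B * T + C * w) + 1 \<le> (504 * (A + B + C) + 1) * (T + w)"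
      if "0 \<le> A" "0 \<le> B" "0 \<le> C" "1 \<le> T" for A B C T :: real
    proof -
      have "0 \<le> A * w" "0 \<le> B * w" "0 \<le> C * T" using that w by auto
      thus ?thesis using that(4) w unfolding ring_distribs by linarith
    qed
    show ?thesis unfolding w_def[symmetric] by (rule *) (use Q alpha M T in auto)
  qed
  finally show ?thesis by (simp add: a_def b_def tt)
qed

lemma finite_scaled_points: "0 < r \<Longrightarrow> 0 < s \<Longrightarrow> finite {n. real n * s / r \<le> a}"
proof -
  assume "0 < r" "0 < s"
  hence "{n. real n * s / r \<le> a} \<subseteq> {..nat \<lfloor>a * r / s\<rfloor>}"
    by (auto simp: field_simps intro!: le_nat_floor)
  thus ?thesis by (rule finite_subset) simp
qed

lemma sawtooth_sum_split:
  assumes "0 < r" "0 < s" "a \<le> b"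
  shows "sawtooth_sum f b r s = sawtooth_sum f a r s +
    (\<Sum>n | a < real n * s / r \<and> real n * s / r \<le> b. sawtooth (r * s * f (real n * s / r)))"
proof -
  have "{n. real n * s / r \<le> b} = {n. real n * s / r \<le> a} \<union> {n. a < real n * s / r \<and> real n * s / r \<le> b}"
    using assms by auto
  thus ?thesis unfolding sawtooth_sum_def
    using finite_scaled_points[OF assms(1,2)]
    by (simp only:) (subst sum.union_disjoint, auto intro: rev_finite_subset)
qed

lemma sawtooth_sum_trivial:
  assumes "0 < r" "0 < s" "0 \<le> a"
  shows "\<bar>sawtooth_sum f a r s\<bar> \<le> r * a / s + 1"
proof -
  have "{n. real n * s / r \<le> a} \<subseteq> {..nat \<lfloor>r * a / s\<rfloor>}"
    using assms by (auto simp: field_simps intro!: le_nat_floor)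
  hence c: "card {n. real n * s / r \<le> a} \<le> Suc (nat \<lfloor>r * a / s\<rfloor>)"
    by (metis card_atMost card_mono finite_atMost)
  have "\<bar>sawtooth_sum f a r s\<bar> \<le> (\<Sum>n | real n * s / r \<le> a. 1 / 2)"
    unfolding sawtooth_sum_def by (intro order_trans[OF sum_abs] sum_mono sawtooth_bounds)
  also have "\<dots> \<le> real (Suc (nat \<lfloor>r * a / s\<rfloor>))" using c by simp
  also have "\<dots> \<le> r * a / s + 1" using assms by simp
  finally show ?thesis .
qed

text \<open>
  Abscissae below \<open>\<delta> r\<close> are estimated trivially and cost about \<open>r * \<delta> r\<close>, of order
  \<open>r powr (1 - 2 * a1)\<close>.  On the rest of the first subinterval the curvature is at least the smaller
  of its values at \<open>\<delta> r\<close> and at the right end, which costs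
  \<open>sqrt (r / \<bar>f'' (\<delta> r)\<bar>)\<close>, of order \<open>r powr (1 - 2 * a2)\<close>, besides \<open>r powr (2 / 3)\<close>.  On the other
  subintervals the curvature is bounded below by a constant.
\<close>

lemma sawtooth_sum_rate:
  fixes f \<delta> :: "real \<Rightarrow> real"
  assumes pw: "piecewise_hypotheses \<alpha> l p f" and dec: "decay_hypotheses \<alpha> f \<delta> a1 a2"
    and lip: "lipschitz_decreasing M \<alpha> f" and M: "0 \<le> M" and Q: "1 \<le> Q"
    and e: "0 < a1" "e \<le> 1 / 6" "e \<le> a1" "e \<le> a2"
  shows "\<exists>C r0. \<forall>r\<ge>r0. \<forall>s. 1 / Q \<le> s \<longrightarrow> s \<le> Q \<longrightarrow> \<bar>sawtooth_sum f \<alpha> r s\<bar> \<le> C * r powr (1 - 2 * e)"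
proof -
  define S where "S i = subinterval p i" for i
  have l: "0 < l" "p 0 = 0" "p l = \<alpha>" and step: "\<And>i. i < l \<Longrightarrow> p i < p (Suc i)"
    and C2: "\<And>i. i < l \<Longrightarrow> C2_on (S i) f"
    and neg: "\<And>i x. i < l \<Longrightarrow> x \<in> S i \<Longrightarrow> D2 (S i) f x < 0"
    and mono: "\<And>i. i < l \<Longrightarrow> monotonic_on (S i) (D2 (S i) f)"
    using pw by (auto simp: piecewise_hypotheses_def PC2_on_def partition_points_def S_def)
  have p_le: "p i \<le> p j" if "i \<le> j" "j \<le> l" for i j
    using that
  proof (induction j rule: dec_induct)
    case (step j)
    thus ?case using \<open>\<And>i. i < l \<Longrightarrow> p i < p (Suc i)\<close>[of j] by simp
  qed simp
  define B where "B = 504 * (Q * \<alpha> + 4 * Q\<^sup>2 * M + 4 * Q\<^sup>2) + 1"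
  have alpha: "0 \<le> \<alpha>" using p_le[of 0 l] l by simp
  have B: "0 \<le> B" using Q alpha M by (simp add: B_def)
  define E where "E = 1 - 2 * e"
  have E: "2 / 3 \<le> E" using e by (simp add: E_def)
  have r23: "r powr (2 / 3) \<le> r powr E" if "1 \<le> r" for r using that E by (intro powr_mono) auto
  have sq: "sqrt r \<le> r powr E" if "1 \<le> r" for r
    using that E by (simp add: powr_half_sqrt[symmetric] powr_mono)
  have s0: "0 < s" "1 / s \<le> Q" if "1 / Q \<le> s" for s
  proof -
    show "0 < s" using that Q by (smt (verit) divide_pos_pos)
    thus "1 / s \<le> Q" using that Q by (simp add: field_simps)
  qed
  have p1: "0 < p 1" using step[of 0] l by simp
  have "\<exists>C r0. \<forall>r\<ge>r0. \<forall>s. 1 / Q \<le> s \<longrightarrow> s \<le> Q \<longrightarrow> \<bar>sawtooth_sum f (p i) r s\<bar> \<le> C * r powr E"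
    if "1 \<le> i" "i \<le> l" for i
    using that
  proof (induction i rule: dec_induct)
    case base
    from dec have dpos: "\<And>r. 0 < r \<Longrightarrow> 0 < \<delta> r"
      and O1: "\<delta> \<in> O[at_top](\<lambda>r. r powr (- 2 * a1))"
      and O2: "(\<lambda>r. inverse (D2 {0<..\<alpha>} f (\<delta> r))) \<in> O[at_top](\<lambda>r. r powr (1 - 4 * a2))"
      by (auto simp: decay_hypotheses_def)
    from landau_o.bigE[OF O1] obtain c1 where c1: "c1 > 0"
      "eventually (\<lambda>r. norm (\<delta> r) \<le> c1 * norm (r powr (- 2 * a1))) at_top" by auto
    from landau_o.bigE[OF O2] obtain c2 where c2: "c2 > 0"
      "eventually (\<lambda>r. norm (inverse (D2 {0<..\<alpha>} f (\<delta> r))) \<le> c2 * norm (r powr (1 - 4 * a2))) at_top" by auto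
    have "((\<lambda>r. c1 * r powr (- 2 * a1)) \<longlongrightarrow> c1 * 0) at_top"
      using e by (intro tendsto_mult tendsto_const tendsto_neg_powr filterlim_ident) auto
    hence "eventually (\<lambda>r. c1 * r powr (- 2 * a1) < p 1) at_top"
      using p1 by (intro order_tendstoD) auto
    with c1(2) c2(2) have "eventually (\<lambda>r. norm (\<delta> r) \<le> c1 * norm (r powr (- 2 * a1)) \<and>
        norm (inverse (D2 {0<..\<alpha>} f (\<delta> r))) \<le> c2 * norm (r powr (1 - 4 * a2)) \<and>
        c1 * r powr (- 2 * a1) < p 1) at_top" by eventually_elim auto
    then obtain r1 where r1: "\<And>r. r \<ge> r1 \<Longrightarrow> norm (\<delta> r) \<le> c1 * norm (r powr (- 2 * a1)) \<and>
        norm (inverse (D2 {0<..\<alpha>} f (\<delta> r))) \<le> c2 * norm (r powr (1 - 4 * a2)) \<and>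
        c1 * r powr (- 2 * a1) < p 1" by (auto simp: eventually_at_top_linorder)
    define d where "d = 1 / - D2 (S 0) f (p 1)"
    have S0: "S 0 = {0<..p 1}" by (simp add: S_def subinterval_def)
    have d0: "0 \<le> d" using neg[of 0 "p 1"] l p1 by (auto simp: d_def S0)
    show ?case
    proof (intro exI allI impI)
      fix r s assume r: "max 1 r1 \<le> r" and s: "1 / Q \<le> s" "s \<le> Q"
      have r1': "1 \<le> r" "r1 \<le> r" using r by auto
      have del: "0 < \<delta> r" "\<delta> r \<le> c1 * r powr (- 2 * a1)" "\<delta> r < p 1"
        using r1[OF r1'(2)] dpos[of r] r1' by auto
      have D_eq: "D2 {0<..\<alpha>} f (\<delta> r) = D2 (S 0) f (\<delta> r)"
      proof (rule D2_cong_interior)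
        have "p 1 \<le> \<alpha>" using p_le[of 1 l] l by simp
        hence "{0<..<p 1} \<subseteq> interior {0<..\<alpha>}" by (intro interior_maximal) auto
        thus "\<delta> r \<in> interior {0<..\<alpha>}" using del by auto
        have "{0<..<p 1} \<subseteq> interior (S 0)" unfolding S0 by (intro interior_maximal) auto
        thus "\<delta> r \<in> interior (S 0)" using del by auto
      qed
      have Dneg: "D2 (S 0) f (\<delta> r) < 0" using neg[of 0 "\<delta> r"] l del by (simp add: S0)
      have inv: "1 / - D2 (S 0) f (\<delta> r) \<le> c2 * r powr (1 - 4 * a2)"
        using r1[OF r1'(2)] Dneg by (simp add: D_eq inverse_eq_divide)
      have 1: "\<bar>sawtooth_sum f (\<delta> r) r s\<bar> \<le> (c1 * Q + 1) * r powr E"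
      proof -
        have "\<bar>sawtooth_sum f (\<delta> r) r s\<bar> \<le> r * \<delta> r / s + 1"
          using r1' s0[OF s(1)] del by (intro sawtooth_sum_trivial) auto
        also have "r * \<delta> r / s = r * \<delta> r * (1 / s)" by simp
        also have "\<dots> \<le> r * (c1 * r powr (- 2 * a1)) * Q"
          using r1' del s0[OF s(1)] c1(1) by (intro mult_mono) auto
        also have "\<dots> = c1 * Q * r powr (1 - 2 * a1)"
          using r1' by (simp add: powr_diff powr_minus field_simps)
        also have "\<dots> \<le> c1 * Q * r powr E"
          using r1' e c1(1) Q by (intro mult_left_mono powr_mono) (auto simp: E_def)
        also have "1 \<le> r powr E" using r1' E by (intro ge_one_powr_ge_zero) auto
        finally show ?thesis by (simp add: algebra_simps)
      qed
      have 2: "sqrt (r * (1 / - D2 (S 0) f (\<delta> r) + 1 / - D2 (S 0) f (p 1))) \<le> (sqrt c2 + sqrt d) * r powr E"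
      proof -
        have "r * (1 / - D2 (S 0) f (\<delta> r) + d) \<le> r * (c2 * r powr (1 - 4 * a2) + d)"
          using inv r1' by (intro mult_left_mono) auto
        hence "sqrt (r * (1 / - D2 (S 0) f (\<delta> r) + d)) \<le> sqrt (r * (c2 * r powr (1 - 4 * a2) + d))"
          by (rule real_sqrt_le_mono)
        also have "\<dots> = sqrt (c2 * (r * r powr (1 - 4 * a2)) + d * r)" by (simp add: algebra_simps)
        also have "\<dots> \<le> sqrt (c2 * (r * r powr (1 - 4 * a2))) + sqrt (d * r)"
          using c2(1) r1' d0 by (intro sqrt_add_le_add_sqrt) auto
        also have "r * r powr (1 - 4 * a2) = r powr (1 - 2 * a2) * r powr (1 - 2 * a2)"
          using r1' by (simp add: powr_mult_base flip: powr_add)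
        also have "sqrt (c2 * (r powr (1 - 2 * a2) * r powr (1 - 2 * a2))) = sqrt c2 * r powr (1 - 2 * a2)"
          using r1' by (simp add: real_sqrt_mult)
        also have "\<dots> \<le> sqrt c2 * r powr E"
          using r1' e c2(1) by (intro mult_left_mono powr_mono) (auto simp: E_def)
        also have "sqrt (d * r) \<le> sqrt d * r powr E"
          using sq[OF r1'(1)] d0 by (simp add: real_sqrt_mult mult_left_mono)
        finally show ?thesis by (simp add: d_def algebra_simps)
      qed
      have 3: "\<bar>\<Sum>n | \<delta> r < real n * s / r \<and> real n * s / r \<le> p 1. sawtooth (r * s * f (real n * s / r))\<bar> \<le>
        B * (r powr (2 / 3) + sqrt (r * (1 / - D2 (S 0) f (\<delta> r) + 1 / - D2 (S 0) f (p 1))))"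
        unfolding B_def
      proof (rule sawtooth_sum_smooth_piece)
        show "C2_on (S 0) f" using C2 l by simp
        show "{\<delta> r..p 1} \<subseteq> S 0" using del by (auto simp: S0)
        show "p 1 \<le> \<alpha>" using p_le[of 1 l] l by simp
      qed (use neg[of 0] mono[of 0] l lip M Q s r1' del in auto)
      also have "\<dots> \<le> B * (r powr E + (sqrt c2 + sqrt d) * r powr E)"
        by (intro mult_left_mono add_mono 2 r23 B r1')
      finally have "\<bar>sawtooth_sum f (p 1) r s\<bar> \<le> (c1 * Q + 1) * r powr E + B * (r powr E + (sqrt c2 + sqrt d) * r powr E)"
        using sawtooth_sum_split[of r s "\<delta> r" "p 1" f] 1 r1' s0[OF s(1)] del by simp
      thus "\<bar>sawtooth_sum f (p 1) r s\<bar> \<le> (c1 * Q + 1 + B * (1 + sqrt c2 + sqrt d)) * r powr E"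
        by (simp add: algebra_simps)
    qed
  next
    case (step i)
    then obtain C r0 where C: "\<And>r s. r0 \<le> r \<Longrightarrow> 1 / Q \<le> s \<Longrightarrow> s \<le> Q \<Longrightarrow> \<bar>sawtooth_sum f (p i) r s\<bar> \<le> C * r powr E"
      by (auto simp: Suc_le_eq)
    define d where "d = 1 / - D2 (S i) f (p i) + 1 / - D2 (S i) f (p (Suc i))"
    have Si: "S i = {p i..p (Suc i)}" using step by (simp add: S_def subinterval_def)
    have ple: "p i \<le> p (Suc i)" "0 \<le> p i" "p (Suc i) \<le> \<alpha>"
      using p_le[of i "Suc i"] p_le[of 0 i] p_le[of "Suc i" l] step l by auto
    have "D2 (S i) f (p i) < 0" "D2 (S i) f (p (Suc i)) < 0"
      using neg[of i "p i"] neg[of i "p (Suc i)"] step ple Si by auto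
    hence d0: "0 \<le> d" unfolding d_def by (intro add_nonneg_nonneg divide_nonneg_pos) auto
    show ?case
    proof (intro exI allI impI)
      fix r s assume r: "max 1 r0 \<le> r" and s: "1 / Q \<le> s" "s \<le> Q"
      have r1': "1 \<le> r" "r0 \<le> r" using r by auto
      have "\<bar>\<Sum>n | p i < real n * s / r \<and> real n * s / r \<le> p (Suc i). sawtooth (r * s * f (real n * s / r))\<bar> \<le>
        B * (r powr (2 / 3) + sqrt (r * (1 / - D2 (S i) f (p i) + 1 / - D2 (S i) f (p (Suc i)))))"
        unfolding B_def
      proof (rule sawtooth_sum_smooth_piece)
        show "C2_on (S i) f" using C2 step by simp
      qed (use neg[of i] mono[of i] step lip M Q s r1' ple Si in auto)
      also have "\<dots> \<le> B * (r powr E + sqrt d * r powr E)"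
      proof (intro mult_left_mono add_mono r23 r1' B)
        show "sqrt (r * (1 / - D2 (S i) f (p i) + 1 / - D2 (S i) f (p (Suc i)))) \<le> sqrt d * r powr E"
          unfolding d_def[symmetric] using sq[OF r1'(1)] d0 by (simp add: real_sqrt_mult mult.commute mult_left_mono)
      qed
      finally have "\<bar>sawtooth_sum f (p (Suc i)) r s\<bar> \<le> C * r powr E + B * (r powr E + sqrt d * r powr E)"
        using sawtooth_sum_split[of r s "p i" "p (Suc i)" f] C[OF r1'(2) s] r1' s0[OF s(1)] ple by simp
      thus "\<bar>sawtooth_sum f (p (Suc i)) r s\<bar> \<le> (C + B * (1 + sqrt d)) * r powr E"
        by (simp add: algebra_simps)
    qed
  qed
  from this[of l] show ?thesis using l by (simp add: E_def Suc_le_eq)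
qed

section \<open>Trapezoidal sums of concave functions\<close>

lemma antiderivative_increment_le:
  fixes \<Phi> h :: "real \<Rightarrow> real"
  assumes d: "\<And>t. t \<in> {0..a} \<Longrightarrow> (\<Phi> has_real_derivative h t) (at t within {0..a})"
    and uv: "0 \<le> u" "u \<le> v" "v \<le> a"
    and le: "\<And>t. u \<le> t \<Longrightarrow> t \<le> v \<Longrightarrow> h t \<le> A + B * (t - u)"
  shows "\<Phi> v - \<Phi> u \<le> A * (v - u) + B * (v - u)\<^sup>2 / 2"
proof (cases "u = v")
  case False
  define D where "D t = \<Phi> t - (A * (t - u) + B * (t - u)\<^sup>2 / 2)" for t
  have dD: "(D has_real_derivative h t - (A + B * (t - u))) (at t)" if "u < t" "t < v" for t
  proof -
    have "at t within {0..a} = at t" using that uv by (intro at_within_interior) auto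
    hence "(\<Phi> has_real_derivative h t) (at t)" using d[of t] that uv by simp
    thus ?thesis unfolding D_def by (auto intro!: derivative_eq_intros)
  qed
  have "\<exists>l z. u < z \<and> z < v \<and> (D has_real_derivative l) (at z) \<and> D v - D u = (v - u) * l"
  proof (rule MVT)
    have "continuous_on {0..a} \<Phi>" using d by (intro DERIV_continuous_on) auto
    thus "continuous_on {u..v} D" unfolding D_def
      using uv by (intro continuous_intros) (auto intro: continuous_on_subset)
  qed (use False uv dD in \<open>auto simp: real_differentiable_def\<close>)
  then obtain l z where z: "u < z" "z < v" "(D has_real_derivative l) (at z)" "D v - D u = (v - u) * l" by auto
  have "l \<le> 0" using DERIV_unique[OF z(3) dD] le[of z] z by simp
  hence "D v - D u \<le> 0" using z(4) uv by (simp add: mult_nonneg_nonpos)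
  thus ?thesis by (simp add: D_def)
qed simp

lemma antiderivative_increment_ge:
  fixes \<Phi> h :: "real \<Rightarrow> real"
  assumes d: "\<And>t. t \<in> {0..a} \<Longrightarrow> (\<Phi> has_real_derivative h t) (at t within {0..a})"
    and uv: "0 \<le> u" "u \<le> v" "v \<le> a"
    and ge: "\<And>t. u \<le> t \<Longrightarrow> t \<le> v \<Longrightarrow> A + B * (t - u) \<le> h t"
  shows "A * (v - u) + B * (v - u)\<^sup>2 / 2 \<le> \<Phi> v - \<Phi> u"
proof -
  have "- \<Phi> v - (- \<Phi> u) \<le> (- A) * (v - u) + (- B) * (v - u)\<^sup>2 / 2"
  proof (rule antiderivative_increment_le[where h = "\<lambda>t. - h t" and a = a])
    show "- h t \<le> - A + - B * (t - u)" if "u \<le> t" "t \<le> v" for t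
      using ge[OF that] by simp
  qed (use d uv in \<open>auto intro: DERIV_minus\<close>)
  thus ?thesis by simp
qed

lemma concave_chord:
  fixes h :: "real \<Rightarrow> real"
  assumes "concave_on {0..a} h" "0 \<le> x" "x \<le> y" "y \<le> z" "z \<le> a"
  shows "(z - y) * h x + (y - x) * h z \<le> (z - x) * h y"
proof (cases "x = z")
  case False
  hence xz: "x < z" using assms by simp
  define t where "t = (y - x) / (z - x)"
  have t: "0 \<le> t" "t \<le> 1" "1 - t = (z - y) / (z - x)"
    using assms xz by (auto simp: t_def field_simps)
  have "(1 - t) * h x + t * h z \<le> h ((1 - t) *\<^sub>R x + t *\<^sub>R z)"
    using assms t by (intro concave_onD[OF assms(1)]) auto
  also have "(1 - t) *\<^sub>R x + t *\<^sub>R z = x + t * (z - x)" by (simp add: algebra_simps)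
  also have "\<dots> = y" using xz by (simp add: t_def)
  finally have "(z - x) * ((1 - t) * h x + t * h z) \<le> (z - x) * h y"
    using xz by (intro mult_left_mono) auto
  moreover have "(z - x) * (1 - t) = z - y" using xz unfolding t(3) by simp
  moreover have "(z - x) * t = y - x" using xz by (simp add: t_def)
  ultimately show ?thesis by (simp add: distrib_left flip: mult.assoc)
qed (use assms in auto)

text \<open>
  For a concave function the trapezoidal rule errs on each cell after the first by at most half the
  second difference at the left end.  The errors therefore telescope to a single slope, and concavity alone
  makes the rule exact up to a constant.  The sawtooth term accounts for the incomplete last cell.
\<close>

lemma trapezoid_sum:
  fixes \<Phi> h :: "real \<Rightarrow> real"
  assumes a: "0 \<le> a"
    and d: "\<And>t. t \<in> {0..a} \<Longrightarrow> (\<Phi> has_real_derivative h t) (at t within {0..a})"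
    and conc: "concave_on {0..a} h" and lip: "lipschitz_decreasing M a h" and M: "0 \<le> M"
  shows "\<bar>(\<Sum>j\<le>nat \<lfloor>a\<rfloor>. h (real j)) - (\<Phi> a - \<Phi> 0 + h 0 / 2 - sawtooth a * h a)\<bar> \<le> 2 * M"
proof -
  have lip': "0 \<le> h x - h y" "h x - h y \<le> M * (y - x)" if "0 \<le> x" "x \<le> y" "y \<le> a" for x y
    using lip that by (auto simp: lipschitz_decreasing_def)
  define D where "D n = \<Phi> (real n) - \<Phi> 0 - (\<Sum>j<n. (h (real j) + h (real (Suc j))) / 2)" for n
  have D_low: "0 \<le> D n" if "real n \<le> a" for n
    using that
  proof (induction n)
    case (Suc n)
    have "h (real n) * (real (Suc n) - real n) + (h (real (Suc n)) - h (real n)) * (real (Suc n) - real n)\<^sup>2 / 2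
      \<le> \<Phi> (real (Suc n)) - \<Phi> (real n)"
    proof (rule antiderivative_increment_ge[OF d])
      fix t assume t: "real n \<le> t" "t \<le> real (Suc n)"
      have "(real (Suc n) - t) * h (real n) + (t - real n) * h (real (Suc n)) \<le> (real (Suc n) - real n) * h t"
        using t Suc.prems by (intro concave_chord[OF conc]) auto
      thus "h (real n) + (h (real (Suc n)) - h (real n)) * (t - real n) \<le> h t" by (simp add: algebra_simps)
    qed (use Suc.prems in auto)
    thus ?case using Suc by (simp add: D_def field_simps)
  qed (simp add: D_def)
  \<comment> \<open>Beyond the first cell, \<open>h\<close> lies below the line through its values at the two preceding integers.\<close>
  have D_up: "D (Suc n) \<le> (h (real n) - h (real (Suc n))) / 2" if "real (Suc n) \<le> a" for n
    using that
  proof (induction n)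
    case 0
    have "\<Phi> 1 - \<Phi> 0 \<le> h 0 * (1 - 0) + 0 * (1 - 0)\<^sup>2 / 2"
      by (rule antiderivative_increment_le[OF d]) (use 0 lip'(1)[of 0] in auto)
    thus ?case by (simp add: D_def field_simps)
  next
    case (Suc n)
    have "\<Phi> (real (Suc (Suc n))) - \<Phi> (real (Suc n)) \<le>
      h (real (Suc n)) * (real (Suc (Suc n)) - real (Suc n)) +
      (h (real (Suc n)) - h (real n)) * (real (Suc (Suc n)) - real (Suc n))\<^sup>2 / 2"
    proof (rule antiderivative_increment_le[OF d])
      fix t assume t: "real (Suc n) \<le> t" "t \<le> real (Suc (Suc n))"
      have "(t - real (Suc n)) * h (real n) + (real (Suc n) - real n) * h t \<le> (t - real n) * h (real (Suc n))"
        using t Suc.prems by (intro concave_chord[OF conc]) auto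
      thus "h t \<le> h (real (Suc n)) + (h (real (Suc n)) - h (real n)) * (t - real (Suc n))" by (simp add: algebra_simps)
    qed (use Suc.prems in auto)
    moreover have "D (Suc n) \<le> (h (real n) - h (real (Suc n))) / 2" using Suc by simp
    moreover have "D (Suc (Suc n)) = D (Suc n) + (\<Phi> (real (Suc (Suc n))) - \<Phi> (real (Suc n)))
       - (h (real (Suc n)) + h (real (Suc (Suc n)))) / 2"
      by (simp add: D_def)
    ultimately show ?case by (simp add: field_simps)
  qed
  define n where "n = nat \<lfloor>a\<rfloor>"
  have n: "real n \<le> a" "a \<le> real n + 1" "sawtooth a = a - real n - 1 / 2"
  proof -
    have "real n = real_of_int \<lfloor>a\<rfloor>" using a by (simp add: n_def)
    thus "real n \<le> a" "a \<le> real n + 1" "sawtooth a = a - real n - 1 / 2"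
      unfolding sawtooth_def frac_def by linarith+
  qed
  have Dn: "0 \<le> D n" "D n \<le> M / 2"
  proof -
    show "0 \<le> D n" by (rule D_low[OF n(1)])
    show "D n \<le> M / 2"
    proof (cases n)
      case 0 thus ?thesis using M by (simp add: D_def)
    next
      case (Suc m)
      have "h (real m) - h (real (Suc m)) \<le> M * (real (Suc m) - real m)"
        using n Suc by (intro lip') auto
      thus ?thesis using D_up[of m] n Suc by simp
    qed
  qed
  have eta: "0 \<le> h (real n) - h a" "h (real n) - h a \<le> M"
  proof -
    have "M * (a - real n) \<le> M * 1" using n M by (intro mult_left_mono) auto
    thus "0 \<le> h (real n) - h a" "h (real n) - h a \<le> M" using lip'[of "real n" a] n by auto
  qed
  have tau1: "\<Phi> a - \<Phi> (real n) \<le> h (real n) * (a - real n) + 0 * (a - real n)\<^sup>2 / 2"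
    by (rule antiderivative_increment_le[OF d]) (use n lip'(1)[of "real n"] in auto)
  have tau2: "h a * (a - real n) + 0 * (a - real n)\<^sup>2 / 2 \<le> \<Phi> a - \<Phi> (real n)"
    by (rule antiderivative_increment_ge[OF d]) (use n lip'(1)[of _ a] in auto)
  have tau3: "(h (real n) - h a) * (a - real n) \<le> M * 1"
    using eta n M by (intro mult_mono) auto
  have S: "(\<Sum>j\<le>m. h (real j)) = (\<Sum>j<m. (h (real j) + h (real (Suc j))) / 2) + h 0 / 2 + h (real m) / 2" for m
    by (induction m) (auto simp: field_simps)
  define \<tau> where "\<tau> = \<Phi> a - \<Phi> (real n) - h a * (a - real n)"
  have "0 \<le> \<tau>" "\<tau> \<le> M" using tau1 tau2 tau3 by (auto simp: \<tau>_def algebra_simps)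
  moreover have "(\<Sum>j\<le>n. h (real j)) - (\<Phi> a - \<Phi> 0 + h 0 / 2 - sawtooth a * h a) =
     - D n - \<tau> + (h (real n) - h a) / 2"
    unfolding S n(3) D_def \<tau>_def by (simp add: field_simps)
  ultimately show ?thesis using Dn eta unfolding n_def[symmetric] by (simp add: abs_le_iff field_simps)
qed

section \<open>Decreasing concave curves and their inverses\<close>

lemma lipschitz_decreasing_initial_arc:
  assumes cv: "decreasing_concave_curve L f" and \<alpha>: "0 \<le> \<alpha>" "\<alpha> < L"
  shows "lipschitz_decreasing (f \<alpha> / (L - \<alpha>)) \<alpha> f"
  unfolding lipschitz_decreasing_def
proof (intro allI impI)
  fix x y assume xy: "0 \<le> x" "x \<le> y" "y \<le> \<alpha>"
  have conc: "concave_on {0..L} f" and fL: "f L = 0" and anti: "strict_antimono_on {0..L} f"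
    using cv by (auto simp: decreasing_concave_curve_def)
  have mono: "f v \<le> f u" if "0 \<le> u" "u \<le> v" "v \<le> L" for u v
    using monotone_onD[OF anti, of u v] that by (cases "u = v") auto
  have 1: "(L - y) * f x + (y - x) * f L \<le> (L - x) * f y"
    using xy \<alpha> by (intro concave_chord[OF conc]) auto
  have 2: "(L - \<alpha>) * f y + (\<alpha> - y) * f L \<le> (L - y) * f \<alpha>"
    using xy \<alpha> by (intro concave_chord[OF conc]) auto
  have "(L - y) * (f x - f y) \<le> (y - x) * f y" using 1 fL by (simp add: algebra_simps)
  hence "(L - y) * (L - \<alpha>) * (f x - f y) \<le> (y - x) * ((L - \<alpha>) * f y)"
    using \<alpha> mult_left_mono[of "(L - y) * (f x - f y)" "(y - x) * f y" "L - \<alpha>"] by (simp add: mult_ac)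
  also have "\<dots> \<le> (y - x) * ((L - y) * f \<alpha>)" using 2 fL xy by (intro mult_left_mono) auto
  finally have "(L - y) * ((L - \<alpha>) * (f x - f y)) \<le> (L - y) * (f \<alpha> * (y - x))" by (simp add: mult_ac)
  hence "(L - \<alpha>) * (f x - f y) \<le> f \<alpha> * (y - x)" using xy \<alpha> by simp
  hence "f x - f y \<le> f \<alpha> / (L - \<alpha>) * (y - x)" using \<alpha> by (simp add: field_simps)
  thus "0 \<le> f x - f y \<and> f x - f y \<le> f \<alpha> / (L - \<alpha>) * (y - x)" using mono[of x y] xy \<alpha> by simp
qed

text \<open>
  The hypotheses on the curve are symmetric in the two coordinates.
\<close>

lemma inverse_curve:
  assumes L: "0 < L" and cv: "decreasing_concave_curve L f"
    and g: "\<And>x. x \<in> {0..L} \<Longrightarrow> g (f x) = x"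
  shows "decreasing_concave_curve L g" and "\<And>y. y \<in> {0..L} \<Longrightarrow> f (g y) = y"
    and "\<And>x. x \<in> {0..L} \<Longrightarrow> f x \<in> {0..L}" and "\<And>y. y \<in> {0..L} \<Longrightarrow> g y \<in> {0..L}"
proof -
  have cont: "continuous_on {0..L} f" and conc: "concave_on {0..L} f" and anti: "strict_antimono_on {0..L} f"
    and f0: "f 0 = L" and fL: "f L = 0"
    using cv by (auto simp: decreasing_concave_curve_def)
  have mono: "f v \<le> f u" if "0 \<le> u" "u \<le> v" "v \<le> L" for u v
    using monotone_onD[OF anti, of u v] that by (cases "u = v") auto
  show f_in: "f x \<in> {0..L}" if "x \<in> {0..L}" for x
    using mono[of 0 x] mono[of x L] that by (simp add: f0 fL)
  have surj: "\<exists>x\<in>{0..L}. f x = y" if "y \<in> {0..L}" for y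
    using IVT2'[of f L y 0] that cont L by (auto simp: f0 fL)
  show fg: "f (g y) = y" if "y \<in> {0..L}" for y using surj[OF that] g by auto
  show g_in: "g y \<in> {0..L}" if "y \<in> {0..L}" for y using surj[OF that] g by auto
  have img: "f ` {0..L} = {0..L}"
    using f_in surj by (intro subset_antisym subsetI) (blast, metis imageI)
  have ganti: "g z < g y" if "y \<in> {0..L}" "z \<in> {0..L}" "y < z" for y z
  proof (rule ccontr)
    assume "\<not> g z < g y"
    hence "f (g z) \<le> f (g y)" using g_in[OF that(1)] g_in[OF that(2)] by (intro mono) auto
    thus False using fg that by simp
  qed
  have "continuous_on {0..L} g"
    using continuous_on_inv[of "{0..L}" f g] cont g img by auto
  moreover have "strict_antimono_on {0..L} g" using ganti by (auto intro!: monotone_onI)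
  moreover have "concave_on {0..L} g"
    unfolding concave_on_iff
  proof (intro conjI ballI allI impI)
    fix y z u v :: real
    assume yz: "y \<in> {0..L}" "z \<in> {0..L}" and uv: "0 \<le> u" "0 \<le> v" "u + v = 1"
    define x where "x = u * g y + v * g z"
    have x: "x \<in> {0..L}"
      using convexD[of "{0..L}" "g y" "g z" u v] g_in yz uv by (simp add: x_def)
    have m: "u * y + v * z \<in> {0..L}"
      using convexD[of "{0..L}" y z u v] yz uv by simp
    have "u * f (g y) + v * f (g z) \<le> f (u *\<^sub>R g y + v *\<^sub>R g z)"
      using conc g_in yz uv unfolding concave_on_iff by blast
    hence "u * y + v * z \<le> f x" using fg yz by (simp add: x_def)
    hence "g (f x) \<le> g (u * y + v * z)"
      using ganti[OF m f_in[OF x]] by (cases "u * y + v * z = f x") auto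
    thus "u * g y + v * g z \<le> g (u *\<^sub>R y + v *\<^sub>R z)" using g x by (simp add: x_def)
  qed simp
  moreover have "g 0 = L" "g L = 0" using g[of L] g[of 0] L by (auto simp: f0 fL)
  ultimately show "decreasing_concave_curve L g" by (simp add: decreasing_concave_curve_def)
qed

section \<open>The area under the curve\<close>

definition region_under :: "real \<Rightarrow> (real \<Rightarrow> real) \<Rightarrow> (real \<times> real) set" where
  "region_under a f = {(x, y). 0 \<le> x \<and> x \<le> a \<and> 0 \<le> y \<and> y \<le> f x}"

lemma sets_lborel_pair: "sets (lborel \<Otimes>\<^sub>M lborel) = sets (borel :: (real \<times> real) measure)"
  by (metis lborel_prod sets_lborel)

lemma region_under_measure:
  assumes cont: "continuous_on {0..a} f" and nn: "\<And>x. x \<in> {0..a} \<Longrightarrow> 0 \<le> f x"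
  shows "region_under a f \<in> fmeasurable lborel"
    and "measure lborel (region_under a f) = integral {0..a} f"
proof -
  define R where "R = region_under a f"
  have "closed {z \<in> {0..a} \<times> {0..}. snd z \<le> f (fst z)}"
    by (intro continuous_on_closed_Collect_le continuous_intros continuous_on_compose2[OF cont] closed_Times) auto
  moreover have "R = {z \<in> {0..a} \<times> {0..}. snd z \<le> f (fst z)}"
    by (auto simp: R_def region_under_def)
  ultimately have R: "R \<in> sets (lborel \<Otimes>\<^sub>M lborel)" unfolding sets_lborel_pair by (simp only: borel_closed)
  have si: "set_integrable lborel {0..a} f"
    using cont by (intro borel_integrable_compact[folded set_integrable_def]) auto
  have int0: "0 \<le> integral {0..a} f" using nn by (intro integral_nonneg integrable_continuous_real cont) auto
  have "emeasure lborel R = (\<integral>\<^sup>+x. emeasure lborel (Pair x -` R) \<partial>lborel)"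
    using lborel.emeasure_pair_measure_alt[OF R] by (simp add: lborel_prod)
  also have "\<dots> = (\<integral>\<^sup>+x. ennreal (indicator {0..a} x *\<^sub>R f x) \<partial>lborel)"
  proof (rule nn_integral_cong)
    fix x :: real
    have "Pair x -` R = (if x \<in> {0..a} then {0..f x} else {})" by (auto simp: R_def region_under_def)
    thus "emeasure lborel (Pair x -` R) = ennreal (indicator {0..a} x *\<^sub>R f x)"
      using nn[of x] by simp
  qed
  also have "\<dots> = ennreal (LINT x:{0..a}|lborel. f x)"
    unfolding set_lebesgue_integral_def
    using si nn by (intro nn_integral_eq_integral) (auto simp: set_integrable_def indicator_def)
  also have "(LINT x:{0..a}|lborel. f x) = integral {0..a} f"
    by (rule set_borel_integral_eq_integral(2)[OF si])
  finally have E: "emeasure lborel R = ennreal (integral {0..a} f)" .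
  show "region_under a f \<in> fmeasurable lborel"
    using R E unfolding sets_lborel_pair by (auto simp: fmeasurable_def R_def)
  show "measure lborel (region_under a f) = integral {0..a} f"
    using E int0 by (simp add: measure_def R_def)
qed

text \<open>
  Needed because the part of the region described by \<open>g\<close> is the region under a graph only after the
  coordinates are exchanged.
\<close>

lemma measure_lborel_swap:
  fixes A :: "(real \<times> real) set"
  assumes A: "A \<in> fmeasurable lborel"
  shows "{(x, y). (y, x) \<in> A} \<in> fmeasurable lborel"
    and "measure lborel {(x, y). (y, x) \<in> A} = measure lborel A"
proof -
  have A': "A \<in> sets (lborel \<Otimes>\<^sub>M lborel)" using A unfolding sets_lborel_pair by (auto simp: fmeasurable_def)
  have meas: "(\<lambda>(x, y). (y, x)) \<in> measurable (lborel \<Otimes>\<^sub>M lborel) (lborel \<Otimes>\<^sub>M (lborel :: real measure) :: (real \<times> real) measure)"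
    by (rule measurable_pair_swap')
  have S: "{(x, y). (y, x) \<in> A} = (\<lambda>(x, y). (y, x)) -` A \<inter> space (lborel \<Otimes>\<^sub>M lborel)"
    by (auto simp: space_pair_measure)
  have "emeasure lborel A = emeasure (distr (lborel \<Otimes>\<^sub>M lborel) (lborel \<Otimes>\<^sub>M lborel) (\<lambda>(x, y). (y, x))) A"
    using lborel_pair.distr_pair_swap by (metis lborel_prod)
  also have "\<dots> = emeasure (lborel \<Otimes>\<^sub>M lborel) {(x, y). (y, x) \<in> A}"
    unfolding S by (rule emeasure_distr[OF meas A'])
  finally have E: "emeasure lborel {(x, y). (y, x) \<in> A} = emeasure lborel A" by (simp add: lborel_prod)
  have "{(x, y). (y, x) \<in> A} \<in> sets (lborel \<Otimes>\<^sub>M lborel)" unfolding S by (rule measurable_sets[OF meas A'])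
  thus "{(x, y). (y, x) \<in> A} \<in> fmeasurable lborel"
    using A E unfolding sets_lborel_pair by (auto simp: fmeasurable_def)
  show "measure lborel {(x, y). (y, x) \<in> A} = measure lborel A"
    using E by (simp add: measure_def)
qed

section \<open>Counting lattice points by columns and rows\<close>

lemma of_nat_Suc_floor: "0 \<le> y \<Longrightarrow> real (Suc (nat \<lfloor>y\<rfloor>)) = y + 1 / 2 - sawtooth y"
  by (simp add: sawtooth_def frac_def)

lemma nat_le_iff_le_floor: "0 \<le> y \<Longrightarrow> j \<le> nat \<lfloor>y\<rfloor> \<longleftrightarrow> real j \<le> y"
  by (simp add: le_nat_iff le_floor_iff)

lemma scaled_le_iff:
  assumes "0 < r" "0 < s" "0 \<le> a"
  shows "real j * s / r \<le> a \<longleftrightarrow> j \<le> nat \<lfloor>r * a / s\<rfloor>"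
  using assms by (subst nat_le_iff_le_floor) (auto simp: field_simps)

text \<open>
  The number of lattice points in the closed first quadrant on or below the graph of
  \<open>x \<mapsto> r * s * f (s * x / r)\<close> with abscissa at most \<open>r * a / s\<close>, where \<open>f\<close> is nonnegative.  Applied to \<open>g\<close> and \<open>1 / s\<close> it
  counts by rows.
\<close>

definition column_count :: "(real \<Rightarrow> real) \<Rightarrow> real \<Rightarrow> real \<Rightarrow> real \<Rightarrow> nat" where
  "column_count f a r s = (\<Sum>j\<le>nat \<lfloor>r * a / s\<rfloor>. Suc (nat \<lfloor>r * s * f (real j * s / r)\<rfloor>))"

text \<open>
  A curve together with its inverse function.  Since \<open>curve_pair L g f\<close> holds as well, every result
  proved about columns applies to rows, with \<open>1 / s\<close> in place of \<open>s\<close>.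
\<close>

locale curve_pair =
  fixes L :: real and f g :: "real \<Rightarrow> real"
  assumes L_pos: "0 < L" and curve: "decreasing_concave_curve L f"
    and inverse: "\<And>x. x \<in> {0..L} \<Longrightarrow> g (f x) = x"
begin

lemma f_cont: "continuous_on {0..L} f" and f_conc: "concave_on {0..L} f" and f_0: "f 0 = L" and f_L: "f L = 0"
  using curve by (auto simp: decreasing_concave_curve_def)

lemma f_strict:
  assumes "0 \<le> x" "x < y" "y \<le> L"
  shows "f y < f x"
proof -
  have "strict_antimono_on {0..L} f" using curve by (simp add: decreasing_concave_curve_def)
  from monotone_onD[OF this, of x y] show ?thesis using assms by simp
qed

lemma f_antimono: "0 \<le> x \<Longrightarrow> x \<le> y \<Longrightarrow> y \<le> L \<Longrightarrow> f y \<le> f x"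
  using f_strict[of x y] by (cases "x = y") auto

lemma f_nonneg: "0 \<le> x \<Longrightarrow> x \<le> L \<Longrightarrow> 0 \<le> f x" and f_le_L: "0 \<le> x \<Longrightarrow> x \<le> L \<Longrightarrow> f x \<le> L"
  using f_antimono[of x L] f_antimono[of 0 x] by (auto simp: f_0 f_L)

lemma f_inverse: "0 \<le> y \<Longrightarrow> y \<le> L \<Longrightarrow> f (g y) = y"
  and g_nonneg: "0 \<le> y \<Longrightarrow> y \<le> L \<Longrightarrow> 0 \<le> g y" and g_le_L: "0 \<le> y \<Longrightarrow> y \<le> L \<Longrightarrow> g y \<le> L"
  using inverse_curve(2,4)[OF L_pos curve inverse, of y] by auto

lemma swap: "curve_pair L g f"
  using inverse_curve(1,2)[OF L_pos curve inverse] L_pos by unfold_locales auto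

lemma le_f_iff_le_g:
  assumes "0 \<le> x" "0 \<le> y"
  shows "x \<le> L \<and> y \<le> f x \<longleftrightarrow> y \<le> L \<and> x \<le> g y"
proof
  assume *: "x \<le> L \<and> y \<le> f x"
  hence y: "y \<le> L" using f_le_L[of x] assms by simp
  have "x \<le> g y"
  proof (rule ccontr)
    assume "\<not> x \<le> g y"
    hence "f x < f (g y)" using assms * y g_nonneg[of y] by (intro f_strict) auto
    thus False using f_inverse[of y] assms y * by simp
  qed
  thus "y \<le> L \<and> x \<le> g y" using y by simp
next
  assume *: "y \<le> L \<and> x \<le> g y"
  hence "x \<le> L" using g_le_L[of y] assms by simp
  moreover have "f (g y) \<le> f x" using * assms g_le_L[of y] by (intro f_antimono) auto
  ultimately show "x \<le> L \<and> y \<le> f x" using f_inverse[of y] assms * by simp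
qed

text \<open>
  A column of height \<open>y\<close> contains \<open>y + 1 / 2 - sawtooth y\<close> points; the heights are summed by
  \<open>trapezoid_sum\<close>.
\<close>

lemma column_count_asymptotics:
  assumes \<alpha>: "0 < \<alpha>" "\<alpha> < L" and rs: "0 < r" "0 < s"
  shows "\<bar>real (column_count f \<alpha> r s) - (r\<^sup>2 * integral {0..\<alpha>} f + r * s * L / 2
      - sawtooth (r * \<alpha> / s) * (r * s * f \<alpha>) + (r * \<alpha> / s + 1 / 2 - sawtooth (r * \<alpha> / s)) / 2
      - sawtooth_sum f \<alpha> r s)\<bar> \<le> 2 * (f \<alpha> / (L - \<alpha>) * s\<^sup>2)"
proof -
  define a h \<Phi> where "a = r * \<alpha> / s" and "h t = r * s * f (t * s / r)"
    and "\<Phi> t = r\<^sup>2 * integral {0..t * s / r} f" for t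
  define M where "M = f \<alpha> / (L - \<alpha>)"
  have M: "0 \<le> M" using f_nonneg[of \<alpha>] \<alpha> by (simp add: M_def)
  have a: "0 \<le> a" "a * s / r = \<alpha>" using \<alpha> rs by (auto simp: a_def)
  have sc: "t * s / r \<in> {0..\<alpha>}" if "t \<in> {0..a}" for t
    using that rs \<alpha> by (auto simp: a_def field_simps)
  have "\<bar>(\<Sum>j\<le>nat \<lfloor>a\<rfloor>. h (real j)) - (\<Phi> a - \<Phi> 0 + h 0 / 2 - sawtooth a * h a)\<bar> \<le> 2 * (M * s\<^sup>2)"
  proof (rule trapezoid_sum[OF a(1)])
    fix t assume t: "t \<in> {0..a}"
    have "((\<lambda>x. integral {0..x} f) has_real_derivative f (t * s / r)) (at (t * s / r) within {0..L})"
      using sc[OF t] \<alpha> by (intro integral_has_real_derivative f_cont) auto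
    hence "((\<lambda>x. integral {0..x} f) has_real_derivative f (t * s / r)) (at (t * s / r) within (\<lambda>t. t * s / r) ` {0..a})"
      by (rule DERIV_subset) (use sc \<alpha> in force)
    moreover have "((\<lambda>t. t * s / r) has_real_derivative s / r) (at t within {0..a})"
      using rs by (auto intro!: derivative_eq_intros)
    ultimately have "((\<lambda>x. integral {0..x} f) \<circ> (\<lambda>t. t * s / r) has_real_derivative f (t * s / r) * (s / r)) (at t within {0..a})"
      by (rule DERIV_image_chain)
    hence "((\<lambda>t. r\<^sup>2 * ((\<lambda>x. integral {0..x} f) \<circ> (\<lambda>t. t * s / r)) t) has_real_derivative r\<^sup>2 * (f (t * s / r) * (s / r))) (at t within {0..a})"
      by (rule DERIV_cmult)
    moreover have "r\<^sup>2 * (f (t * s / r) * (s / r)) = h t" using rs by (simp add: h_def power2_eq_square)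
    ultimately show "(\<Phi> has_real_derivative h t) (at t within {0..a})" by (simp add: \<Phi>_def[abs_def] o_def)
  next
    show "concave_on {0..a} h"
      unfolding concave_on_iff
    proof (intro conjI ballI allI impI)
      fix x y u v :: real
      assume xy: "x \<in> {0..a}" "y \<in> {0..a}" and uv: "0 \<le> u" "0 \<le> v" "u + v = 1"
      have "u * f (x * s / r) + v * f (y * s / r) \<le> f (u *\<^sub>R (x * s / r) + v *\<^sub>R (y * s / r))"
      proof -
        have "x * s / r \<in> {0..L}" "y * s / r \<in> {0..L}" using sc[OF xy(1)] sc[OF xy(2)] \<alpha> by auto
        thus ?thesis using f_conc uv unfolding concave_on_iff by blast
      qed
      hence "r * s * (u * f (x * s / r) + v * f (y * s / r)) \<le> r * s * f (u *\<^sub>R (x * s / r) + v *\<^sub>R (y * s / r))"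
        using rs by (intro mult_left_mono) auto
      moreover have "u *\<^sub>R (x * s / r) + v *\<^sub>R (y * s / r) = (u *\<^sub>R x + v *\<^sub>R y) * s / r"
        using rs by (simp add: field_simps)
      ultimately show "u * h x + v * h y \<le> h (u *\<^sub>R x + v *\<^sub>R y)" by (simp add: h_def algebra_simps)
    qed simp
    show "lipschitz_decreasing (M * s\<^sup>2) a h"
      unfolding lipschitz_decreasing_def
    proof (intro allI impI)
      fix x y assume xy: "0 \<le> x" "x \<le> y" "y \<le> a"
      have le: "x * s / r \<le> y * s / r" using xy rs by (intro divide_right_mono mult_right_mono) auto
      have "0 \<le> f (x * s / r) - f (y * s / r) \<and> f (x * s / r) - f (y * s / r) \<le> M * (y * s / r - x * s / r)"
        using lipschitz_decreasing_initial_arc[OF curve, of \<alpha>] \<alpha> sc[of x] sc[of y] xy le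
        by (auto simp: lipschitz_decreasing_def M_def)
      hence *: "0 \<le> f (x * s / r) - f (y * s / r)" "f (x * s / r) - f (y * s / r) \<le> M * (y * s / r - x * s / r)" by auto
      have "h x - h y = r * s * (f (x * s / r) - f (y * s / r))" by (simp add: h_def right_diff_distrib)
      moreover have "r * s * (M * (y * s / r - x * s / r)) = M * s\<^sup>2 * (y - x)"
        using rs by (simp add: power2_eq_square field_simps)
      moreover have "0 \<le> r * s" using rs by simp
      ultimately show "0 \<le> h x - h y \<and> h x - h y \<le> M * s\<^sup>2 * (y - x)"
        using mult_left_mono[OF *(2), of "r * s"] mult_nonneg_nonneg[OF _ *(1), of "r * s"] by presburger
    qed
  qed (use M in simp)
  moreover have "\<Phi> a - \<Phi> 0 + h 0 / 2 - sawtooth a * h a =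
      r\<^sup>2 * integral {0..\<alpha>} f + r * s * L / 2 - sawtooth a * (r * s * f \<alpha>)"
    by (simp add: \<Phi>_def h_def a(2) f_0)
  moreover have "real (column_count f \<alpha> r s) = (\<Sum>j\<le>nat \<lfloor>a\<rfloor>. h (real j)) + (a + 1 / 2 - sawtooth a) / 2 - sawtooth_sum f \<alpha> r s"
  proof -
    have "real (column_count f \<alpha> r s) = (\<Sum>j\<le>nat \<lfloor>a\<rfloor>. real (Suc (nat \<lfloor>h (real j)\<rfloor>)))"
      by (simp add: column_count_def a_def h_def)
    also have "\<dots> = (\<Sum>j\<le>nat \<lfloor>a\<rfloor>. h (real j) + 1 / 2 - sawtooth (h (real j)))"
    proof (intro sum.cong refl of_nat_Suc_floor)
      fix j assume "j \<in> {..nat \<lfloor>a\<rfloor>}"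
      hence "real j * s / r \<le> \<alpha>" using scaled_le_iff[of r s \<alpha> j] rs \<alpha> by (simp add: a_def)
      thus "0 \<le> h (real j)" unfolding h_def using rs \<alpha> by (intro mult_nonneg_nonneg f_nonneg) auto
    qed
    also have "\<dots> = (\<Sum>j\<le>nat \<lfloor>a\<rfloor>. h (real j)) + real (Suc (nat \<lfloor>a\<rfloor>)) / 2 - (\<Sum>j\<le>nat \<lfloor>a\<rfloor>. sawtooth (h (real j)))"
      by (simp add: sum.distrib sum_subtractf)
    also have "real (Suc (nat \<lfloor>a\<rfloor>)) = a + 1 / 2 - sawtooth a" by (rule of_nat_Suc_floor[OF a(1)])
    also have "(\<Sum>j\<le>nat \<lfloor>a\<rfloor>. sawtooth (h (real j))) = sawtooth_sum f \<alpha> r s"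
    proof -
      have "{n. real n * s / r \<le> \<alpha>} = {..nat \<lfloor>a\<rfloor>}"
        using scaled_le_iff[of r s \<alpha>] rs \<alpha> by (auto simp: a_def)
      thus ?thesis by (simp add: sawtooth_sum_def h_def)
    qed
    finally show ?thesis .
  qed
  ultimately show ?thesis unfolding a_def[symmetric] M_def[symmetric] by (simp add: algebra_simps)
qed

text \<open>
  The points are counted by columns up to the abscissa of \<open>(\<alpha>, f \<alpha>)\<close> and by rows up to its ordinate;
  the rectangle spanned by the two ranges is counted twice.  This keeps both counts on arcs of
  bounded slope.
\<close>

lemma lattice_count_decomposition:
  assumes \<alpha>: "0 < \<alpha>" "\<alpha> < L" and rs: "0 < r" "0 < s"
  shows "lattice_count L f r s + Suc (nat \<lfloor>r * \<alpha> / s\<rfloor>) * Suc (nat \<lfloor>r * f \<alpha> / (1 / s)\<rfloor>) =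
    column_count f \<alpha> r s + column_count g (f \<alpha>) r (1 / s)"
proof -
  define na nb where "na = nat \<lfloor>r * \<alpha> / s\<rfloor>" and "nb = nat \<lfloor>r * f \<alpha> / (1 / s)\<rfloor>"
  define X Y where "X j = real j * s / r" and "Y k = real k * (1 / s) / r" for j k
  define A where "A = Sigma {..na} (\<lambda>j. {..nat \<lfloor>r * s * f (X j)\<rfloor>})"
  define B where "B = Sigma {..nb} (\<lambda>k. {..nat \<lfloor>r * (1 / s) * g (Y k)\<rfloor>})"
  define B' where "B' = prod.swap ` B"
  define S where "S = {(j :: nat, k :: nat). real j * s / r \<le> L \<and> real k \<le> r * s * f (real j * s / r)}"
  have XY: "0 \<le> X j" "0 \<le> Y k" for j k using rs by (auto simp: X_def Y_def)
  have fa: "0 \<le> f \<alpha>" "f \<alpha> \<le> L" using f_nonneg[of \<alpha>] f_le_L[of \<alpha>] \<alpha> by auto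
  have na: "j \<le> na \<longleftrightarrow> X j \<le> \<alpha>" for j using scaled_le_iff[of r s \<alpha> j] rs \<alpha> by (simp add: na_def X_def)
  have nb: "k \<le> nb \<longleftrightarrow> Y k \<le> f \<alpha>" for k using scaled_le_iff[of r "1 / s" "f \<alpha>" k] rs fa by (simp add: nb_def Y_def)
  have k_iff: "real k \<le> r * s * y \<longleftrightarrow> Y k \<le> y" for k y using rs by (simp add: Y_def field_simps)
  have j_iff: "real j \<le> r * (1 / s) * x \<longleftrightarrow> X j \<le> x" for j x using rs by (simp add: X_def field_simps)
  have inA: "(j, k) \<in> A \<longleftrightarrow> X j \<le> \<alpha> \<and> Y k \<le> f (X j)" for j k
  proof (cases "X j \<le> \<alpha>")
    case True
    hence "0 \<le> r * s * f (X j)" using rs \<alpha> XY f_nonneg[of "X j"] by simp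
    thus ?thesis using True by (simp add: A_def na nat_le_iff_le_floor k_iff)
  qed (simp add: A_def na)
  have inB: "(j, k) \<in> B' \<longleftrightarrow> Y k \<le> f \<alpha> \<and> X j \<le> g (Y k)" for j k
  proof -
    have "(j, k) \<in> B' \<longleftrightarrow> (k, j) \<in> B" by (force simp: B'_def)
    also have "\<dots> \<longleftrightarrow> Y k \<le> f \<alpha> \<and> X j \<le> g (Y k)"
    proof (cases "Y k \<le> f \<alpha>")
      case True
      hence "0 \<le> r * (1 / s) * g (Y k)" using rs fa XY g_nonneg[of "Y k"] by simp
      thus ?thesis using True by (simp only: B_def mem_Sigma_iff atMost_iff nb nat_le_iff_le_floor j_iff)
    qed (simp add: B_def nb)
    finally show ?thesis .
  qed
  have inS: "(j, k) \<in> S \<longleftrightarrow> X j \<le> L \<and> Y k \<le> f (X j)" for j k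
    by (simp add: S_def k_iff X_def[symmetric])
  have "S = A \<union> B'"
  proof (rule set_eqI, clarify)
    fix j k
    have "X j \<le> L \<and> Y k \<le> f (X j) \<longleftrightarrow> (X j \<le> \<alpha> \<and> Y k \<le> f (X j)) \<or> (Y k \<le> f \<alpha> \<and> X j \<le> g (Y k))"
      using le_f_iff_le_g[OF XY(1,2), of j k] \<alpha> fa f_antimono[of \<alpha> "X j"] by (cases "X j \<le> \<alpha>") auto
    thus "(j, k) \<in> S \<longleftrightarrow> (j, k) \<in> A \<union> B'" by (simp add: inS inA inB)
  qed
  moreover have "A \<inter> B' = {..na} \<times> {..nb}"
  proof (rule set_eqI, clarify)
    fix j k
    have "X j \<le> \<alpha> \<Longrightarrow> Y k \<le> f \<alpha> \<Longrightarrow> Y k \<le> f (X j)"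
      using f_antimono[of "X j" \<alpha>] XY[of j] \<alpha> by auto
    hence "(X j \<le> \<alpha> \<and> Y k \<le> f (X j)) \<and> (Y k \<le> f \<alpha> \<and> X j \<le> g (Y k)) \<longleftrightarrow> X j \<le> \<alpha> \<and> Y k \<le> f \<alpha>"
      using le_f_iff_le_g[OF XY(1,2), of j k] \<alpha> by auto
    thus "(j, k) \<in> A \<inter> B' \<longleftrightarrow> (j, k) \<in> {..na} \<times> {..nb}" by (simp add: inA inB na nb)
  qed
  moreover have "finite A" "finite B" by (auto simp: A_def B_def)
  moreover have "card B' = card B" unfolding B'_def by (intro card_image) auto
  moreover have "card A = column_count f \<alpha> r s"
    by (simp add: A_def column_count_def na_def X_def card_SigmaI)
  moreover have "card B = column_count g (f \<alpha>) r (1 / s)"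
    by (simp add: B_def column_count_def nb_def Y_def card_SigmaI)
  moreover have "finite B'" using \<open>finite B\<close> by (simp add: B'_def)
  ultimately have "card S + Suc na * Suc nb = column_count f \<alpha> r s + column_count g (f \<alpha>) r (1 / s)"
    using card_Un_Int[of A B'] by (simp add: card_cartesian_product)
  thus ?thesis
    unfolding lattice_count_def S_def[symmetric] na_def[symmetric] nb_def[symmetric] .
qed

lemma curve_area_eq_integral: "curve_area L f = integral {0..L} f"
  using region_under_measure(2)[OF f_cont] f_nonneg by (simp add: curve_area_def region_under_def)

lemma curve_area_decomposition:
  assumes \<alpha>: "0 < \<alpha>" "\<alpha> < L"
  shows "curve_area L f = integral {0..\<alpha>} f + integral {0..f \<alpha>} g - \<alpha> * f \<alpha>"
proof -
  interpret s: curve_pair L g f by (rule swap)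
  have fa: "0 \<le> f \<alpha>" "f \<alpha> \<le> L" using f_nonneg[of \<alpha>] f_le_L[of \<alpha>] \<alpha> by auto
  define A B where "A = region_under \<alpha> f" and "B = {(x, y). (y, x) \<in> region_under (f \<alpha>) g}"
  have contf: "continuous_on {0..\<alpha>} f" using f_cont \<alpha> by (auto intro: continuous_on_subset)
  have contg: "continuous_on {0..f \<alpha>} g" using s.f_cont fa by (auto intro: continuous_on_subset)
  have A: "A \<in> fmeasurable lborel" "measure lborel A = integral {0..\<alpha>} f"
    unfolding A_def using f_nonneg \<alpha> by (auto intro!: region_under_measure contf)
  have Bg: "region_under (f \<alpha>) g \<in> fmeasurable lborel" "measure lborel (region_under (f \<alpha>) g) = integral {0..f \<alpha>} g"
    using g_nonneg fa by (auto intro!: region_under_measure contg)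
  have B: "B \<in> fmeasurable lborel" "measure lborel B = integral {0..f \<alpha>} g"
    unfolding B_def using measure_lborel_swap[OF Bg(1)] Bg(2) by auto
  have C: "measure lborel (region_under \<alpha> (\<lambda>_. f \<alpha>)) = \<alpha> * f \<alpha>"
    using region_under_measure(2)[of \<alpha> "\<lambda>_. f \<alpha>"] fa \<alpha> by simp
  have "{(x, y). 0 \<le> x \<and> x \<le> L \<and> 0 \<le> y \<and> y \<le> f x} = A \<union> B"
  proof (rule set_eqI, clarify)
    fix x y :: real
    have "0 \<le> x \<and> x \<le> L \<and> 0 \<le> y \<and> y \<le> f x \<longleftrightarrow>
      (0 \<le> x \<and> x \<le> \<alpha> \<and> 0 \<le> y \<and> y \<le> f x) \<or> (0 \<le> y \<and> y \<le> f \<alpha> \<and> 0 \<le> x \<and> x \<le> g y)"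
      using le_f_iff_le_g[of x y] \<alpha> fa f_antimono[of \<alpha> x] by (cases "x \<le> \<alpha>") auto
    thus "(x, y) \<in> {(x, y). 0 \<le> x \<and> x \<le> L \<and> 0 \<le> y \<and> y \<le> f x} \<longleftrightarrow> (x, y) \<in> A \<union> B"
      by (simp add: A_def B_def region_under_def)
  qed
  moreover have "A \<inter> B = region_under \<alpha> (\<lambda>_. f \<alpha>)"
  proof (rule set_eqI, clarify)
    fix x y :: real
    have "0 \<le> x \<Longrightarrow> x \<le> \<alpha> \<Longrightarrow> y \<le> f \<alpha> \<Longrightarrow> y \<le> f x"
      using f_antimono[of x \<alpha>] \<alpha> by auto
    hence "(0 \<le> x \<and> x \<le> \<alpha> \<and> 0 \<le> y \<and> y \<le> f x) \<and> (0 \<le> y \<and> y \<le> f \<alpha> \<and> 0 \<le> x \<and> x \<le> g y) \<longleftrightarrow>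
      0 \<le> x \<and> x \<le> \<alpha> \<and> 0 \<le> y \<and> y \<le> f \<alpha>"
      using le_f_iff_le_g[of x y] \<alpha> by auto
    thus "(x, y) \<in> A \<inter> B \<longleftrightarrow> (x, y) \<in> region_under \<alpha> (\<lambda>_. f \<alpha>)"
      by (simp add: A_def B_def region_under_def)
  qed
  ultimately show ?thesis
    using measure_Un3[OF A(1) B(1)] A(2) B(2) C by (simp add: curve_area_def)
qed

text \<open>
  When the two one-sided asymptotics are added, the terms \<open>sawtooth a * b\<close> and \<open>sawtooth b * a\<close> cancel
  against the product that counts the rectangle, and the leading term \<open>a * b\<close> of this product completes
  the area.  Only the two sawtooth sums and bounded terms remain.
\<close>

lemma lattice_count_two_term:
  assumes \<alpha>: "0 < \<alpha>" "\<alpha> < L" and rs: "0 < r" "0 < s"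
  shows "\<bar>real (lattice_count L f r s) - (r\<^sup>2 * curve_area L f + r * L * (s + 1 / s) / 2)\<bar> \<le>
    \<bar>sawtooth_sum f \<alpha> r s\<bar> + \<bar>sawtooth_sum g (f \<alpha>) r (1 / s)\<bar> +
    2 * (f \<alpha> / (L - \<alpha>) * s\<^sup>2) + 2 * (\<alpha> / (L - f \<alpha>) * (1 / s)\<^sup>2) + 1"
proof -
  interpret s: curve_pair L g f by (rule swap)
  have fa: "0 < f \<alpha>" "f \<alpha> < L" using f_strict[of \<alpha> L] f_strict[of 0 \<alpha>] \<alpha> by (auto simp: f_0 f_L)
  define a b p q where "a = r * \<alpha> / s" and "b = r * f \<alpha> / (1 / s)"
    and "p = 1 / 2 - sawtooth a" and "q = 1 / 2 - sawtooth b"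
  define F G where "F = integral {0..\<alpha>} f" and "G = integral {0..f \<alpha>} g"
  define U V where "U = sawtooth_sum f \<alpha> r s" and "V = sawtooth_sum g (f \<alpha>) r (1 / s)"
  have gfa: "g (f \<alpha>) = \<alpha>" using inverse \<alpha> by simp
  have ab: "0 \<le> a" "0 \<le> b" "a * b = r\<^sup>2 * (\<alpha> * f \<alpha>)" "r * s * f \<alpha> = b" "r * (1 / s) * \<alpha> = a"
    using \<alpha> fa rs by (auto simp: a_def b_def power2_eq_square)
  have 1: "\<bar>real (column_count f \<alpha> r s) - (r\<^sup>2 * F + r * s * L / 2 - sawtooth a * b + (a + 1 / 2 - sawtooth a) / 2 - U)\<bar>
      \<le> 2 * (f \<alpha> / (L - \<alpha>) * s\<^sup>2)"
    using column_count_asymptotics[OF \<alpha> rs] unfolding ab(4) a_def[symmetric] F_def[symmetric] U_def[symmetric] .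
  have 2: "\<bar>real (column_count g (f \<alpha>) r (1 / s)) - (r\<^sup>2 * G + r * (1 / s) * L / 2 - sawtooth b * a + (b + 1 / 2 - sawtooth b) / 2 - V)\<bar>
      \<le> 2 * (\<alpha> / (L - f \<alpha>) * (1 / s)\<^sup>2)"
    using s.column_count_asymptotics[OF fa rs(1), of "1 / s"] rs(2)
    unfolding gfa ab(5) b_def[symmetric] G_def[symmetric] V_def[symmetric] by simp
  have 3: "real (lattice_count L f r s) + (a + p) * (b + q) =
      real (column_count f \<alpha> r s) + real (column_count g (f \<alpha>) r (1 / s))"
  proof -
    have "real (Suc (nat \<lfloor>a\<rfloor>)) = a + p" "real (Suc (nat \<lfloor>b\<rfloor>)) = b + q"
      using of_nat_Suc_floor[OF ab(1)] of_nat_Suc_floor[OF ab(2)] by (auto simp: p_def q_def)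
    moreover have "lattice_count L f r s + Suc (nat \<lfloor>a\<rfloor>) * Suc (nat \<lfloor>b\<rfloor>) =
      column_count f \<alpha> r s + column_count g (f \<alpha>) r (1 / s)"
      using lattice_count_decomposition[OF \<alpha> rs] by (simp add: a_def b_def)
    ultimately show ?thesis by (metis of_nat_add of_nat_mult)
  qed
  have pq: "\<bar>(p + q) / 2 - p * q\<bar> \<le> 1"
  proof -
    have pq: "0 \<le> p" "p \<le> 1" "0 \<le> q" "q \<le> 1"
      using sawtooth_bounds[of a] sawtooth_bounds[of b] by (auto simp: p_def q_def abs_le_iff)
    have "p * q \<le> 1 * 1" using pq by (intro mult_mono) auto
    moreover have "0 \<le> p * q" using pq by simp
    ultimately have "p * q \<le> 1" "0 \<le> p * q" by auto
    moreover define t where "t = (p + q) / 2"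
    moreover have "0 \<le> t" "t \<le> 1" using pq by (auto simp: t_def)
    ultimately show ?thesis unfolding t_def[symmetric] by linarith
  qed
  have area: "curve_area L f = F + G - \<alpha> * f \<alpha>"
    unfolding F_def G_def by (rule curve_area_decomposition[OF \<alpha>])
  have "real (lattice_count L f r s) - (r\<^sup>2 * curve_area L f + r * L * (s + 1 / s) / 2) =
    (real (column_count f \<alpha> r s) - (r\<^sup>2 * F + r * s * L / 2 - sawtooth a * b + (a + 1 / 2 - sawtooth a) / 2 - U)) +
    (real (column_count g (f \<alpha>) r (1 / s)) - (r\<^sup>2 * G + r * (1 / s) * L / 2 - sawtooth b * a + (b + 1 / 2 - sawtooth b) / 2 - V))
    - U - V + ((p + q) / 2 - p * q)"
  proof -
    have N: "real (lattice_count L f r s) = real (column_count f \<alpha> r s) + real (column_count g (f \<alpha>) r (1 / s)) - (a + p) * (b + q)"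
      using 3 by simp
    have sp: "sawtooth a = 1 / 2 - p" "sawtooth b = 1 / 2 - q" by (auto simp: p_def q_def)
    have A: "r\<^sup>2 * curve_area L f = r\<^sup>2 * F + r\<^sup>2 * G - a * b" by (simp add: area ab(3) algebra_simps)
    show ?thesis unfolding N sp A by (simp add: algebra_simps add_divide_distrib diff_divide_distrib)
  qed
  thus ?thesis using 1 2 pq unfolding U_def[symmetric] V_def[symmetric] by linarith
qed

section \<open>A lower bound for the count, and boundedness of optimal stretches\<close>

text \<open>
  Every cell of the left Riemann sum overshoots, since \<open>f\<close> decreases; the total excess has to be
  comparable with the mesh.  If \<open>h\<close> is small then \<open>f\<close> falls with slope at least \<open>m\<close> on the right half of the interval, and each of
  the about \<open>L / (2 * h)\<close> cells there contributes an excess of \<open>m * h\<^sup>2 / 2\<close>.  If \<open>h\<close> is not small then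
  the first cell alone suffices, because \<open>f\<close> is below its initial value \<open>L\<close> on a fixed part of it.
\<close>

lemma riemann_sum_excess:
  "\<exists>c>0. \<forall>h>0. integral {0..L} f + c * h \<le> h * (\<Sum>j\<le>nat \<lfloor>L / h\<rfloor>. f (real j * h))"
proof -
  \<comment> \<open>Extension by zero, so that the cell containing \<open>L\<close> needs no separate treatment.\<close>
  define w where "w x = f (min x L)" for x
  define W where "W x = integral {0..x} w" for x
  have w_cont: "continuous_on {0..b} w" for b
    unfolding w_def using L_pos by (intro continuous_on_compose2[OF f_cont] continuous_intros) auto
  have W_deriv: "(W has_real_derivative w t) (at t within {0..b})" if "t \<in> {0..b}" for t b
    unfolding W_def using that by (intro integral_has_real_derivative w_cont)
  have w_mono: "w y \<le> w x" if "0 \<le> x" "x \<le> y" for x y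
    unfolding w_def using that L_pos by (intro f_antimono) auto
  have W_le: "W v - W u \<le> w u * (v - u)" if "0 \<le> u" "u \<le> v" for u v
    using antiderivative_increment_le[of v W w u v "w u" 0] W_deriv w_mono that by simp
  have W_ge: "w v * (v - u) \<le> W v - W u" if "0 \<le> u" "u \<le> v" for u v
    using antiderivative_increment_ge[of v W w u v "w v" 0] W_deriv w_mono that by simp
  have W0: "W 0 = 0" by (simp add: W_def)
  have w_L: "w 0 = L" "\<And>x. L \<le> x \<Longrightarrow> w x = 0" using L_pos by (auto simp: w_def f_0 f_L)
  have W_total: "W x = integral {0..L} f" if "L \<le> x" for x
  proof -
    have "W x = W L" using W_le[of L x] W_ge[of L x] that L_pos w_L by simp
    also have "\<dots> = integral {0..L} f" unfolding W_def by (intro integral_cong) (auto simp: w_def)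
    finally show ?thesis .
  qed
  define x1 where "x1 = L / 8"
  define c1 where "c1 = L - W x1 / x1"
  define m where "m = (L - f (L / 2)) / L"
  have x1: "0 < x1" "x1 / 2 \<le> L" using L_pos by (auto simp: x1_def)
  have c1: "0 < c1"
  proof -
    have "w (x1 / 2) < L" using f_strict[of 0 "x1 / 2"] x1 L_pos by (simp add: w_def f_0)
    hence "w (x1 / 2) * x1 < L * x1" using x1 by (intro mult_strict_right_mono) auto
    moreover have "W (x1 / 2) * 2 \<le> L * x1" using W_le[of 0 "x1 / 2"] x1 by (simp add: W0 w_L)
    moreover have "W x1 * 2 - W (x1 / 2) * 2 \<le> w (x1 / 2) * x1" using W_le[of "x1 / 2" x1] x1 by simp
    ultimately have "W x1 < L * x1" by linarith
    thus ?thesis using x1 by (simp add: c1_def field_simps)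
  qed
  have m: "0 < m" using f_strict[of 0 "L / 2"] L_pos by (simp add: m_def f_0)
  have steep: "f y \<le> f x - m * (y - x)" if "L / 2 \<le> x" "x \<le> y" "y \<le> L" for x y
  proof -
    have "(y - x) * f 0 + (x - 0) * f y \<le> (y - 0) * f x"
      using that L_pos by (intro concave_chord[OF f_conc]) auto
    hence 1: "(y - x) * (L - f x) \<le> x * (f x - f y)" by (simp add: f_0 algebra_simps)
    have "f x \<le> f (L / 2)" using that L_pos by (intro f_antimono) auto
    hence "(y - x) * (L - f (L / 2)) \<le> (y - x) * (L - f x)" using that by (intro mult_left_mono) auto
    also note 1
    also have "x * (f x - f y) \<le> L * (f x - f y)"
      using that L_pos f_antimono[of x y] by (intro mult_right_mono) auto
    finally show ?thesis using L_pos by (simp add: m_def field_simps)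
  qed
  define c where "c = min c1 (m * L / 8)"
  have c: "0 < c" using c1 m L_pos by (simp add: c_def)
  have "integral {0..L} f + c * h \<le> h * (\<Sum>j\<le>nat \<lfloor>L / h\<rfloor>. f (real j * h))" if h: "0 < h" for h
  proof -
    define J where "J = nat \<lfloor>L / h\<rfloor>"
    have J: "real J \<le> L / h" "L / h \<le> real J + 1"
    proof -
      have "real J = real_of_int \<lfloor>L / h\<rfloor>" using h L_pos by (simp add: J_def)
      thus "real J \<le> L / h" "L / h \<le> real J + 1" by linarith+
    qed
    have Jh: "real J * h \<le> L" "L \<le> (real J + 1) * h" using J h by (auto simp: field_simps)
    have fw: "(\<Sum>j\<le>J. f (real j * h)) = (\<Sum>j<Suc J. w (real j * h))"
    proof -
      have "f (real j * h) = w (real j * h)" if "j \<le> J" for j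
      proof -
        have "real j * h \<le> real J * h" using that h by (intro mult_right_mono) auto
        thus ?thesis using Jh by (simp add: w_def)
      qed
      thus ?thesis by (simp add: lessThan_Suc_atMost)
    qed
    have cell: "W (real (Suc j) * h) - W (real j * h) \<le> w (real j * h) * h" for j
      using W_le[of "real j * h" "real (Suc j) * h"] h by (simp add: algebra_simps)
    have WJ: "W (real (Suc J) * h) = integral {0..L} f" using Jh by (intro W_total) (simp add: add.commute)
    show ?thesis
    proof (cases "h \<le> x1")
      case True
      define J0 where "J0 = nat \<lceil>L / (2 * h)\<rceil>"
      have J0: "real J0 \<le> L / (2 * h) + 1" "L / (2 * h) \<le> real J0"
      proof -
        have "0 \<le> L / (2 * h)" using h L_pos by simp
        hence "real J0 = real_of_int \<lceil>L / (2 * h)\<rceil>" unfolding J0_def by simp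
        thus "real J0 \<le> L / (2 * h) + 1" "L / (2 * h) \<le> real J0" by linarith+
      qed
      have "W (real n * h) + m * h\<^sup>2 / 2 * real (n - J0) \<le> h * (\<Sum>j<n. w (real j * h))" if "n \<le> J" for n
        using that
      proof (induction n)
        case (Suc n)
        have n: "real (Suc n) * h \<le> L"
        proof -
          have "real (Suc n) * h \<le> real J * h" using Suc.prems h by (intro mult_right_mono) auto
          thus ?thesis using Jh by simp
        qed
        show ?case
        proof (cases "J0 \<le> n")
          case True
          have "L / (2 * h) \<le> real n" using True J0 by linarith
          hence nl: "L / 2 \<le> real n * h" using h by (simp add: field_simps)
          have "W (real (Suc n) * h) - W (real n * h) \<le> w (real n * h) * (real (Suc n) * h - real n * h)
              + (- m) * (real (Suc n) * h - real n * h)\<^sup>2 / 2"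
          proof (rule antiderivative_increment_le[OF W_deriv])
            fix t assume t: "real n * h \<le> t" "t \<le> real (Suc n) * h"
            thus "w t \<le> w (real n * h) + - m * (t - real n * h)"
              using steep[of "real n * h" t] nl n by (simp add: w_def)
          qed (use h n in \<open>auto simp: algebra_simps\<close>)
          also have "real (Suc n) * h - real n * h = h" by (simp add: algebra_simps)
          finally have "W (real (Suc n) * h) - W (real n * h) \<le> w (real n * h) * h - m * h\<^sup>2 / 2" by simp
          moreover define q where "q = m * h\<^sup>2 / 2"
          moreover have "W (real n * h) + q * real (n - J0) \<le> h * (\<Sum>j<n. w (real j * h))"
            using Suc unfolding q_def by simp
          moreover have "real (Suc n - J0) = real (n - J0) + 1" using True by simp
          moreover have "h * (\<Sum>j<Suc n. w (real j * h)) = h * (\<Sum>j<n. w (real j * h)) + w (real n * h) * h"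
            by (simp add: algebra_simps)
          ultimately show ?thesis unfolding q_def[symmetric] by (simp only: distrib_left)
        next
          case False
          thus ?thesis using Suc cell[of n] by (simp add: algebra_simps)
        qed
      qed (simp add: W0)
      from this[of J] have "W (real (Suc J) * h) + m * h\<^sup>2 / 2 * real (J - J0) \<le> h * (\<Sum>j<Suc J. w (real j * h))"
        using cell[of J] by (simp add: algebra_simps)
      moreover have "c * h \<le> m * h\<^sup>2 / 2 * real (J - J0)"
      proof -
        have "2 \<le> L / (4 * h)" using True h by (simp add: x1_def field_simps)
        moreover have "L / (2 * h) = 2 * (L / (4 * h))" "L / h = 4 * (L / (4 * h))" by simp_all
        ultimately have "L / (4 * h) \<le> real J - real J0" using J J0 by linarith
        also have "\<dots> \<le> real (J - J0)" by simp
        finally have "m * h\<^sup>2 / 2 * (L / (4 * h)) \<le> m * h\<^sup>2 / 2 * real (J - J0)"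
          using m by (intro mult_left_mono) auto
        moreover have "m * h\<^sup>2 / 2 * (L / (4 * h)) = m * L / 8 * h" using h by (simp add: power2_eq_square)
        moreover have "c * h \<le> m * L / 8 * h" using h by (intro mult_right_mono) (auto simp: c_def)
        ultimately show ?thesis by linarith
      qed
      ultimately show ?thesis unfolding J_def[symmetric] fw WJ by linarith
    next
      case False
      have first: "W h + c1 * h \<le> h * L"
      proof -
        have "w x1 \<le> W x1 / x1" using W_ge[of 0 x1] x1 by (simp add: W0 field_simps)
        hence "w x1 * (h - x1) \<le> W x1 / x1 * (h - x1)" using False by (intro mult_right_mono) auto
        moreover have "W h - W x1 \<le> w x1 * (h - x1)" using W_le[of x1 h] x1 False by simp
        moreover have "W x1 / x1 * (h - x1) = W x1 / x1 * h - W x1" using x1 by (simp add: field_simps)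
        ultimately have "W h \<le> W x1 / x1 * h" by linarith
        moreover have "c1 * h = L * h - W x1 / x1 * h" by (simp add: c1_def left_diff_distrib)
        ultimately show ?thesis by (simp add: mult.commute)
      qed
      have "W (real (Suc n) * h) + c1 * h \<le> h * (\<Sum>j<Suc n. w (real j * h))" for n
      proof (induction n)
        case 0
        show ?case using first by (simp add: w_L)
      next
        case (Suc n)
        have "(\<Sum>j<Suc (Suc n). w (real j * h)) = (\<Sum>j<Suc n. w (real j * h)) + w (real (Suc n) * h)"
          by simp
        thus ?case using Suc cell[of "Suc n"] by (simp only: distrib_left mult.commute[of h "w _"])
      qed
      from this[of J] have "integral {0..L} f + c1 * h \<le> h * (\<Sum>j<Suc J. w (real j * h))" unfolding WJ .
      moreover have "c * h \<le> c1 * h" using h by (intro mult_right_mono) (auto simp: c_def)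
      ultimately show ?thesis unfolding J_def[symmetric] fw by linarith
    qed
  qed
  thus ?thesis using c by blast
qed

lemma lattice_count_eq_column_count:
  assumes rs: "0 < r" "0 < s"
  shows "lattice_count L f r s = column_count f L r s"
proof -
  have "{(j :: nat, k :: nat). real j * s / r \<le> L \<and> real k \<le> r * s * f (real j * s / r)} =
    Sigma {..nat \<lfloor>r * L / s\<rfloor>} (\<lambda>j. {..nat \<lfloor>r * s * f (real j * s / r)\<rfloor>})"
  proof (rule set_eqI, clarify)
    fix j k :: nat
    show "(j, k) \<in> {(j :: nat, k :: nat). real j * s / r \<le> L \<and> real k \<le> r * s * f (real j * s / r)} \<longleftrightarrow>
      (j, k) \<in> Sigma {..nat \<lfloor>r * L / s\<rfloor>} (\<lambda>j. {..nat \<lfloor>r * s * f (real j * s / r)\<rfloor>})"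
    proof (cases "real j * s / r \<le> L")
      case True
      hence "0 \<le> r * s * f (real j * s / r)" using rs by (intro mult_nonneg_nonneg f_nonneg) auto
      thus ?thesis using True scaled_le_iff[OF rs, of L j] L_pos by (simp add: nat_le_iff_le_floor)
    next
      case False
      thus ?thesis using scaled_le_iff[OF rs, of L j] L_pos by simp
    qed
  qed
  thus ?thesis by (simp add: lattice_count_def column_count_def card_SigmaI)
qed

text \<open>
  Excludes large optimal stretches: the count exceeds the area term by a multiple of \<open>r * s\<close>.
  Exchanging the coordinates gives the same with \<open>r / s\<close>.
\<close>

lemma lattice_count_lower:
  "\<exists>c>0. \<forall>r>0. \<forall>s>0. r\<^sup>2 * curve_area L f + c * (r * s) \<le> real (lattice_count L f r s)"
proof -
  from riemann_sum_excess obtain c where c: "0 < c"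
    "\<And>h. 0 < h \<Longrightarrow> integral {0..L} f + c * h \<le> h * (\<Sum>j\<le>nat \<lfloor>L / h\<rfloor>. f (real j * h))" by blast
  have "r\<^sup>2 * curve_area L f + c * (r * s) \<le> real (lattice_count L f r s)" if rs: "0 < r" "0 < s" for r s
  proof -
    have "r\<^sup>2 * (integral {0..L} f + c * (s / r)) \<le> r\<^sup>2 * (s / r * (\<Sum>j\<le>nat \<lfloor>L / (s / r)\<rfloor>. f (real j * (s / r))))"
      using rs by (intro mult_left_mono c) auto
    also have "\<dots> = (\<Sum>j\<le>nat \<lfloor>r * L / s\<rfloor>. r * s * f (real j * s / r))"
      using rs by (simp add: sum_distrib_left power2_eq_square mult_ac)
    also have "\<dots> \<le> (\<Sum>j\<le>nat \<lfloor>r * L / s\<rfloor>. real (Suc (nat \<lfloor>r * s * f (real j * s / r)\<rfloor>)))"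
    proof (rule sum_mono)
      fix j
      show "r * s * f (real j * s / r) \<le> real (Suc (nat \<lfloor>r * s * f (real j * s / r)\<rfloor>))" by linarith
    qed
    also have "\<dots> = real (lattice_count L f r s)"
      by (simp add: lattice_count_eq_column_count[OF rs] column_count_def)
    finally show ?thesis using rs by (simp add: curve_area_eq_integral power2_eq_square algebra_simps)
  qed
  thus ?thesis using c(1) by blast
qed

lemma lattice_count_swap:
  assumes rs: "0 < r" "0 < s"
  shows "lattice_count L f r s = lattice_count L g r (1 / s)"
proof -
  have "bij_betw prod.swap {(j :: nat, k :: nat). real j * s / r \<le> L \<and> real k \<le> r * s * f (real j * s / r)}
    {(k :: nat, j :: nat). real k * (1 / s) / r \<le> L \<and> real j \<le> r * (1 / s) * g (real k * (1 / s) / r)}"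
  proof (rule bij_betw_byWitness[where f' = prod.swap])
    have *: "real j * s / r \<le> L \<and> real k \<le> r * s * f (real j * s / r) \<longleftrightarrow>
      real k * (1 / s) / r \<le> L \<and> real j \<le> r * (1 / s) * g (real k * (1 / s) / r)" for j k :: nat
    proof -
      define x y where "x = real j * s / r" and "y = real k * (1 / s) / r"
      have "0 \<le> x" "0 \<le> y" using rs by (auto simp: x_def y_def)
      moreover have "real k \<le> r * s * f x \<longleftrightarrow> y \<le> f x" using rs by (simp add: y_def field_simps)
      moreover have "real j \<le> r * (1 / s) * g y \<longleftrightarrow> x \<le> g y" using rs by (simp add: x_def field_simps)
      ultimately show ?thesis unfolding x_def[symmetric] y_def[symmetric] using le_f_iff_le_g[of x y] by blast
    qed
    show "prod.swap ` {(j :: nat, k :: nat). real j * s / r \<le> L \<and> real k \<le> r * s * f (real j * s / r)} \<subseteq>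
      {(k :: nat, j :: nat). real k * (1 / s) / r \<le> L \<and> real j \<le> r * (1 / s) * g (real k * (1 / s) / r)}"
      using * by fastforce
    show "prod.swap ` {(k :: nat, j :: nat). real k * (1 / s) / r \<le> L \<and> real j \<le> r * (1 / s) * g (real k * (1 / s) / r)} \<subseteq>
      {(j :: nat, k :: nat). real j * s / r \<le> L \<and> real k \<le> r * s * f (real j * s / r)}"
      using * by fastforce
  qed auto
  thus ?thesis unfolding lattice_count_def by (rule bij_betw_same_card)
qed

lemma curve_area_swap: "curve_area L g = curve_area L f"
proof -
  interpret s: curve_pair L g f by (rule swap)
  define \<alpha> where "\<alpha> = L / 2"
  have \<alpha>: "0 < \<alpha>" "\<alpha> < L" using L_pos by (auto simp: \<alpha>_def)
  have fa: "0 < f \<alpha>" "f \<alpha> < L" using f_strict[of \<alpha> L] f_strict[of 0 \<alpha>] \<alpha> by (auto simp: f_0 f_L)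
  have "g (f \<alpha>) = \<alpha>" using inverse \<alpha> by simp
  thus ?thesis using curve_area_decomposition[OF \<alpha>] s.curve_area_decomposition[OF fa] by simp
qed

section \<open>Optimal stretch factors\<close>

text \<open>
  Comparison with \<open>s = 1\<close> and the lower bound confine optimal stretches to a fixed interval
  \<open>[1 / Q, Q]\<close>, on which the two-term asymptotics hold uniformly.  Comparing once more yields
  \<open>r * L * (s + 1 / s - 2) / 2 = O(r powr (1 - 2 * e))\<close>; as \<open>s + 1 / s - 2 = (s - 1)\<^sup>2 / s\<close>, this is the
  rate for \<open>s\<close>.  The inequality \<open>s + 1 / s \<ge> 2\<close> shows that the minimum has the same asymptotics as the
  count at \<open>s = 1\<close>.
\<close>

lemma optimal_stretch_asymptotics:
  assumes \<alpha>: "0 < \<alpha>" "\<alpha> < L" and e: "0 < e" "e \<le> 1 / 6"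
    and Sf: "\<And>Q. 1 \<le> Q \<Longrightarrow> \<exists>C r0. \<forall>r\<ge>r0. \<forall>s. 1 / Q \<le> s \<longrightarrow> s \<le> Q \<longrightarrow>
      \<bar>sawtooth_sum f \<alpha> r s\<bar> \<le> C * r powr (1 - 2 * e)"
    and Sg: "\<And>Q. 1 \<le> Q \<Longrightarrow> \<exists>C r0. \<forall>r\<ge>r0. \<forall>s. 1 / Q \<le> s \<longrightarrow> s \<le> Q \<longrightarrow>
      \<bar>sawtooth_sum g (f \<alpha>) r s\<bar> \<le> C * r powr (1 - 2 * e)"
  shows "near_one_with_rate (optimal_stretches L f) e"
    and "(\<lambda>r. real (min_lattice_count L f r) - (r\<^sup>2 * curve_area L f + r * L))
          \<in> O[at_top](\<lambda>r. r powr (1 - 2 * e))"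
proof -
  interpret s: curve_pair L g f by (rule swap)
  define N A E where "N r s = real (lattice_count L f r s)" and "A = curve_area L f" and "E = 1 - 2 * e" for r s
  have fa: "0 < f \<alpha>" "f \<alpha> < L" using f_strict[of \<alpha> L] f_strict[of 0 \<alpha>] \<alpha> by (auto simp: f_0 f_L)
  have asymp: "\<exists>C r0. 1 \<le> r0 \<and> 0 \<le> C \<and> (\<forall>r\<ge>r0. \<forall>s. 1 / Q \<le> s \<longrightarrow> s \<le> Q \<longrightarrow>
      \<bar>N r s - (r\<^sup>2 * A + r * L * (s + 1 / s) / 2)\<bar> \<le> C * r powr E)" if Q: "1 \<le> Q" for Q
  proof -
    from Sf[OF Q] obtain C1 r1 where C1: "\<And>r s. r1 \<le> r \<Longrightarrow> 1 / Q \<le> s \<Longrightarrow> s \<le> Q \<Longrightarrow>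
      \<bar>sawtooth_sum f \<alpha> r s\<bar> \<le> C1 * r powr E" unfolding E_def by blast
    from Sg[OF Q] obtain C2 r2 where C2: "\<And>r s. r2 \<le> r \<Longrightarrow> 1 / Q \<le> s \<Longrightarrow> s \<le> Q \<Longrightarrow>
      \<bar>sawtooth_sum g (f \<alpha>) r s\<bar> \<le> C2 * r powr E" unfolding E_def by blast
    define K where "K = 2 * (f \<alpha> / (L - \<alpha>) * Q\<^sup>2) + 2 * (\<alpha> / (L - f \<alpha>) * Q\<^sup>2) + 1"
    have K: "0 \<le> K" using \<alpha> fa by (simp add: K_def)
    have "\<bar>N r s - (r\<^sup>2 * A + r * L * (s + 1 / s) / 2)\<bar> \<le> (max 0 C1 + max 0 C2 + K) * r powr E"
      if r: "max 1 (max r1 r2) \<le> r" and s: "1 / Q \<le> s" "s \<le> Q" for r s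
    proof -
      have s0: "0 < s" using s Q by (smt (verit) divide_pos_pos)
      have s': "1 / Q \<le> 1 / s" "1 / s \<le> Q" using s s0 Q by (auto simp: field_simps)
      have r': "1 \<le> r" "r1 \<le> r" "r2 \<le> r" using r by auto
      have P: "1 \<le> r powr E" using r' e by (intro ge_one_powr_ge_zero) (auto simp: E_def)
      have "\<bar>N r s - (r\<^sup>2 * A + r * L * (s + 1 / s) / 2)\<bar> \<le>
        \<bar>sawtooth_sum f \<alpha> r s\<bar> + \<bar>sawtooth_sum g (f \<alpha>) r (1 / s)\<bar> +
        2 * (f \<alpha> / (L - \<alpha>) * s\<^sup>2) + 2 * (\<alpha> / (L - f \<alpha>) * (1 / s)\<^sup>2) + 1"
        unfolding N_def A_def using r' s0 by (intro lattice_count_two_term \<alpha>) auto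
      also have "\<dots> \<le> C1 * r powr E + C2 * r powr E + 2 * (f \<alpha> / (L - \<alpha>) * Q\<^sup>2) + 2 * (\<alpha> / (L - f \<alpha>) * Q\<^sup>2) + 1"
      proof (intro add_mono mult_left_mono order_refl)
        show "s\<^sup>2 \<le> Q\<^sup>2" "(1 / s)\<^sup>2 \<le> Q\<^sup>2" using s s' s0 by (intro power_mono; simp)+
      qed (use C1[OF r'(2) s] C2[OF r'(3) s'] \<alpha> fa in auto)
      also have "\<dots> = C1 * r powr E + C2 * r powr E + K * 1" by (simp add: K_def)
      also have "\<dots> \<le> max 0 C1 * r powr E + max 0 C2 * r powr E + K * r powr E"
        using K P by (intro add_mono mult_right_mono mult_left_mono) auto
      finally show ?thesis by (simp add: algebra_simps)
    qed
    thus ?thesis using K by (intro exI[of _ "max 0 C1 + max 0 C2 + K"] exI[of _ "max 1 (max r1 r2)"]) auto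
  qed
  obtain C1 r1 where C1: "1 \<le> r1" "0 \<le> C1" "\<And>r s. r1 \<le> r \<Longrightarrow> 1 / 1 \<le> s \<Longrightarrow> s \<le> 1 \<Longrightarrow>
      \<bar>N r s - (r\<^sup>2 * A + r * L * (s + 1 / s) / 2)\<bar> \<le> C1 * r powr E"
    using asymp[OF order_refl] by blast
  have N1: "N r 1 \<le> r\<^sup>2 * A + r * L + C1 * r powr E" if "r1 \<le> r" for r
    using C1(3)[OF that, of 1] by simp
  have N1': "N r 1 \<le> r\<^sup>2 * A + r * (L + C1)" if r: "r1 \<le> r" for r
  proof -
    have "C1 * r powr E \<le> C1 * r powr 1" using r C1 e by (intro mult_left_mono powr_mono) (auto simp: E_def)
    thus ?thesis using N1[OF r] r C1 by (simp add: algebra_simps)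
  qed
  from lattice_count_lower obtain c where c: "0 < c"
    "\<And>r s. 0 < r \<Longrightarrow> 0 < s \<Longrightarrow> r\<^sup>2 * A + c * (r * s) \<le> N r s" unfolding A_def N_def by blast
  from s.lattice_count_lower obtain c' where c': "0 < c'"
    "\<And>r s. 0 < r \<Longrightarrow> 0 < s \<Longrightarrow> r\<^sup>2 * curve_area L g + c' * (r * s) \<le> real (lattice_count L g r s)" by blast
  have c'': "r\<^sup>2 * A + c' * (r * (1 / s)) \<le> N r s" if "0 < r" "0 < s" for r s
    using c'(2)[of r "1 / s"] that lattice_count_swap[OF that] by (simp add: N_def A_def curve_area_swap)
  define Q where "Q = max 1 (max ((L + C1) / c) ((L + C1) / c'))"
  have Q: "1 \<le> Q" by (simp add: Q_def)
  have confined: "1 / Q \<le> s \<and> s \<le> Q" if r: "r1 \<le> r" and s: "0 < s" "N r s \<le> N r 1" for r s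
  proof -
    have r0: "0 < r" using r C1 by simp
    have "c * (r * s) \<le> r * (L + C1)" "c' * (r * (1 / s)) \<le> r * (L + C1)"
      using c(2)[OF r0 s(1)] c''[OF r0 s(1)] N1'[OF r] s(2) by linarith+
    hence "r * (c * s) \<le> r * (L + C1)" "r * (c' * (1 / s)) \<le> r * (L + C1)" by (simp_all add: mult_ac)
    hence "c * s \<le> L + C1" "c' * (1 / s) \<le> L + C1"
      by (simp_all only: mult_le_cancel_left_pos[OF r0])
    hence "s \<le> (L + C1) / c" "1 / s \<le> (L + C1) / c'" using c(1) c'(1) by (simp_all add: field_simps)
    hence "s \<le> Q" "1 / s \<le> Q" by (auto simp: Q_def)
    thus ?thesis using s(1) Q by (auto simp: field_simps)
  qed
  obtain C2 r2 where C2: "1 \<le> r2" "0 \<le> C2" "\<And>r s. r2 \<le> r \<Longrightarrow> 1 / Q \<le> s \<Longrightarrow> s \<le> Q \<Longrightarrow>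
      \<bar>N r s - (r\<^sup>2 * A + r * L * (s + 1 / s) / 2)\<bar> \<le> C2 * r powr E"
    using asymp[OF Q] by blast
  define R where "R = max r1 r2"
  have lower: "r\<^sup>2 * A + r * L * (s + 1 / s) / 2 - C2 * r powr E \<le> N r s"
    if "R \<le> r" "0 < s" "N r s \<le> N r 1" for r s
    using C2(3)[of r s] confined[of r s] that by (auto simp: R_def abs_le_iff)
  have opt: "0 < s \<and> (\<forall>y>0. N r s \<le> N r y)" if "s \<in> optimal_stretches L f r" for r s
    using that unfolding optimal_stretches_def is_arg_min_def N_def mem_Collect_eq of_nat_le_iff
    by (meson not_le)
  show "near_one_with_rate (optimal_stretches L f) e"
    unfolding near_one_with_rate_def
  proof (intro exI conjI allI impI ballI)
    define D where "D = 2 * Q * (C1 + C2) / L"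
    have D: "0 \<le> D" using Q C1 C2 L_pos by (simp add: D_def)
    show "0 < sqrt D + 1" using D by (simp add: add_nonneg_pos)
    show "0 < R" using C1 by (simp add: R_def)
    fix r s assume r: "R \<le> r" and s: "s \<in> optimal_stretches L f r"
    have r0: "0 < r" "r1 \<le> r" using r C1 by (auto simp: R_def)
    have s0: "0 < s" "N r s \<le> N r 1" using opt[OF s] by auto
    define X where "X = r * L * (s + 1 / s) / 2"
    have "X \<le> r * L + (C1 + C2) * r powr E"
      using lower[OF r s0] N1[OF r0(2)] s0(2) unfolding X_def[symmetric] distrib_right by linarith
    moreover have "r * (L * (s + 1 / s - 2)) = 2 * X - 2 * (r * L)" by (simp add: X_def algebra_simps)
    ultimately have "r * (L * (s + 1 / s - 2)) \<le> 2 * (C1 + C2) * r powr E" by (simp add: algebra_simps)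
    also have "r powr E = r * r powr (- 2 * e)"
      using r0 by (simp add: E_def powr_diff powr_minus field_simps)
    finally have "r * (L * (s + 1 / s - 2)) \<le> r * (2 * (C1 + C2) * r powr (- 2 * e))" by (simp add: mult_ac)
    hence "L * (s + 1 / s - 2) \<le> 2 * (C1 + C2) * r powr (- 2 * e)" using r0 by (auto dest: mult_left_le_imp_le)
    hence 1: "s + 1 / s - 2 \<le> 2 * (C1 + C2) * r powr (- 2 * e) / L" using L_pos by (simp add: field_simps)
    have "(s - 1)\<^sup>2 = s * (s + 1 / s - 2)" using s0 by (simp add: power2_eq_square field_simps)
    also have "\<dots> \<le> Q * (2 * (C1 + C2) * r powr (- 2 * e) / L)"
    proof (intro mult_mono 1)
      have "0 \<le> (s - 1)\<^sup>2 / s" using s0 by simp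
      also have "(s - 1)\<^sup>2 / s = s + 1 / s - 2" using s0 by (simp add: power2_eq_square field_simps)
      finally show "0 \<le> s + 1 / s - 2" .
    qed (use confined[OF r0(2) s0] Q in auto)
    also have "\<dots> = D * (r powr (- e))\<^sup>2" by (simp add: D_def power2_eq_square flip: powr_add)
    finally have "sqrt ((s - 1)\<^sup>2) \<le> sqrt (D * (r powr (- e))\<^sup>2)" by (rule real_sqrt_le_mono)
    hence "\<bar>s - 1\<bar> \<le> sqrt D * r powr (- e)" by (simp add: real_sqrt_mult)
    also have "\<dots> \<le> (sqrt D + 1) * r powr (- e)" by (intro mult_right_mono) auto
    finally show "\<bar>s - 1\<bar> \<le> (sqrt D + 1) * r powr (- e)" .
  qed
  show "(\<lambda>r. real (min_lattice_count L f r) - (r\<^sup>2 * curve_area L f + r * L)) \<in> O[at_top](\<lambda>r. r powr (1 - 2 * e))"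
  proof (rule landau_o.bigI)
    show "0 < C1 + C2 + 1" using C1 C2 by simp
    have "norm (real (min_lattice_count L f r) - (r\<^sup>2 * A + r * L)) \<le> (C1 + C2 + 1) * norm (r powr E)" if r: "R \<le> r" for r
    proof -
      have r0: "0 < r" "r1 \<le> r" using r C1 by (auto simp: R_def)
      define m where "m = real (min_lattice_count L f r)"
      have "min_lattice_count L f r \<in> lattice_count L f r ` {0<..}"
        unfolding min_lattice_count_def by (intro Inf_nat_def1) auto
      then obtain s where s: "0 < s" "m = N r s" by (auto simp: N_def m_def)
      have m1: "m \<le> N r 1"
        unfolding m_def min_lattice_count_def N_def of_nat_le_iff by (intro wellorder_Inf_le1) auto
      have "0 \<le> (s - 1)\<^sup>2 / s" using s by simp
      also have "(s - 1)\<^sup>2 / s = s + 1 / s - 2" using s by (simp add: power2_eq_square field_simps)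
      finally have "2 \<le> s + 1 / s" by simp
      hence "r * L * 2 \<le> r * L * (s + 1 / s)" using r0 L_pos by (intro mult_left_mono) auto
      moreover define X where "X = r * L * (s + 1 / s) / 2"
      ultimately have "r * L \<le> X" by simp
      hence "r\<^sup>2 * A + r * L - C2 * r powr E \<le> m"
        using lower[OF r s(1)] m1 s(2) unfolding X_def[symmetric] by simp
      moreover have "m \<le> r\<^sup>2 * A + r * L + C1 * r powr E" using m1 N1[OF r0(2)] by simp
      moreover have "0 \<le> C1 * r powr E" "0 \<le> C2 * r powr E" "0 \<le> r powr E" using C1 C2 by auto
      moreover have "norm (r powr E) = r powr E" by simp
      ultimately show ?thesis
        unfolding m_def[symmetric] real_norm_def distrib_right mult_1 by (intro abs_leI; linarith)
    qed
    thus "eventually (\<lambda>r. norm (real (min_lattice_count L f r) - (r\<^sup>2 * curve_area L f + r * L)) \<le>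
      (C1 + C2 + 1) * norm (r powr (1 - 2 * e))) at_top"
      unfolding eventually_at_top_linorder A_def E_def by blast
  qed
qed

end

section \<open>Smooth and piecewise smooth arcs\<close>

text \<open>
  With \<open>\<delta> r = r powr (- 1 / 3)\<close> the exponents are \<open>1 / 6\<close>: the second derivative is bounded away from
  \<open>0\<close> on the closed arc, so its inverse is bounded, which is more than required.
\<close>

lemma piecewise_of_smooth:
  assumes \<alpha>: "0 < \<alpha>" and smooth: "smooth_hypotheses \<alpha> f"
  shows "piecewise_hypotheses \<alpha> 1 (\<lambda>i. real i * \<alpha>) f"
    and "decay_hypotheses \<alpha> f (\<lambda>r. r powr (- 1 / 3)) (1 / 6) (1 / 6)"
proof -
  define S T where "S = {0<..\<alpha>}" and "T = {0..\<alpha>}"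
  have C2: "C2_on T f" and neg1: "\<And>x. x \<in> S \<Longrightarrow> D1 T f x < 0" and neg2: "\<And>x. x \<in> T \<Longrightarrow> D2 T f x < 0"
    and mono: "monotonic_on T (D2 T f)"
    using smooth by (auto simp: smooth_hypotheses_def S_def T_def)
  have ST: "S \<subseteq> T" by (auto simp: S_def T_def)
  have within: "at x within S = at x within T" if "x \<in> S" for x
    by (rule at_within_nhd[where S = "{0<..}"]) (use that in \<open>auto simp: S_def T_def\<close>)
  have D1_eq: "D1 S f x = D1 T f x" if "x \<in> S" for x
    using within[OF that] by (simp add: D1_def)
  have D2_eq: "D2 S f x = D2 T f x" if x: "x \<in> S" for x
  proof -
    have "eventually (\<lambda>y. y \<in> S \<longrightarrow> D1 S f y = D1 T f y) (nhds x)"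
      by (auto simp: D1_eq)
    hence "vector_derivative (D1 S f) (at x within S) = vector_derivative (D1 T f) (at x within S)"
      using x by (intro vector_derivative_cong_eq) auto
    thus ?thesis using within[OF x] by (simp add: D2_def D1_def[of S "D1 S f"] D1_def[of T "D1 T f"])
  qed
  have "C2_on S f"
    unfolding C2_on_def
  proof (intro conjI)
    show "f differentiable_on S" using C2 ST by (auto simp: C2_on_def intro: differentiable_on_subset)
    show "D1 S f differentiable_on S"
      unfolding differentiable_on_def
    proof
      fix x assume x: "x \<in> S"
      have "D1 T f differentiable (at x within S)"
        using C2 ST x by (auto simp: C2_on_def dest: differentiable_on_subset intro: differentiable_onD)
      thus "D1 S f differentiable (at x within S)"
        by (rule differentiable_transform_within[where d = 1]) (use x in \<open>auto simp: D1_eq\<close>)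
    qed
    have "continuous_on S (D2 T f)" using C2 ST by (auto simp: C2_on_def intro: continuous_on_subset)
    thus "continuous_on S (D2 S f)" using continuous_on_cong[of S S "D2 S f" "D2 T f"] D2_eq by simp
  qed
  moreover have "monotonic_on S (D2 S f)"
    using mono ST D2_eq unfolding monotonic_on_def
    by (auto 0 3 simp: monotone_on_def)
  moreover have "continuous_on S f"
    using C2 ST by (auto simp: C2_on_def intro: differentiable_imp_continuous_on differentiable_on_subset)
  ultimately show "piecewise_hypotheses \<alpha> 1 (\<lambda>i. real i * \<alpha>) f"
    using \<alpha> neg1 neg2 ST D1_eq D2_eq
    by (auto simp: piecewise_hypotheses_def PC2_on_def partition_points_def subinterval_def S_def[symmetric])
  show "decay_hypotheses \<alpha> f (\<lambda>r. r powr (- 1 / 3)) (1 / 6) (1 / 6)"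
    unfolding decay_hypotheses_def
  proof (intro conjI allI impI)
    show "(\<lambda>r. r powr (- 1 / 3)) \<in> O[at_top](\<lambda>r. r powr (- 2 * (1 / 6)))" by simp
    define \<kappa> where "\<kappa> = min (- D2 T f 0) (- D2 T f \<alpha>)"
    have \<kappa>: "0 < \<kappa>" using neg2[of 0] neg2[of \<alpha>] \<alpha> by (simp add: \<kappa>_def T_def)
    have le: "D2 T f x \<le> - \<kappa>" if "x \<in> T" for x
    proof -
      have "D2 T f x \<le> max (D2 T f 0) (D2 T f \<alpha>)"
        using mono unfolding monotonic_on_def
      proof
        assume m: "mono_on T (D2 T f)"
        have "D2 T f x \<le> D2 T f \<alpha>" using that \<alpha> by (intro mono_onD[OF m]) (auto simp: T_def)
        thus ?thesis by simp
      next
        assume m: "antimono_on T (D2 T f)"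
        have "D2 T f x \<le> D2 T f 0" using that \<alpha> by (intro monotone_onD[OF m]) (auto simp: T_def)
        thus ?thesis by simp
      qed
      thus ?thesis by (auto simp: \<kappa>_def)
    qed
    have "((\<lambda>r :: real. r powr (- 1 / 3)) \<longlongrightarrow> 0) at_top"
      by (intro tendsto_neg_powr filterlim_ident) auto
    hence "eventually (\<lambda>r :: real. r powr (- 1 / 3) < \<alpha>) at_top" using \<alpha> by (intro order_tendstoD)
    hence "eventually (\<lambda>r. norm (inverse (D2 {0<..\<alpha>} f (r powr (- 1 / 3)))) \<le> (1 / \<kappa>) * norm (r powr (1 - 4 * (1 / 6)))) at_top"
      using eventually_ge_at_top[of 1]
    proof eventually_elim
      case (elim r)
      define x where "x = r powr (- 1 / 3)"
      have x: "x \<in> S" using elim by (simp add: S_def x_def)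
      have "D2 S f x \<le> - \<kappa>" using le[of x] x ST by (auto simp: D2_eq)
      hence "norm (inverse (D2 S f x)) \<le> 1 / \<kappa> * 1"
        using \<kappa> by (simp add: abs_if field_simps)
      also have "\<dots> \<le> 1 / \<kappa> * r powr (1 - 4 * (1 / 6))"
        using elim \<kappa> by (intro mult_left_mono ge_one_powr_ge_zero) auto
      finally show ?case by (simp add: x_def S_def)
    qed
    thus "(\<lambda>r. inverse (D2 {0<..\<alpha>} f (r powr (- 1 / 3)))) \<in> O[at_top](\<lambda>r. r powr (1 - 4 * (1 / 6)))"
      using \<kappa> by (intro landau_o.bigI[of "1 / \<kappa>"]) auto
  qed simp
qed

lemma (in curve_pair) piecewise_optimal_stretch:
  assumes \<alpha>: "0 < \<alpha>" "\<alpha> < L"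
    and f: "piecewise_hypotheses \<alpha> l p f" "decay_hypotheses \<alpha> f \<delta> a1 a2"
    and g: "piecewise_hypotheses (f \<alpha>) m q g" "decay_hypotheses (f \<alpha>) g \<epsilon> b1 b2"
    and pos: "0 < a1" "0 < a2" "0 < b1" "0 < b2" and e: "e = Min {1 / 6, a1, a2, b1, b2}"
  shows "near_one_with_rate (optimal_stretches L f) e"
    and "(\<lambda>r. real (min_lattice_count L f r) - (r\<^sup>2 * curve_area L f + r * L))
          \<in> O[at_top](\<lambda>r. r powr (1 - 2 * e))"
proof -
  interpret s: curve_pair L g f by (rule swap)
  have fa: "0 < f \<alpha>" "f \<alpha> < L" using f_strict[of \<alpha> L] f_strict[of 0 \<alpha>] \<alpha> by (auto simp: f_0 f_L)
  have ga: "g (f \<alpha>) = \<alpha>" using inverse \<alpha> by simp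
  have e': "0 < e" "e \<le> 1 / 6" "e \<le> a1" "e \<le> a2" "e \<le> b1" "e \<le> b2" using pos by (auto simp: e)
  have lf: "lipschitz_decreasing (f \<alpha> / (L - \<alpha>)) \<alpha> f" "0 \<le> f \<alpha> / (L - \<alpha>)"
    using lipschitz_decreasing_initial_arc[OF curve, of \<alpha>] \<alpha> fa by auto
  have lg: "lipschitz_decreasing (\<alpha> / (L - f \<alpha>)) (f \<alpha>) g" "0 \<le> \<alpha> / (L - f \<alpha>)"
    using lipschitz_decreasing_initial_arc[OF s.curve, of "f \<alpha>"] \<alpha> fa by (auto simp: ga)
  show "near_one_with_rate (optimal_stretches L f) e"
    "(\<lambda>r. real (min_lattice_count L f r) - (r\<^sup>2 * curve_area L f + r * L)) \<in> O[at_top](\<lambda>r. r powr (1 - 2 * e))"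
    using optimal_stretch_asymptotics[OF \<alpha> e'(1,2) sawtooth_sum_rate[OF f lf] sawtooth_sum_rate[OF g lg]] e' pos by blast+
qed

theorem theorem7:
  fixes f g :: "real \<Rightarrow> real" and L \<alpha> \<beta> :: real
  assumes "0 < L"
    and "decreasing_concave_curve L f"
    and "\<And>x. x \<in> {0..L} \<Longrightarrow> g (f x) = x"
    and "\<alpha> \<in> {0..L}" and "\<beta> = f \<alpha>" and "0 < \<alpha>" and "0 < \<beta>"
  shows
    "(smooth_hypotheses \<alpha> f \<and> smooth_hypotheses \<beta> g \<longrightarrow>
        near_one_with_rate (optimal_stretches L f) (1 / 6) \<and>
        (\<lambda>r. real (min_lattice_count L f r) - (r\<^sup>2 * curve_area L f + r * L))
          \<in> O[at_top](\<lambda>r. r powr (2 / 3)))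
     \<and>
     (\<forall>(l :: nat) (m :: nat) (p :: nat \<Rightarrow> real) (q :: nat \<Rightarrow> real)
        (a1 :: real) (a2 :: real) (b1 :: real) (b2 :: real)
        (\<delta> :: real \<Rightarrow> real) (\<epsilon> :: real \<Rightarrow> real) (e :: real).
        piecewise_hypotheses \<alpha> l p f \<and> piecewise_hypotheses \<beta> m q g \<and>
        0 < a1 \<and> 0 < a2 \<and> 0 < b1 \<and> 0 < b2 \<and>
        decay_hypotheses \<alpha> f \<delta> a1 a2 \<and> decay_hypotheses \<beta> g \<epsilon> b1 b2 \<and>
        e = Min {1 / 6, a1, a2, b1, b2} \<longrightarrow>
        near_one_with_rate (optimal_stretches L f) e \<and>
        (\<lambda>r. real (min_lattice_count L f r) - (r\<^sup>2 * curve_area L f + r * L))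
          \<in> O[at_top](\<lambda>r. r powr (1 - 2 * e)))"
proof -
  interpret curve_pair L f g using assms(1-3) by unfold_locales auto
  have \<alpha>: "0 < \<alpha>" "\<alpha> < L"
    using assms(4-7) f_L by (auto simp: less_le)
  note main = piecewise_optimal_stretch[OF \<alpha>, folded \<open>\<beta> = f \<alpha>\<close>]
  show ?thesis
  proof (intro conjI impI allI; (elim conjE)?)
    assume sm: "smooth_hypotheses \<alpha> f" "smooth_hypotheses \<beta> g"
    note * = main[OF piecewise_of_smooth[OF \<open>0 < \<alpha>\<close> sm(1)] piecewise_of_smooth[OF \<open>0 < \<beta>\<close> sm(2)], of "1 / 6"]
    show "near_one_with_rate (optimal_stretches L f) (1 / 6)" by (rule *) auto
    show "(\<lambda>r. real (min_lattice_count L f r) - (r\<^sup>2 * curve_area L f + r * L)) \<in> O[at_top](\<lambda>r. r powr (2 / 3))"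
      using *(2) by simp
  next
    fix l m :: nat and p q :: "nat \<Rightarrow> real" and a1 a2 b1 b2 :: real and \<delta> \<epsilon> :: "real \<Rightarrow> real" and e :: real
    assume h: "piecewise_hypotheses \<alpha> l p f" "piecewise_hypotheses \<beta> m q g"
      "0 < a1" "0 < a2" "0 < b1" "0 < b2"
      "decay_hypotheses \<alpha> f \<delta> a1 a2" "decay_hypotheses \<beta> g \<epsilon> b1 b2" "e = Min {1 / 6, a1, a2, b1, b2}"
    show "near_one_with_rate (optimal_stretches L f) e"
      "(\<lambda>r. real (min_lattice_count L f r) - (r\<^sup>2 * curve_area L f + r * L)) \<in> O[at_top](\<lambda>r. r powr (1 - 2 * e))"
      using main[OF h(1,7,2,8,3-6,9)] by blast+
  qed
qed

end
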